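(* Under the LTI setting below, let $p_0\in L^2(\mathbb R^d)$ be a probability density with compact support, $T>0$, and define $\pi(t,x):=\tfrac12B^\top\nabla\log p^{\rm f}_{T-t}(x)$ for $t\in[0,T)$. Then for every $\epsilon\in(0,T)$ there exists a probability measure $\mathbb P$ on $\mathbb R^d\times C([0,T-\epsilon];\mathbb R^d)$ such that for $\mathbb P$-a.e. $(y,\gamma)$, $\gamma$ is absolutely continuous, $\gamma(0)=y$, and $\dot\gamma_t=-A\gamma_t+B\pi(t,\gamma_t)$ for a.e. $t\in[0,T-\epsilon]$, and $\mathbb P(\gamma_t\in dx)=p^{\rm f}_{T-t}(x)\,dx$ for all $t\in[0,T-\epsilon]$.
   Context: LTI setting: $A\in\mathbb R^{d\times d}$ has all eigenvalues in the open left half-plane; $B\in\mathbb R^{d\times m}$; the controllability Gramian $Q_t:=\int_0^te^{A\tau}BB^\top e^{A^\top\tau}\,d\tau$ is invertible for every $t>0$. For $t>0$ define the Gaussian kernel $K(t,x,y):=(2\pi)^{-d/2}\det(Q_t)^{-1/2}\exp\!\big(-\tfrac12(y-e^{At}x)^\top Q_t^{-1}(y-e^{At}x)\big)$, and for a probability density $p_0$ on $\mathbb R^d$ the forward density $p^{\rm f}_t(y):=\int_{\mathbb R^d}K(t,x,y)p_0(x)\,dx$ ($t>0$), $p^{\rm f}_0:=p_0$ (it solves $\partial_tp=-\mathrm{div}(Ayp)+\tfrac12\sum_{j,k}(BB^\top)_{jk}\partial_{y_j}\partial_{y_k}p$, so the time-reversed dynamics has drift $-Ax$). *)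

theory Defs
  imports "HOL-Analysis.Analysis" "HOL-Probability.Probability"
begin

text \<open>Matrix powers and the matrix exponential e^{tA} (defined by its power series).\<close>
definition mpow :: "real^'n^'n \<Rightarrow> nat \<Rightarrow> real^'n^'n" where
  "mpow M k = (((**) M) ^^ k) (mat 1)"

definition mexp :: "real \<Rightarrow> real^'n^'n \<Rightarrow> real^'n^'n" where
  "mexp t M = (\<Sum>k. ((t ^ k) / fact k) *\<^sub>R mpow M k)"

text \<open>Complex eigenvalues of a real square matrix.\<close>
definition is_eigenvalue :: "real^'n^'n \<Rightarrow> complex \<Rightarrow> bool" where
  "is_eigenvalue M c \<longleftrightarrow>
     (\<exists>v :: complex^'n. v \<noteq> 0 \<and> (map_matrix complex_of_real M) *v v = c *s v)"

text \<open>Controllability Gramian Q_t.\<close>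
definition gramian :: "real^'n^'n \<Rightarrow> real^'m^'n \<Rightarrow> real \<Rightarrow> real^'n^'n" where
  "gramian A B t = integral {0..t}
     (\<lambda>\<tau>. mexp \<tau> A ** B ** transpose B ** transpose (mexp \<tau> A))"

text \<open>Gaussian transition kernel K(t,x,y).\<close>
definition kernel :: "real^'n^'n \<Rightarrow> real^'m^'n \<Rightarrow> real \<Rightarrow> real^'n \<Rightarrow> real^'n \<Rightarrow> real" where
  "kernel A B t x y =
     (2 * pi) powr (- real CARD('n) / 2) * det (gramian A B t) powr (-1/2) *
     exp (- (1/2) * ((y - mexp t A *v x) \<bullet> (matrix_inv (gramian A B t) *v (y - mexp t A *v x))))"

text \<open>Forward density p^f_t.\<close>
definition fwd_density ::
  "real^'n^'n \<Rightarrow> real^'m^'n \<Rightarrow> (real^'n \<Rightarrow> real) \<Rightarrow> real \<Rightarrow> real^'n \<Rightarrow> real" where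
  "fwd_density A B p0 t y =
     (if t = 0 then p0 y else \<integral>x. kernel A B t x y * p0 x \<partial>lborel)"

text \<open>Gradient of a real-valued function on R^d (via the Frechet derivative).\<close>
definition grad :: "(real^'n \<Rightarrow> real) \<Rightarrow> real^'n \<Rightarrow> real^'n" where
  "grad f x = (\<chi> i. frechet_derivative f (at x) (axis i 1))"

text \<open>The control pi(t,x) = 1/2 B^T grad log p^f_{T-t}(x).\<close>
definition policy ::
  "real^'n^'n \<Rightarrow> real^'m^'n \<Rightarrow> (real^'n \<Rightarrow> real) \<Rightarrow> real \<Rightarrow> real \<Rightarrow> real^'n \<Rightarrow> real^'m" where
  "policy A B p0 T t x = (1/2) *\<^sub>R (transpose B *v grad (\<lambda>z. ln (fwd_density A B p0 (T - t) z)) x)"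

text \<open>Absolute continuity of a vector-valued function on an interval [a,b].\<close>
definition abs_cont_on :: "(real \<Rightarrow> 'a::real_normed_vector) \<Rightarrow> real \<Rightarrow> real \<Rightarrow> bool" where
  "abs_cont_on f a b \<longleftrightarrow>
     (\<forall>e>0. \<exists>\<delta>>0. \<forall>(n::nat) (s::nat \<Rightarrow> real) (u::nat \<Rightarrow> real).
        (\<forall>i<n. a \<le> s i \<and> s i \<le> u i \<and> u i \<le> b) \<and>
        (\<forall>i<n. \<forall>j<n. i \<noteq> j \<longrightarrow> u i \<le> s j \<or> u j \<le> s i) \<and>
        (\<Sum>i<n. u i - s i) < \<delta>
        \<longrightarrow> (\<Sum>i<n. norm (f (u i) - f (s i))) < e)"

end

theory Submission
  imports Defs
begin

text \<open>The forward density solves the continuity equation \<open>\<partial>\<^sub>s p + div (b p) = 0\<close> for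
  \<open>b(s, y) = A y - (1/2) B B\<^sup>T \<nabla> log p\<^sub>s(y)\<close>, and the controlled dynamics is the time reversal
  \<open>v(t, x) = - b(T - t, x)\<close> of its characteristics. Compactness of the support of \<open>p\<^sub>0\<close> bounds the
  Hessian of \<open>log p\<^sub>s\<close> uniformly for \<open>s \<ge> \<epsilon>\<close>, so \<open>v\<close> is globally Lipschitz and has a flow
  \<open>\<Phi>\<close>; \<open>\<P>\<close> is the law of the whole trajectory of the flow started from \<open>p\<^sub>T\<close>.

  The marginals are identified by duality. For a compactly supported Lipschitz \<open>\<phi>\<close> the function
  \<open>F(s) = \<integral> \<phi>(\<Phi>\<^sub>s\<^sub>,\<^sub>\<tau>(x)) q\<^sub>s(x) dx\<close> with \<open>q\<^sub>s = p\<^bsub>T-s\<^esub>\<close> has vanishing derivative: replace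
  the flow over \<open>[s, s + h]\<close> by the Euler step \<open>x + h v(s, x)\<close>, change variables, and use that
  the Jacobian is \<open>1 + h div v + o(h)\<close>. No differentiability of the flow is needed.\<close>

section \<open>Change of variables for an arbitrary finite index type\<close>

text \<open>Each increment of \<open>F\<close> splits into two errors. The Euler step misses the
  flow, which the Lipschitz constant of \<open>\<phi>\<close> composed with the flow absorbs; and
  the new density, pulled back with its Jacobian, misses the old one, where the first-order terms
  cancel by the continuity equation. Both errors are o(h) uniformly in time on one fixed ball, to
  which growth bounds in both time directions confine the argument. This uniformity also turns a
  bound on forward increments into a two-sided derivative.

  The terminal time of the transport argument is a parameter: running it with horizon t, and
  identifying the flows by uniqueness, gives the marginal at every t from a statement about end
  points only.

  The forward equation is verified on averages: the Lyapunov equation of the Gramian gives the time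
  derivative of the kernel in closed form, and integration against \<open>p\<^sub>0\<close> leaves
  an identity between a few weighted moments. The inverse Gramian is controlled only away from time
  0, hence the margin \<epsilon>.\<close>

text \<open>The change of variables formula of the library is stated for vectors over a well-ordered index type.
  This copy of the index type carries such an order, and reindexing removes the restriction.\<close>

typedef ('n::finite) ordered_index = "{..<CARD('n)}"
  by (auto intro!: exI[of _ 0])

setup_lifting type_definition_ordered_index

instantiation ordered_index :: (finite) linorder
begin

lift_definition less_eq_ordered_index :: "'a ordered_index \<Rightarrow> 'a ordered_index \<Rightarrow> bool" is "(\<le>)" .
lift_definition less_ordered_index :: "'a ordered_index \<Rightarrow> 'a ordered_index \<Rightarrow> bool" is "(<)" .

instance
  by standard (transfer; auto)+

end

instance ordered_index :: (finite) finite
  by standard (simp add: type_definition.univ[OF type_definition_ordered_index])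

instance ordered_index :: (finite) wellorder
proof
  fix P :: "'a ordered_index \<Rightarrow> bool" and a
  assume step: "\<And>x. (\<And>y. y < x \<Longrightarrow> P y) \<Longrightarrow> P x"
  show "P a"
  proof (induction "Rep_ordered_index a" arbitrary: a rule: less_induct)
    case less
    show ?case
      by (rule step, rule less) (simp add: less_ordered_index.rep_eq)
  qed
qed

lemma card_ordered_index: "CARD('n::finite ordered_index) = CARD('n)"
  using type_definition.card[OF type_definition_ordered_index] by simp

definition reindex :: "('m \<Rightarrow> 'n) \<Rightarrow> real^'n::finite \<Rightarrow> real^'m::finite" where
  "reindex \<beta> x = (\<chi> i. x $ \<beta> i)"

lemma linear_reindex: "linear (reindex \<beta>)"
  by (auto simp: reindex_def vec_eq_iff intro!: linearI)

lemma bounded_linear_reindex: "bounded_linear (reindex \<beta>)"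
  using linear_reindex linear_linear by blast

lemma reindex_reindex: "reindex \<beta> (reindex \<alpha> x) = reindex (\<alpha> \<circ> \<beta>) x"
  by (simp add: reindex_def)

lemma reindex_id [simp]: "reindex id x = x"
  by (simp add: reindex_def)

lemma reindex_measurable [measurable]: "reindex \<beta> \<in> borel_measurable borel"
  by (intro borel_measurable_continuous_onI linear_continuous_on bounded_linear_reindex)

lemma Basis_vec_real: "(Basis :: (real^'n) set) = range (\<lambda>i. axis i 1)"
  by (auto simp: Basis_vec_def)

text \<open>Lebesgue measure is determined by its values on boxes; a bijective relabelling of
  coordinates pulls boxes back to boxes and merely permutes the side lengths in the product.\<close>

lemma lborel_reindex:
  fixes \<beta> :: "'m::finite \<Rightarrow> 'n::finite"
  assumes "bij \<beta>"
  shows "distr lborel borel (reindex \<beta>) = lborel"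
proof (rule lborel_eqI[symmetric])
  fix l u :: "real^'m" assume le: "\<And>b. b \<in> Basis \<Longrightarrow> l \<bullet> b \<le> u \<bullet> b"
  let ?r = "reindex (inv \<beta>)"
  have inv: "inv \<beta> (\<beta> i) = i" "\<beta> (inv \<beta> j) = j" for i j
    using assms by (auto simp: bij_is_inj bij_is_surj surj_f_inv_f)
  have box: "reindex \<beta> -` box l u = box (?r l) (?r u)"
    by (auto simp: mem_box_cart reindex_def) (metis inv)+
  have prods: "(\<Prod>b\<in>Basis. (u - l) \<bullet> b) = (\<Prod>i\<in>UNIV. u$i - l$i)" for u l :: "real^'k::finite"
    unfolding Basis_vec_real
    by (subst prod.reindex) (auto simp: inj_on_def axis_eq_axis cart_eq_inner_axis[symmetric])
  have le': "(?r l) \<bullet> b \<le> (?r u) \<bullet> b" if b_in: "b \<in> Basis" for b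
  proof -
    obtain i where b: "b = axis i 1" using b_in unfolding Basis_vec_real by blast
    show ?thesis using le[of "axis (inv \<beta> i) 1"] unfolding b
      by (simp add: reindex_def cart_eq_inner_axis[symmetric])
  qed
  have "emeasure (distr lborel borel (reindex \<beta>)) (box l u) = emeasure lborel (box (?r l) (?r u))"
    by (subst emeasure_distr) (auto simp: box)
  also have "\<dots> = (\<Prod>b\<in>Basis. (?r u - ?r l) \<bullet> b)"
    using le' by (subst emeasure_lborel_box) auto
  also have "(\<Prod>b\<in>Basis. (?r u - ?r l) \<bullet> b) = (\<Prod>i\<in>UNIV. u $ inv \<beta> i - l $ inv \<beta> i)"
    unfolding prods by (simp add: reindex_def)
  also have "\<dots> = (\<Prod>i\<in>UNIV. u $ i - l $ i)"
    by (rule prod.reindex_bij_betw[OF bij_imp_bij_inv[OF assms], of "\<lambda>i. u $ i - l $ i"])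
  also have "\<dots> = (\<Prod>b\<in>Basis. (u - l) \<bullet> b)"
    unfolding prods ..
  finally show "emeasure (distr lborel borel (reindex \<beta>)) (box l u) = (\<Prod>b\<in>Basis. (u - l) \<bullet> b)" .
qed simp

text \<open>Conjugation by \<open>\<beta>\<close> matches the permutations in the two Leibniz sums,
  preserving both the sign and the product of entries.\<close>

lemma det_reindex:
  fixes \<beta> :: "'m::finite \<Rightarrow> 'n::finite" and M :: "real^'n^'n"
  assumes "bij \<beta>"
  shows "det (\<chi> i j. M $ \<beta> i $ \<beta> j) = det M"
proof -
  let ?\<alpha> = "inv \<beta>"
  have \<alpha>: "bij ?\<alpha>" by (rule bij_imp_bij_inv[OF assms])
  have inv: "?\<alpha> (\<beta> i) = i" "\<beta> (?\<alpha> j) = j" for i j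
    using assms by (auto simp: bij_is_inj bij_is_surj surj_f_inv_f)
  have conj: "map_permutation UNIV f p = f \<circ> p \<circ> inv f" if "bij f" for f :: "'a \<Rightarrow> 'b" and p
    using that by (auto simp: map_permutation_def bij_is_surj restrict_id_def)
  have "det M = (\<Sum>p\<in>{p. p permutes (UNIV::'n set)}. of_int (sign p) * (\<Prod>i\<in>UNIV. M $ i $ p i))"
    by (simp add: det_def)
  also have "\<dots> = (\<Sum>p\<in>{p. p permutes (UNIV::'m set)}. of_int (sign p) * (\<Prod>i\<in>UNIV. M $ \<beta> i $ \<beta> (p i)))"
  proof (rule sum.reindex_bij_witness[where i = "map_permutation UNIV \<beta>" and j = "map_permutation UNIV ?\<alpha>"])
    fix p assume p: "p \<in> {p. p permutes (UNIV::'n set)}"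
    show "map_permutation UNIV \<beta> (map_permutation UNIV ?\<alpha> p) = p"
      using assms \<alpha> by (auto simp: conj inv_inv_eq inv)
    show "map_permutation UNIV ?\<alpha> p \<in> {p. p permutes (UNIV::'m set)}"
      using map_permutation_permutes[of ?\<alpha> UNIV UNIV p] p \<alpha> by auto
    have "sign (map_permutation UNIV ?\<alpha> p) = sign p"
      using p \<alpha> by (intro sign_map_permutation) (auto simp: bij_is_inj)
    moreover have "(\<Prod>i\<in>UNIV. M $ \<beta> i $ \<beta> (map_permutation UNIV ?\<alpha> p i)) = (\<Prod>i\<in>UNIV. M $ i $ p i)"
      using prod.reindex_bij_betw[of \<beta> UNIV UNIV "\<lambda>i. M $ i $ p i"] assms
      by (simp add: conj[OF \<alpha>] inv_inv_eq inv)
    ultimately show "of_int (sign (map_permutation UNIV ?\<alpha> p)) * (\<Prod>i\<in>UNIV. M $ \<beta> i $ \<beta> (map_permutation UNIV ?\<alpha> p i))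
       = of_int (sign p) * (\<Prod>i\<in>UNIV. M $ i $ p i)"
      by simp
  next
    fix p assume p: "p \<in> {p. p permutes (UNIV::'m set)}"
    show "map_permutation UNIV ?\<alpha> (map_permutation UNIV \<beta> p) = p"
      using assms \<alpha> by (auto simp: conj inv_inv_eq inv)
    show "map_permutation UNIV \<beta> p \<in> {p. p permutes (UNIV::'n set)}"
      using map_permutation_permutes[of \<beta> UNIV UNIV p] p assms by auto
  qed
  also have "\<dots> = det (\<chi> i j. M $ \<beta> i $ \<beta> j)"
    by (simp add: det_def)
  finally show ?thesis ..
qed

text \<open>The underlying formula concerns vector-valued integrands and absolute gauge
  integrability, so \<open>f\<close> is wrapped into \<open>real^1\<close> and integrability is
  moved between \<open>lborel\<close> and its completion. Bijectivity makes the image the whole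
  space.\<close>

lemma change_of_variables_wellorder:
  fixes f :: "real^'n::{finite,wellorder} \<Rightarrow> real" and g :: "real^'n::_ \<Rightarrow> real^'n::_"
  assumes der: "\<And>x. (g has_derivative g' x) (at x)" and g: "bij g"
    and [measurable]: "(\<lambda>x. det (matrix (g' x))) \<in> borel_measurable borel"
    and f: "integrable lborel f"
  shows "integrable lborel (\<lambda>x. \<bar>det (matrix (g' x))\<bar> * f (g x))"
    and "(\<integral>x. \<bar>det (matrix (g' x))\<bar> * f (g x) \<partial>lborel) = (\<integral>x. f x \<partial>lborel)"
proof -
  have [measurable]: "f \<in> borel_measurable borel" using f by auto
  have [measurable]: "g \<in> borel_measurable borel"
    by (intro borel_measurable_continuous_onI)
      (metis der has_derivative_continuous continuous_at_imp_continuous_on)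
  let ?F = "\<lambda>x. vec (f x) :: real^1"
  let ?h = "\<lambda>x. \<bar>det (matrix (g' x))\<bar> * f (g x)"
  have fL: "f absolutely_integrable_on UNIV" "integral UNIV f = integral\<^sup>L lborel f"
    using f by (auto simp: set_integrable_def integrable_completion integral_lborel)
  have "?F absolutely_integrable_on (g ` UNIV) \<and> integral (g ` UNIV) ?F = vec (integral UNIV f)"
    using fL(1) set_lebesgue_integral_eq_integral(1)[OF fL(1)] g
    by (simp add: bij_is_surj absolutely_integrable_on_1_iff integral_on_1_eq)
  then have "(\<lambda>x. \<bar>det (matrix (g' x))\<bar> *\<^sub>R ?F (g x)) absolutely_integrable_on UNIV \<and>
           integral UNIV (\<lambda>x. \<bar>det (matrix (g' x))\<bar> *\<^sub>R ?F (g x)) = vec (integral UNIV f)"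
    using has_absolute_integral_change_of_variables[of UNIV g g' ?F "vec (integral UNIV f)"] der g
    by (auto simp: bij_is_inj)
  then have h: "?h absolutely_integrable_on UNIV" "integral UNIV ?h = integral UNIV f"
    by (auto simp: absolutely_integrable_on_1_iff integral_on_1_eq vec_eq_iff)
  show i: "integrable lborel ?h"
    using h(1) by (simp add: set_integrable_def integrable_completion)
  show "(\<integral>x. ?h x \<partial>lborel) = (\<integral>x. f x \<partial>lborel)"
    using h(2) fL(2) integral_lborel[OF i] by simp
qed

text \<open>Conjugating \<open>g\<close> with the relabelling moves the problem to the ordered index
  type. Relabelling preserves Lebesgue measure, and it changes the Jacobian matrix only by the same
  permutation of rows and columns.\<close>

lemma change_of_variables:
  fixes f :: "real^'n::finite \<Rightarrow> real" and g :: "real^'n::_ \<Rightarrow> real^'n::_"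
  assumes der: "\<And>x. (g has_derivative g' x) (at x)" and g: "bij g"
    and [measurable]: "(\<lambda>x. det (matrix (g' x))) \<in> borel_measurable borel"
    and f: "integrable lborel f"
  shows "integrable lborel (\<lambda>x. \<bar>det (matrix (g' x))\<bar> * f (g x))"
    and "(\<integral>x. \<bar>det (matrix (g' x))\<bar> * f (g x) \<partial>lborel) = (\<integral>x. f x \<partial>lborel)"
proof -
  obtain \<beta> :: "'n ordered_index \<Rightarrow> 'n" where \<beta>: "bij \<beta>"
    using finite_same_card_bij[of "UNIV :: 'n ordered_index set" "UNIV :: 'n set"]
    by (auto simp: card_ordered_index)
  define r where "r = reindex \<beta>"
  define r' where "r' = reindex (inv \<beta>)"
  have rr [simp]: "r (r' x) = x" "r' (r y) = y" for x y
    using \<beta> by (simp_all add: r_def r'_def reindex_reindex bij_is_inj bij_is_surj surj_iff[symmetric])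
      (metis bij_is_surj reindex_id surj_iff)+
  have bl: "bounded_linear r" "bounded_linear r'"
    by (simp_all add: r_def r'_def bounded_linear_reindex)
  have [measurable]: "r \<in> borel_measurable borel" "r' \<in> borel_measurable borel"
    by (simp_all add: r_def r'_def)
  have [measurable]: "f \<in> borel_measurable borel" using f by auto
  have [measurable]: "g \<in> borel_measurable borel"
    by (intro borel_measurable_continuous_onI)
      (metis der has_derivative_continuous continuous_at_imp_continuous_on)
  have lb: "distr lborel borel r = lborel" "distr lborel borel r' = lborel"
    using \<beta> by (auto simp: r_def r'_def intro!: lborel_reindex bij_imp_bij_inv)
  let ?g = "\<lambda>x. r (g (r' x))"
  let ?g' = "\<lambda>x h. r (g' (r' x) (r' h))"
  have det: "det (matrix (?g' x)) = det (matrix (g' (r' x)))" for x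
  proof -
    have inv: "inv \<beta> i = j \<longleftrightarrow> i = \<beta> j" for i j
      using \<beta> by (metis bij_inv_eq_iff)
    have ax: "r' (axis j 1) = axis (\<beta> j) 1" for j
      by (auto simp: r'_def reindex_def axis_def vec_eq_iff inv)
    have "matrix (?g' x) = (\<chi> i j. matrix (g' (r' x)) $ \<beta> i $ \<beta> j)"
      by (simp add: matrix_def ax vec_eq_iff) (simp add: r_def reindex_def)
    then show ?thesis using det_reindex[OF \<beta>] by simp
  qed
  have der': "(?g has_derivative ?g' x) (at x)" for x
    using bounded_linear.has_derivative[OF bl(1) has_derivative_compose[OF bounded_linear.has_derivative[OF bl(2) has_derivative_ident] der]]
    by (simp add: o_def)
  have bij': "bij ?g"
  proof (rule o_bij[of "\<lambda>x. r (inv g (r' x))"])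
    show "(\<lambda>x. r (inv g (r' x))) \<circ> ?g = id" "?g \<circ> (\<lambda>x. r (inv g (r' x))) = id"
      using g by (auto simp: o_def bij_is_inj bij_is_surj surj_f_inv_f)
  qed
  have f': "integrable lborel (\<lambda>x. f (r' x))" "(\<integral>x. f (r' x) \<partial>lborel) = (\<integral>x. f x \<partial>lborel)"
  proof -
    show "integrable lborel (\<lambda>x. f (r' x))"
      using f by (subst (asm) lb(2)[symmetric], subst (asm) integrable_distr_eq) auto
    show "(\<integral>x. f (r' x) \<partial>lborel) = (\<integral>x. f x \<partial>lborel)"
      using integral_distr[of r' lborel borel f] by (simp add: lb(2))
  qed
  have m': "(\<lambda>x. det (matrix (?g' x))) \<in> borel_measurable borel"
    unfolding det by measurable
  note * = change_of_variables_wellorder[of ?g ?g' "\<lambda>x. f (r' x)", OF der' bij' m' f'(1), unfolded det, simplified]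
  show "integrable lborel (\<lambda>x. \<bar>det (matrix (g' x))\<bar> * f (g x))"
    using *(1) by (subst lb(2)[symmetric], subst integrable_distr_eq) auto
  show "(\<integral>x. \<bar>det (matrix (g' x))\<bar> * f (g x) \<partial>lborel) = (\<integral>x. f x \<partial>lborel)"
    using *(2) f'(2) by (subst lb(2)[symmetric], subst integral_distr) auto
qed

section \<open>Globally Lipschitz differential equations\<close>

text \<open>Freezing a function at its end values embeds paths on \<open>{a..b}\<close> into the
  complete space of bounded continuous functions on the line. Both the fixed-point argument and the
  path space of the final measure use this encoding.\<close>

lemma bcontfun_clampE:
  fixes f :: "real \<Rightarrow> 'a::metric_space"
  assumes "continuous_on {a..b} f" "a \<le> b"
  obtains g where "\<And>t. apply_bcontfun g t = f (max a (min b t))"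
proof -
  obtain g where g: "\<And>x. apply_bcontfun g x = f (clamp a b x)"
    using continuous_on_cbox_bcontfunE[of a b f] assms(1) by (metis cbox_interval)
  have "clamp a b t = max a (min b t)" for t
    unfolding clamp_def Basis_real_def using assms(2) by auto
  then show thesis using g that by auto
qed

lemma picard_lindelof_global:
  fixes v :: "real \<Rightarrow> 'a::euclidean_space \<Rightarrow> 'a"
  assumes cont: "continuous_on ({a..b} \<times> UNIV) (\<lambda>(t, x). v t x)"
    and L: "L > 0" and lip: "\<And>t x y. t \<in> {a..b} \<Longrightarrow> norm (v t x - v t y) \<le> L * norm (x - y)"
    and ab: "a \<le> b"
  shows "\<exists>\<gamma>. \<gamma> a = x0 \<and> (\<forall>t\<in>{a..b}. (\<gamma> has_vector_derivative v t (\<gamma> t)) (at t within {a..b}))"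
proof -
  \<comment> \<open>Bielecki's weight: with \<open>\<gamma> t = exp (2 L (t - a)) g t\<close> the Picard operator on \<open>g\<close> is a
    contraction on the whole interval.\<close>
  define e where "e t = exp (2 * L * (t - a))" for t
  define c where "c t = max a (min b t)" for t
  have c: "c t \<in> {a..b}" "t \<in> {a..b} \<Longrightarrow> c t = t" for t
    using ab by (auto simp: c_def)
  have e_pos: "e t > 0" for t by (simp add: e_def)
  have cont_e: "continuous_on S e" for S
    unfolding e_def by (intro continuous_intros)
  have cont_v: "continuous_on {a..b} (\<lambda>s. v s (e s *\<^sub>R apply_bcontfun g s))" for g
  proof -
    have "continuous_on {a..b} ((\<lambda>(t, x). v t x) \<circ> (\<lambda>s. (s, e s *\<^sub>R apply_bcontfun g s)))"
      by (rule continuous_on_compose, intro continuous_intros cont_e continuous_on_apply_bcontfun)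
        (auto intro: continuous_on_subset[OF cont])
    then show ?thesis by (simp add: o_def)
  qed
  define I where "I g t = integral {a..t} (\<lambda>s. v s (e s *\<^sub>R apply_bcontfun g s))" for g t
  define H where "H g t = (1 / e t) *\<^sub>R (x0 + I g t)" for g t
  have cont_H: "continuous_on {a..b} (H g)" for g
    unfolding H_def I_def using e_pos
    by (intro continuous_intros cont_e indefinite_integral_continuous_1 integrable_continuous_interval cont_v)
      (auto simp: less_imp_neq[symmetric])
  have "\<exists>h. \<forall>t. apply_bcontfun h t = H g (c t)" for g
    unfolding c_def using bcontfun_clampE[OF cont_H ab] by metis
  then obtain F where F: "\<And>g t. apply_bcontfun (F g) t = H g (c t)" by metis
  have contr: "dist (F g) (F h) \<le> (1/2) * dist g h" for g h
  proof (rule dist_bound)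
    fix t
    let ?t = "c t"
    have t: "a \<le> ?t" "?t \<le> b" using c(1)[of t] by auto
    have int: "(\<lambda>s. v s (e s *\<^sub>R apply_bcontfun g s)) integrable_on {a..?t}" for g
      using t by (intro integrable_continuous_interval continuous_on_subset[OF cont_v]) auto
    \<comment> \<open>The exponent \<open>2 * L\<close> of the weight is chosen here:
      \<open>L * e s\<close> has the antiderivative \<open>e s / 2\<close>, and division by
      \<open>e\<close> then leaves the contraction factor 1/2.\<close>
    have D: "((\<lambda>s. L * e s * dist g h) has_integral (e ?t / 2 - e a / 2) * dist g h) {a..?t}"
    proof (intro has_integral_mult_left fundamental_theorem_of_calculus t(1))
      fix s assume "s \<in> {a..?t}"
      show "((\<lambda>s. e s / 2) has_vector_derivative L * e s) (at s within {a..?t})"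
        unfolding e_def has_real_derivative_iff_has_vector_derivative[symmetric]
        by (auto intro!: derivative_eq_intros)
    qed
    have "norm (I g ?t - I h ?t) = norm (integral {a..?t} (\<lambda>s. v s (e s *\<^sub>R apply_bcontfun g s) - v s (e s *\<^sub>R apply_bcontfun h s)))"
      unfolding I_def by (simp add: integral_diff[OF int int])
    also have "\<dots> \<le> integral {a..?t} (\<lambda>s. L * e s * dist g h)"
    proof (rule integral_norm_bound_integral)
      show "(\<lambda>s. L * e s * dist g h) integrable_on {a..?t}" using D by blast
      fix s assume "s \<in> {a..?t}"
      then have "norm (v s (e s *\<^sub>R apply_bcontfun g s) - v s (e s *\<^sub>R apply_bcontfun h s))
        \<le> L * norm (e s *\<^sub>R apply_bcontfun g s - e s *\<^sub>R apply_bcontfun h s)"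
        using t by (intro lip) auto
      also have "\<dots> = L * (e s * dist (apply_bcontfun g s) (apply_bcontfun h s))"
        using e_pos[of s] by (simp add: scaleR_diff_right[symmetric] dist_norm)
      also have "\<dots> \<le> L * (e s * dist g h)"
        using e_pos[of s] L by (intro mult_left_mono dist_bounded) auto
      finally show "norm (v s (e s *\<^sub>R apply_bcontfun g s) - v s (e s *\<^sub>R apply_bcontfun h s)) \<le> L * e s * dist g h"
        by (simp add: mult.assoc)
    qed (intro integrable_diff int)
    also have "\<dots> = (e ?t / 2 - e a / 2) * dist g h" using D by (rule integral_unique)
    also have "\<dots> \<le> (e ?t / 2) * dist g h"
      using e_pos[of a] by (intro mult_right_mono) auto
    finally have "norm (I g ?t - I h ?t) \<le> (e ?t / 2) * dist g h" .
    then have "norm (I g ?t - I h ?t) / e ?t \<le> dist g h / 2"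
      using e_pos[of ?t] by (simp add: field_simps)
    then show "dist (apply_bcontfun (F g) t) (apply_bcontfun (F h) t) \<le> (1/2) * dist g h"
      using e_pos[of ?t]
      by (simp add: F H_def dist_norm scaleR_diff_right[symmetric])
  qed
  obtain g where g: "F g = g"
    using banach_fix_type[of "1/2" F] contr by auto
  define \<gamma> where "\<gamma> t = e t *\<^sub>R apply_bcontfun g t" for t
  have \<gamma>: "\<gamma> t = x0 + I g t" if "t \<in> {a..b}" for t
  proof -
    have "apply_bcontfun g t = H g t"
      using F[of g t] c(2)[OF that] by (simp add: g)
    then show ?thesis using e_pos[of t] by (simp add: \<gamma>_def H_def)
  qed
  have "(\<gamma> has_vector_derivative v t (\<gamma> t)) (at t within {a..b})" if t: "t \<in> {a..b}" for t
  proof -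
    have "(I g has_vector_derivative v t (\<gamma> t)) (at t within {a..b})"
      using integral_has_vector_derivative[OF cont_v[of g] t] by (simp add: I_def[abs_def] \<gamma>_def)
    then have "((\<lambda>t. x0 + I g t) has_vector_derivative v t (\<gamma> t)) (at t within {a..b})"
      by (auto intro!: derivative_eq_intros)
    then show ?thesis
      by (rule has_vector_derivative_transform[OF t, rotated]) (auto simp: \<gamma>)
  qed
  moreover have "\<gamma> a = x0" using \<gamma>[of a] ab by (simp add: I_def)
  ultimately show ?thesis by blast
qed

definition solves_ode :: "(real \<Rightarrow> 'a::real_normed_vector \<Rightarrow> 'a) \<Rightarrow> (real \<Rightarrow> 'a) \<Rightarrow> real \<Rightarrow> real \<Rightarrow> bool" where
  "solves_ode v \<gamma> a b \<longleftrightarrow> (\<forall>t\<in>{a..b}. (\<gamma> has_vector_derivative v t (\<gamma> t)) (at t within {a..b}))"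

lemma solves_ode_subset:
  "solves_ode v \<gamma> a b \<Longrightarrow> a \<le> a' \<Longrightarrow> b' \<le> b \<Longrightarrow> solves_ode v \<gamma> a' b'"
  unfolding solves_ode_def by (meson atLeastAtMost_iff atLeastatMost_subset_iff
      has_vector_derivative_within_subset order_trans)

lemma solves_ode_continuous: "solves_ode v \<gamma> a b \<Longrightarrow> continuous_on {a..b} \<gamma>"
  unfolding solves_ode_def
  by (meson continuous_on_eq_continuous_within has_vector_derivative_continuous)

text \<open>Gronwall's inequality in both time directions: \<open>exp (- k * t) * f t\<close>
  decreases and \<open>exp (k * t) * f t\<close> increases. The backward bound later keeps preimages
  of balls under the flow bounded.\<close>

lemma exp_weighted_le:
  fixes f :: "real \<Rightarrow> real"
  assumes der: "\<And>t. t \<in> {a..b} \<Longrightarrow> (f has_real_derivative f' t) (at t within {a..b})"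
    and bound: "\<And>t. t \<in> {a..b} \<Longrightarrow> \<bar>f' t\<bar> \<le> k * f t" and ab: "a \<le> b"
  shows "f b \<le> exp (k * (b - a)) * f a" "f a \<le> exp (k * (b - a)) * f b"
proof -
  have 1: "exp (- k * b) * f b \<le> exp (- k * a) * f a"
  proof (rule DERIV_nonpos_imp_decreasing_open[OF ab])
    fix t assume t: "a < t" "t < b"
    have "((\<lambda>t. exp (- k * t) * f t) has_real_derivative exp (- k * t) * (f' t - k * f t)) (at t)"
      using der[of t] t at_within_Icc_at[of a t b]
      by (auto intro!: derivative_eq_intros simp: algebra_simps)
    moreover have "exp (- k * t) * (f' t - k * f t) \<le> 0"
      using bound[of t] t by (intro mult_nonneg_nonpos) auto
    ultimately show "\<exists>y. ((\<lambda>t. exp (- k * t) * f t) has_real_derivative y) (at t) \<and> y \<le> 0" by blast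
  next
    show "continuous_on {a..b} (\<lambda>t. exp (- k * t) * f t)"
      using der by (intro continuous_intros) (meson DERIV_continuous continuous_on_eq_continuous_within)
  qed
  have 2: "exp (k * a) * f a \<le> exp (k * b) * f b"
  proof (rule DERIV_nonneg_imp_increasing_open[OF ab])
    fix t assume t: "a < t" "t < b"
    have "((\<lambda>t. exp (k * t) * f t) has_real_derivative exp (k * t) * (f' t + k * f t)) (at t)"
      using der[of t] t at_within_Icc_at[of a t b]
      by (auto intro!: derivative_eq_intros simp: algebra_simps)
    moreover have "exp (k * t) * (f' t + k * f t) \<ge> 0"
      using bound[of t] t by (intro mult_nonneg_nonneg) auto
    ultimately show "\<exists>y. ((\<lambda>t. exp (k * t) * f t) has_real_derivative y) (at t) \<and> y \<ge> 0" by blast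
  next
    show "continuous_on {a..b} (\<lambda>t. exp (k * t) * f t)"
      using der by (intro continuous_intros) (meson DERIV_continuous continuous_on_eq_continuous_within)
  qed
  have E: "exp (k * (b - a)) = exp (k * b) * exp (- k * a)"
    by (simp add: exp_add[symmetric] algebra_simps)
  have b: "exp (k * b) * exp (- k * b) = 1" and a: "exp (k * a) * exp (- k * a) = 1"
    by (simp_all add: exp_minus)
  have "f b = exp (k * b) * (exp (- k * b) * f b)" using b by algebra
  also have "\<dots> \<le> exp (k * b) * (exp (- k * a) * f a)" using 1 by (intro mult_left_mono) auto
  finally show "f b \<le> exp (k * (b - a)) * f a" unfolding E by (simp add: mult.assoc)
  have "f a = exp (- k * a) * (exp (k * a) * f a)" using a by algebra
  also have "\<dots> \<le> exp (- k * a) * (exp (k * b) * f b)" using 2 by (intro mult_left_mono) auto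
  finally show "f a \<le> exp (k * (b - a)) * f b" unfolding E by (simp add: mult_ac)
qed

lemma has_real_derivative_norm_power2:
  fixes \<gamma> :: "real \<Rightarrow> 'a::real_inner"
  assumes "(\<gamma> has_vector_derivative d) (at t within S)"
  shows "((\<lambda>t. (norm (\<gamma> t))\<^sup>2) has_real_derivative 2 * (\<gamma> t \<bullet> d)) (at t within S)"
proof -
  have \<gamma>: "(\<gamma> has_derivative (\<lambda>h. h *\<^sub>R d)) (at t within S)"
    using assms by (simp add: has_vector_derivative_def)
  have eq: "(\<lambda>h. \<gamma> t \<bullet> h *\<^sub>R d + (h *\<^sub>R d) \<bullet> \<gamma> t) = (\<lambda>h. 2 * (\<gamma> t \<bullet> d) * h)"
    by (simp add: fun_eq_iff inner_commute[of d "\<gamma> t"])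
  show ?thesis
    using has_derivative_inner[OF \<gamma> \<gamma>] unfolding eq
    by (simp add: power2_norm_eq_inner has_field_derivative_def)
qed

text \<open>Gronwall is applied to the squared distance, which stays differentiable where the two
  solutions meet; this doubles the rate, and the square root restores it.\<close>

lemma solves_ode_lipschitz:
  fixes v :: "real \<Rightarrow> 'a::euclidean_space \<Rightarrow> 'a"
  assumes lip: "\<And>t x y. t \<in> {a..b} \<Longrightarrow> norm (v t x - v t y) \<le> L * norm (x - y)"
    and sol: "solves_ode v \<gamma> a b" "solves_ode v \<eta> a b" and ab: "a \<le> b"
  shows "norm (\<gamma> b - \<eta> b) \<le> exp (L * (b - a)) * norm (\<gamma> a - \<eta> a)"
proof -
  let ?f = "\<lambda>t. (norm (\<gamma> t - \<eta> t))\<^sup>2"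
  have "?f b \<le> exp (2 * L * (b - a)) * ?f a"
  proof (rule exp_weighted_le(1)[OF _ _ ab])
    fix t assume t: "t \<in> {a..b}"
    let ?d = "2 * ((\<gamma> t - \<eta> t) \<bullet> (v t (\<gamma> t) - v t (\<eta> t)))"
    show "(?f has_real_derivative ?d) (at t within {a..b})"
      using sol t by (intro has_real_derivative_norm_power2)
        (auto simp: solves_ode_def intro!: has_vector_derivative_diff)
    have "\<bar>?d\<bar> \<le> 2 * (norm (\<gamma> t - \<eta> t) * norm (v t (\<gamma> t) - v t (\<eta> t)))"
      using Cauchy_Schwarz_ineq2[of "\<gamma> t - \<eta> t" "v t (\<gamma> t) - v t (\<eta> t)"] by (simp add: abs_mult)
    also have "\<dots> \<le> 2 * (norm (\<gamma> t - \<eta> t) * (L * norm (\<gamma> t - \<eta> t)))"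
      using lip[OF t] by (intro mult_left_mono) auto
    finally show "\<bar>?d\<bar> \<le> 2 * L * ?f t" by (simp add: power2_eq_square algebra_simps)
  qed
  also have "\<dots> = (exp (L * (b - a)) * norm (\<gamma> a - \<eta> a))\<^sup>2"
    by (simp add: power_mult_distrib exp_double[of "L * (b - a)", symmetric] mult.assoc)
  finally show ?thesis
    by (rule power2_le_imp_le) auto
qed

text \<open>The smooth function \<open>1 + (norm (\<gamma> t))\<^sup>2\<close> turns linear growth
  of the field into exponential bounds both ways. The factor 4 comes from
  \<open>2 * n \<le> 1 + n\<^sup>2\<close>.\<close>

lemma solves_ode_growth:
  fixes v :: "real \<Rightarrow> 'a::euclidean_space \<Rightarrow> 'a"
  assumes growth: "\<And>t x. t \<in> {a..b} \<Longrightarrow> norm (v t x) \<le> C * (1 + norm x)"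
    and sol: "solves_ode v \<gamma> a b" and ab: "a \<le> b" and C: "C \<ge> 0"
  shows "1 + (norm (\<gamma> b))\<^sup>2 \<le> exp (4 * C * (b - a)) * (1 + (norm (\<gamma> a))\<^sup>2)"
    and "1 + (norm (\<gamma> a))\<^sup>2 \<le> exp (4 * C * (b - a)) * (1 + (norm (\<gamma> b))\<^sup>2)"
proof -
  let ?f = "\<lambda>t. 1 + (norm (\<gamma> t))\<^sup>2"
  let ?d = "\<lambda>t. 2 * (\<gamma> t \<bullet> v t (\<gamma> t))"
  have der: "(?f has_real_derivative ?d t) (at t within {a..b})" if t: "t \<in> {a..b}" for t
    using DERIV_add[OF DERIV_const has_real_derivative_norm_power2[of \<gamma> "v t (\<gamma> t)" t "{a..b}"], of 1] sol t
    by (auto simp: solves_ode_def)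
  have bound: "\<bar>?d t\<bar> \<le> 4 * C * ?f t" if t: "t \<in> {a..b}" for t
  proof -
    let ?n = "norm (\<gamma> t)"
    have "\<bar>?d t\<bar> \<le> 2 * (?n * norm (v t (\<gamma> t)))"
      using Cauchy_Schwarz_ineq2[of "\<gamma> t" "v t (\<gamma> t)"] by (simp add: abs_mult)
    also have "\<dots> \<le> 2 * (?n * (C * (1 + ?n)))"
      using growth[OF t] by (intro mult_left_mono) auto
    also have "\<dots> = C * (2 * (?n + ?n\<^sup>2))" by (simp add: algebra_simps power2_eq_square)
    also have "\<dots> \<le> C * (4 * (1 + ?n\<^sup>2))"
    proof (intro mult_left_mono C)
      have "0 \<le> (?n - 1)\<^sup>2" by simp
      then have "2 * ?n \<le> 1 + ?n\<^sup>2" by (simp add: power2_eq_square algebra_simps)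
      moreover have "0 \<le> ?n\<^sup>2" by simp
      ultimately show "2 * (?n + ?n\<^sup>2) \<le> 4 * (1 + ?n\<^sup>2)" by argo
    qed
    finally show ?thesis by (simp add: algebra_simps)
  qed
  show "?f b \<le> exp (4 * C * (b - a)) * ?f a" "?f a \<le> exp (4 * C * (b - a)) * ?f b"
    using exp_weighted_le[OF der bound ab] by blast+
qed

section \<open>Derivative of the determinant\<close>

text \<open>Only the identity permutation contributes to the differentiated Leibniz sum: any other
  moves at least two indices, so after one factor is replaced by an entry of \<open>H\<close> some
  off-diagonal zero of the identity matrix remains.\<close>

lemma has_derivative_det_mat_1:
  "(det has_derivative trace) (at (mat 1 :: real^'n^'n))"
proof -
  let ?P = "{p. p permutes (UNIV::'n set)}"
  let ?D = "\<lambda>(p::'n\<Rightarrow>'n) (H::real^'n^'n). of_int (sign p) * (\<Sum>i\<in>UNIV. H $ i $ p i * (\<Prod>j\<in>UNIV - {i}. mat 1 $ j $ p j))"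
  have comp: "((\<lambda>M::real^'n^'n. M $ i $ j) has_derivative (\<lambda>H. H $ i $ j)) (at x)" for i j x
    by (rule bounded_linear_imp_has_derivative)
      (intro bounded_linear_compose[OF bounded_linear_vec_nth bounded_linear_vec_nth])
  have "((\<lambda>M::real^'n^'n. \<Sum>p\<in>?P. of_int (sign p) * (\<Prod>i\<in>UNIV. M $ i $ p i)) has_derivative
      (\<lambda>H. \<Sum>p\<in>?P. ?D p H)) (at (mat 1))"
    by (intro has_derivative_sum has_derivative_mult_right has_derivative_prod comp)
  also have "(\<lambda>H. \<Sum>p\<in>?P. ?D p H) = trace"
  proof
    fix H :: "real^'n^'n"
    have z: "?D p H = 0" if p: "p \<in> ?P" "p \<noteq> id" for p
    proof -
      obtain k where k: "p k \<noteq> k" using p(2) by (auto simp: fun_eq_iff)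
      have inj: "inj p" using p(1) permutes_inj by blast
      have "H $ i $ p i * (\<Prod>j\<in>UNIV - {i}. (mat 1 :: real^'n^'n) $ j $ p j) = 0" for i
      proof -
        obtain m where m: "m \<noteq> i" "p m \<noteq> m"
          using k inj by (metis injD)
        have "(\<Prod>j\<in>UNIV - {i}. (mat 1 :: real^'n^'n) $ j $ p j) = 0"
          using m by (intro prod_zero) (auto simp: mat_def intro!: bexI[of _ m])
        then show ?thesis by simp
      qed
      then show ?thesis by (simp only: sum.neutral_const mult_zero_right)
    qed
    have "(\<Sum>p\<in>?P. ?D p H) = (\<Sum>p\<in>{id}. ?D p H)"
      by (rule sum.mono_neutral_right) (auto simp: permutes_id z)
    also have "\<dots> = trace H"
      by (simp add: trace_def mat_def)
    finally show "(\<Sum>p\<in>?P. ?D p H) = trace H" .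
  qed
  finally show ?thesis by (simp add: det_def[abs_def])
qed

lemma bounded_bilinear_matrix_mult:
  "bounded_bilinear ((**) :: real^'n^'m \<Rightarrow> real^'k^'n \<Rightarrow> real^'k^'m)"
  unfolding bilinear_conv_bounded_bilinear[symmetric] bilinear_def
  by (auto intro!: linearI simp: matrix_matrix_mult_def vec_eq_iff sum.distrib sum_distrib_left algebra_simps)

lemma bounded_bilinear_matrix_vector_mult:
  "bounded_bilinear ((*v) :: real^'n^'m \<Rightarrow> real^'n \<Rightarrow> real^'m)"
  unfolding bilinear_conv_bounded_bilinear[symmetric] bilinear_def
  by (auto intro!: linearI simp: matrix_vector_mult_def vec_eq_iff sum.distrib sum_distrib_left algebra_simps)

lemma matrix_inv_mult:
  fixes M :: "real^'n^'n"
  assumes "invertible M"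
  shows "M ** matrix_inv M = mat 1" "matrix_inv M ** M = mat 1"
  using someI_ex[OF assms[unfolded invertible_def]] by (simp_all add: matrix_inv_def)

text \<open>Jacobi's formula, reduced to the identity matrix by factoring
  \<open>det X = det M * det (matrix_inv M ** X)\<close>.\<close>

lemma has_derivative_det:
  fixes M :: "real^'n^'n"
  assumes "invertible M"
  shows "(det has_derivative (\<lambda>H. det M * trace (matrix_inv M ** H))) (at M)"
proof -
  let ?N = "matrix_inv M"
  have MN: "M ** ?N = mat 1" "?N ** M = mat 1"
    using assms by (simp_all add: matrix_inv_mult)
  have lin: "bounded_linear (\<lambda>X. ?N ** X)"
    by (rule bounded_bilinear.bounded_linear_right[OF bounded_bilinear_matrix_mult])
  have "((\<lambda>X. det M * det (?N ** X)) has_derivative (\<lambda>H. det M * trace (?N ** H))) (at M)"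
    using has_derivative_mult_right[OF has_derivative_compose[OF bounded_linear_imp_has_derivative[OF lin], of det trace M UNIV], of "det M"]
      has_derivative_det_mat_1 by (simp add: MN)
  moreover have "det M * det (?N ** X) = det X" for X
  proof -
    have "det M * det (?N ** X) = det ((M ** ?N) ** X)"
      by (simp add: det_mul matrix_mul_assoc[symmetric])
    then show ?thesis by (simp add: MN)
  qed
  ultimately show ?thesis by simp
qed

text \<open>Uniformity over \<open>norm M \<le> K\<close> provides one step size for all Jacobians
  on a ball. Dividing by \<open>K + 1\<close> instead of \<open>K\<close> covers
  \<open>K = 0\<close>.\<close>

lemma det_near_mat_1:
  assumes e: "(e::real) > 0" and K: "K \<ge> 0"
  shows "\<exists>\<delta>>0. \<forall>h (M::real^'n^'n). 0 < h \<and> h < \<delta> \<and> norm M \<le> K \<longrightarrow>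
    \<bar>det (mat 1 + h *\<^sub>R M) - 1 - h * trace M\<bar> \<le> e * h"
proof -
  have "e / (K + 1) > 0" using e K by simp
  then obtain d where d: "d > 0" and D: "\<And>X::real^'n^'n. norm (X - mat 1) < d \<Longrightarrow>
      norm (det X - det (mat 1 :: real^'n^'n) - trace (X - mat 1)) \<le> e / (K + 1) * norm (X - mat 1)"
    using has_derivative_det_mat_1[where 'n='n] unfolding has_derivative_at_alt by blast
  show ?thesis
  proof (intro exI[of _ "d / (K + 1)"] conjI allI impI)
    show "0 < d / (K + 1)" using d K by simp
    fix h and M :: "real^'n^'n" assume *: "0 < h \<and> h < d / (K + 1) \<and> norm M \<le> K"
    have n: "norm (mat 1 + h *\<^sub>R M - mat 1) \<le> h * K"
      using * by (auto intro!: mult_left_mono)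
    have "h * K \<le> h * (K + 1)" using * K by (intro mult_left_mono) auto
    moreover have "h * (K + 1) < d" using * K by (simp add: pos_less_divide_eq)
    ultimately have "norm (mat 1 + h *\<^sub>R M - mat 1) < d" using n by linarith
    from D[OF this] have "\<bar>det (mat 1 + h *\<^sub>R M) - 1 - h * trace M\<bar> \<le> e / (K + 1) * norm (h *\<^sub>R M)"
      by (simp add: trace_def sum_distrib_left[symmetric] det_I)
    also have "\<dots> \<le> e / (K + 1) * (h * (K + 1))"
      using n \<open>h * K \<le> h * (K + 1)\<close> e K by (intro mult_left_mono) auto
    also have "\<dots> = e * h" using K by simp
    finally show "\<bar>det (mat 1 + h *\<^sub>R M) - 1 - h * trace M\<bar> \<le> e * h" .
  qed
qed

section \<open>Measures determined by test functions\<close>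

text \<open>The indicator of a bounded open set is the pointwise limit of the Lipschitz functions
  \<open>min 1 (n * infdist x (- U))\<close>, which vanish off the set. So the measures agree on
  boxes, a generator closed under intersection.\<close>

lemma measure_eqI_test_functions:
  fixes M N :: "'a::euclidean_space measure"
  assumes fin: "finite_measure M" "finite_measure N" and sets: "sets M = sets borel" "sets N = sets borel"
    and test: "\<And>(\<phi> :: 'a \<Rightarrow> real) K R. (\<And>x y. \<bar>\<phi> x - \<phi> y\<bar> \<le> K * norm (x - y)) \<Longrightarrow> K \<ge> 0 \<Longrightarrow>
      (\<And>x. \<bar>\<phi> x\<bar> \<le> 1) \<Longrightarrow> (\<And>x. norm x > R \<Longrightarrow> \<phi> x = 0) \<Longrightarrow> (\<integral>x. \<phi> x \<partial>M) = (\<integral>x. \<phi> x \<partial>N)"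
  shows "M = N"
proof -
  interpret M: finite_measure M by fact
  interpret N: finite_measure N by fact
  have eq: "measure M U = measure N U" if U: "open U" "bounded U" for U
  proof -
    define \<phi> where "\<phi> n x = min 1 (real n * infdist x (- U))" for n x
    have lip: "\<bar>\<phi> n x - \<phi> n y\<bar> \<le> real n * norm (x - y)" for n x y
    proof -
      have "\<bar>\<phi> n x - \<phi> n y\<bar> \<le> \<bar>real n * infdist x (- U) - real n * infdist y (- U)\<bar>"
        unfolding \<phi>_def by linarith
      also have "\<dots> = real n * \<bar>infdist x (- U) - infdist y (- U)\<bar>"
        by (simp add: abs_mult right_diff_distrib[symmetric])
      also have "\<dots> \<le> real n * norm (x - y)"
        using infdist_triangle_abs[of x "- U" y] by (intro mult_left_mono) (auto simp: dist_norm)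
      finally show ?thesis .
    qed
    have bd: "\<bar>\<phi> n x\<bar> \<le> 1" for n x
      unfolding \<phi>_def by (auto simp: infdist_nonneg min_def)
    obtain R where R: "\<And>x. x \<in> U \<Longrightarrow> norm x \<le> R" using U(2) by (auto simp: bounded_iff)
    have supp: "\<phi> n x = 0" if "x \<notin> U" for n x using that by (simp add: \<phi>_def)
    have supp': "\<phi> n x = 0" if "norm x > R" for n x using supp R that by force
    have [measurable]: "\<phi> n \<in> borel_measurable borel" for n
      unfolding \<phi>_def by (intro borel_measurable_continuous_onI continuous_intros)
    have lim: "(\<lambda>n. \<phi> n x) \<longlonglongrightarrow> indicator U x" for x
    proof (cases "x \<in> U")
      case True
      \<comment> \<open>The distance to the empty set is 0 by convention, so positivity of
        \<open>infdist\<close> requires a point outside \<open>U\<close>; boundedness supplies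
        one.\<close>
      have "- U \<noteq> {}" using U(2) not_bounded_UNIV[where 'a = 'a] by (metis Compl_empty_eq double_compl)
      then have pos: "infdist x (- U) > 0"
        using True U(1) infdist_pos_not_in_closed[of "- U" x] by auto
      then obtain n0 :: nat where n0: "1 < real n0 * infdist x (- U)" using reals_Archimedean3 by blast
      have "\<phi> n x = 1" if "n \<ge> n0" for n
      proof -
        have "real n0 * infdist x (- U) \<le> real n * infdist x (- U)"
          using that pos by (intro mult_right_mono) auto
        then show ?thesis using n0 by (simp add: \<phi>_def)
      qed
      then have "eventually (\<lambda>n. \<phi> n x = 1) sequentially"
        unfolding eventually_sequentially by blast
      then show ?thesis using True by (simp add: tendsto_eventually)
    qed (simp add: supp)
    have conv: "(\<lambda>n. \<integral>x. \<phi> n x \<partial>L) \<longlonglongrightarrow> measure L U" if "finite_measure L" "sets L = sets borel" for L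
    proof -
      interpret L: finite_measure L by fact
      have [measurable_cong]: "sets L = sets borel" by fact
      have [measurable]: "U \<in> sets borel" using U(1) by simp
      have "(\<lambda>n. \<integral>x. \<phi> n x \<partial>L) \<longlonglongrightarrow> (\<integral>x. indicator U x \<partial>L)"
        using U(1) bd by (intro integral_dominated_convergence[where w = "\<lambda>_. 1"]) (auto intro: lim)
      then show ?thesis using that(2) U(1) by (simp add: sets_eq_imp_space_eq)
    qed
    have "(\<lambda>n. \<integral>x. \<phi> n x \<partial>M) = (\<lambda>n. \<integral>x. \<phi> n x \<partial>N)"
      using test[OF lip _ bd supp'] by auto
    then show ?thesis
      using LIMSEQ_unique[OF conv[OF fin(1) sets(1)]] conv[OF fin(2) sets(2)] by simp
  qed
  let ?A = "\<lambda>n::nat. box (- (real n *\<^sub>R One)) (real n *\<^sub>R One) :: 'a set"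
  show ?thesis
  proof (rule measure_eqI_generator_eq)
    let ?E = "range (\<lambda>(a, b). box a b::'a set)"
    show "Int_stable ?E"
      by (auto simp: Int_stable_def box_Int_box)
    show "?E \<subseteq> Pow UNIV" "sets M = sigma_sets UNIV ?E" "sets N = sigma_sets UNIV ?E"
      by (simp_all add: borel_eq_box sets)
    show "range ?A \<subseteq> ?E" "(\<Union>i. ?A i) = UNIV"
      unfolding UN_box_eq_UNIV by auto
    show "emeasure M (?A i) \<noteq> \<infinity>" for i by simp
    show "emeasure M X = emeasure N X" if X: "X \<in> ?E" for X
    proof -
      obtain a b where "X = box a b" using X by auto
      then have "measure M X = measure N X" by (intro eq) (simp_all add: open_box bounded_box)
      then show ?thesis by (simp add: M.emeasure_eq_measure N.emeasure_eq_measure)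
    qed
  qed
qed

section \<open>Transport by the flow of the continuity equation\<close>

lemma vector_derivative_bound:
  fixes f :: "real \<Rightarrow> 'a::real_normed_vector"
  assumes "\<And>t. t \<in> {a..b} \<Longrightarrow> (f has_vector_derivative f' t) (at t within {a..b})"
    and "\<And>t. t \<in> {a..b} \<Longrightarrow> norm (f' t) \<le> B" and ab: "a \<le> b"
  shows "norm (f b - f a) \<le> B * (b - a)"
proof -
  have "norm (f b - f a) \<le> B * norm (b - a)"
  proof (rule differentiable_bound[where S = "{a..b}" and f' = "\<lambda>t h. h *\<^sub>R f' t"])
    fix t assume t: "t \<in> {a..b}"
    show "(f has_derivative (\<lambda>h. h *\<^sub>R f' t)) (at t within {a..b})"
      using assms(1)[OF t] by (simp add: has_vector_derivative_def)
    show "onorm (\<lambda>h. h *\<^sub>R f' t) \<le> B"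
      using assms(2)[OF t] by (simp add: onorm_scaleR_left[OF bounded_linear_ident, of "f' t"] onorm_id)
  qed (use ab in auto)
  then show ?thesis using ab by simp
qed

lemma integrable_compact_support:
  fixes f :: "'a::euclidean_space \<Rightarrow> real"
  assumes "continuous_on UNIV f" "\<And>x. norm x > R \<Longrightarrow> f x = 0"
  shows "integrable lborel f"
proof -
  have "integrable lborel (\<lambda>x. indicator (cball 0 R) x *\<^sub>R f x)"
    by (rule borel_integrable_compact) (auto intro: continuous_on_subset[OF assms(1)])
  also have "(\<lambda>x. indicator (cball 0 R) x *\<^sub>R f x) = f"
    using assms(2) by (force simp: indicator_def)
  finally show ?thesis .
qed

lemma continuous_slice:
  assumes "continuous_on (U \<times> UNIV) (\<lambda>(\<theta>, x). g \<theta> x)" "\<theta> \<in> U"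
  shows "continuous_on S (g \<theta>)"
proof -
  have "continuous_on S ((\<lambda>(\<theta>, x). g \<theta> x) \<circ> (\<lambda>x. (\<theta>, x)))"
    using assms(2) by (intro continuous_on_compose continuous_intros continuous_on_subset[OF assms(1)]) auto
  then show ?thesis by (simp add: o_def)
qed

lemma bounded_on_compact:
  fixes f :: "'a::topological_space \<Rightarrow> 'b::real_normed_vector"
  assumes "compact K" "continuous_on K f"
  shows "\<exists>B>0. \<forall>x\<in>K. norm (f x) \<le> B"
  using compact_imp_bounded[OF compact_continuous_image[OF assms(2,1)]]
  by (auto simp: bounded_pos)

text \<open>\<open>q'\<close> is the joint derivative in time and space, so \<open>pde\<close> is
  the continuity equation along characteristics: the derivative of \<open>q\<close> in direction
  \<open>(1, v)\<close> plus \<open>q\<close> times the divergence of \<open>v\<close>. The horizon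
  \<open>\<tau>\<close> is a parameter because every marginal time will serve as end point
  once.\<close>

locale continuity_equation =
  fixes v :: "real \<Rightarrow> real^'n \<Rightarrow> real^'n" and v' :: "real \<Rightarrow> real^'n \<Rightarrow> real^'n^'n"
    and q :: "real \<Rightarrow> real^'n \<Rightarrow> real" and q' :: "real \<Rightarrow> real^'n \<Rightarrow> (real \<times> (real^'n)) \<Rightarrow>\<^sub>L real"
    and \<tau> L :: real
  assumes tau: "0 \<le> \<tau>" and L: "L > 0"
    and v_lip: "\<And>t x y. t \<in> {0..\<tau>} \<Longrightarrow> norm (v t x - v t y) \<le> L * norm (x - y)"
    and v_cont: "continuous_on ({0..\<tau>} \<times> UNIV) (\<lambda>(t, x). v t x)"
    and v_der: "\<And>t x. t \<in> {0..\<tau>} \<Longrightarrow> (v t has_derivative (\<lambda>h. v' t x *v h)) (at x)"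
    and v'_cont: "continuous_on ({0..\<tau>} \<times> UNIV) (\<lambda>(t, x). v' t x)"
    and q_der: "\<And>t x. t \<in> {0..\<tau>} \<Longrightarrow>
      ((\<lambda>(t, x). q t x) has_derivative blinfun_apply (q' t x)) (at (t, x) within {0..\<tau>} \<times> UNIV)"
    and q'_cont: "continuous_on ({0..\<tau>} \<times> UNIV) (\<lambda>(t, x). q' t x)"
    and pde: "\<And>t x. t \<in> {0..\<tau>} \<Longrightarrow> blinfun_apply (q' t x) (1, v t x) + q t x * trace (v' t x) = 0"
begin

lemma q_cont: "continuous_on ({0..\<tau>} \<times> UNIV) (\<lambda>(t, x). q t x)"
  using q_der has_derivative_continuous_on[of "{0..\<tau>} \<times> UNIV" "\<lambda>(t, x). q t x" "\<lambda>(t, x). blinfun_apply (q' t x)"]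
  by auto

lemma bounded_on_cylinder:
  fixes f :: "real \<Rightarrow> real^'n \<Rightarrow> 'b::real_normed_vector"
  assumes "continuous_on ({0..\<tau>} \<times> UNIV) (\<lambda>(t, x). f t x)"
  obtains B where "B > 0" "\<And>t x. t \<in> {0..\<tau>} \<Longrightarrow> norm x \<le> R \<Longrightarrow> norm (f t x) \<le> B"
proof -
  have "\<exists>B>0. \<forall>z\<in>{0..\<tau>} \<times> cball 0 R. norm ((\<lambda>(t, x). f t x) z) \<le> B"
    by (intro bounded_on_compact compact_Times continuous_on_subset[OF assms]) auto
  then obtain B where B: "B > 0" "\<And>z. z \<in> {0..\<tau>} \<times> cball 0 R \<Longrightarrow> norm ((\<lambda>(t, x). f t x) z) \<le> B" by blast
  show thesis
  proof (rule that[OF B(1)])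
    fix t and x :: "real^'n" assume "t \<in> {0..\<tau>}" "norm x \<le> R"
    then show "norm (f t x) \<le> B" using B(2)[of "(t, x)"] by auto
  qed
qed

lemma uniform_on_cylinder:
  fixes f :: "real \<Rightarrow> real^'n \<Rightarrow> 'b::real_normed_vector"
  assumes "continuous_on ({0..\<tau>} \<times> UNIV) (\<lambda>(t, x). f t x)" "e > 0"
  obtains d where "d > 0" "\<And>t x s y. t \<in> {0..\<tau>} \<Longrightarrow> s \<in> {0..\<tau>} \<Longrightarrow> norm x \<le> R \<Longrightarrow> norm y \<le> R
    \<Longrightarrow> \<bar>t - s\<bar> + norm (x - y) < d \<Longrightarrow> norm (f t x - f s y) \<le> e"
proof -
  have "uniformly_continuous_on ({0..\<tau>} \<times> cball 0 R) (\<lambda>(t, x). f t x)"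
    by (intro compact_uniformly_continuous compact_Times continuous_on_subset[OF assms(1)]) auto
  then obtain d where d: "d > 0" "\<And>z w. z \<in> {0..\<tau>} \<times> cball 0 R \<Longrightarrow> w \<in> {0..\<tau>} \<times> cball 0 R \<Longrightarrow>
      dist w z < d \<Longrightarrow> dist ((\<lambda>(t, x). f t x) w) ((\<lambda>(t, x). f t x) z) < e"
    using \<open>e > 0\<close> unfolding uniformly_continuous_on_def by meson
  show thesis
  proof (rule that[OF d(1)])
    fix t s and x y :: "real^'n"
    assume *: "t \<in> {0..\<tau>}" "s \<in> {0..\<tau>}" "norm x \<le> R" "norm y \<le> R" "\<bar>t - s\<bar> + norm (x - y) < d"
    have "dist (t, x) (s, y) \<le> \<bar>t - s\<bar> + norm (x - y)"
      using norm_Pair_le[of "t - s" "x - y"] by (simp add: dist_norm)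
    then show "norm (f t x - f s y) \<le> e"
      using d(2)[of "(s, y)" "(t, x)"] * by (auto simp: dist_norm)
  qed
qed

lemma v_growth: obtains C where "C > 0" "\<And>t x. t \<in> {0..\<tau>} \<Longrightarrow> norm (v t x) \<le> C * (1 + norm x)"
proof -
  obtain B where B: "B > 0" "\<And>t x. t \<in> {0..\<tau>} \<Longrightarrow> norm x \<le> 0 \<Longrightarrow> norm (v t x) \<le> B"
    using bounded_on_cylinder[OF v_cont, of 0] by blast
  show thesis
  proof (rule that[of "B + L"])
    fix t and x :: "real^'n" assume t: "t \<in> {0..\<tau>}"
    have "norm (v t x) \<le> norm (v t 0) + norm (v t x - v t 0)"
      by (metis add.commute diff_add_cancel norm_triangle_ineq)
    also have "\<dots> \<le> B + L * norm x" using B(2)[OF t, of 0] v_lip[OF t, of x 0] by simp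
    also have "\<dots> \<le> (B + L) * (1 + norm x)" using B(1) L by (simp add: algebra_simps)
    finally show "norm (v t x) \<le> (B + L) * (1 + norm x)" .
  qed (use B L in simp)
qed

section \<open>Flow of the drift: existence, uniqueness and growth\<close>

text \<open>The chosen curve is arbitrary outside \<open>{s..\<tau>}\<close>; it is evaluated only
  at times inside.\<close>

definition flow :: "real \<Rightarrow> real^'n \<Rightarrow> real \<Rightarrow> real^'n" where
  "flow s x = (SOME \<gamma>. \<gamma> s = x \<and> solves_ode v \<gamma> s \<tau>)"

lemma flow:
  assumes "s \<in> {0..\<tau>}"
  shows flow_init: "flow s x s = x" and flow_solves: "solves_ode v (flow s x) s \<tau>"
proof -
  have "\<exists>\<gamma>. \<gamma> s = x \<and> solves_ode v \<gamma> s \<tau>"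
    unfolding solves_ode_def using assms
    by (intro picard_lindelof_global[OF _ L] continuous_on_subset[OF v_cont] v_lip) auto
  then have "flow s x s = x \<and> solves_ode v (flow s x) s \<tau>"
    unfolding flow_def by (rule someI_ex)
  then show "flow s x s = x" "solves_ode v (flow s x) s \<tau>" by auto
qed

lemma solution_lipschitz:
  assumes "solves_ode v \<gamma> s t" "solves_ode v \<eta> s t" "0 \<le> s" "s \<le> t" "t \<le> \<tau>"
  shows "norm (\<gamma> t - \<eta> t) \<le> exp (L * \<tau>) * norm (\<gamma> s - \<eta> s)"
proof -
  have "norm (\<gamma> t - \<eta> t) \<le> exp (L * (t - s)) * norm (\<gamma> s - \<eta> s)"
    using assms v_lip by (intro solves_ode_lipschitz[of s t v]) auto
  also have "\<dots> \<le> exp (L * \<tau>) * norm (\<gamma> s - \<eta> s)"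
    using L assms by (intro mult_right_mono) (auto intro!: mult_left_mono)
  finally show ?thesis .
qed

lemma flow_unique:
  assumes "solves_ode v \<gamma> s t" "0 \<le> s" "s \<le> t" "t \<le> \<tau>"
  shows "\<gamma> t = flow s (\<gamma> s) t"
proof -
  have "solves_ode v (flow s (\<gamma> s)) s t"
    using assms by (intro solves_ode_subset[OF flow_solves[of s "\<gamma> s"]]) auto
  from solution_lipschitz[OF assms(1) this assms(2,3,4)] show ?thesis
    using flow_init[of s "\<gamma> s"] assms by simp
qed

lemma flow_lipschitz:
  assumes "0 \<le> s" "s \<le> t" "t \<le> \<tau>"
  shows "norm (flow s x t - flow s y t) \<le> exp (L * \<tau>) * norm (x - y)"
  using solution_lipschitz[of "flow s x" s t "flow s y"] assms
    solves_ode_subset[OF flow_solves[of s x], of s t] solves_ode_subset[OF flow_solves[of s y], of s t]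
  by (simp add: flow_init)

lemma flow_semigroup:
  assumes "0 \<le> s" "s \<le> r" "r \<le> t" "t \<le> \<tau>"
  shows "flow r (flow s x r) t = flow s x t"
  using flow_unique[of "flow s x" r t] assms solves_ode_subset[OF flow_solves[of s x], of r t] by simp

text \<open>The second bound states that distant points stay distant; it makes a compactly supported
  function composed with the flow compactly supported again, on a ball independent of the starting
  time.\<close>

lemma flow_growth:
  obtains E where "E > 0"
    "\<And>s t x. 0 \<le> s \<Longrightarrow> s \<le> t \<Longrightarrow> t \<le> \<tau> \<Longrightarrow> 1 + (norm (flow s x t))\<^sup>2 \<le> E * (1 + (norm x)\<^sup>2)"
    "\<And>s t x. 0 \<le> s \<Longrightarrow> s \<le> t \<Longrightarrow> t \<le> \<tau> \<Longrightarrow> 1 + (norm x)\<^sup>2 \<le> E * (1 + (norm (flow s x t))\<^sup>2)"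
proof -
  obtain C where C: "C > 0" "\<And>t x. t \<in> {0..\<tau>} \<Longrightarrow> norm (v t x) \<le> C * (1 + norm x)"
    using v_growth by blast
  show thesis
  proof (rule that[of "exp (4 * C * \<tau>)"])
    fix s t and x :: "real^'n" assume st: "0 \<le> s" "s \<le> t" "t \<le> \<tau>"
    have sol: "solves_ode v (flow s x) s t"
      using st by (intro solves_ode_subset[OF flow_solves[of s x]]) auto
    have le: "exp (4 * C * (t - s)) * (1 + z\<^sup>2) \<le> exp (4 * C * \<tau>) * (1 + z\<^sup>2)" for z :: real
      using C st by (intro mult_right_mono) auto
    note g = solves_ode_growth[of s t v C "flow s x", OF _ sol st(2)]
    show "1 + (norm (flow s x t))\<^sup>2 \<le> exp (4 * C * \<tau>) * (1 + (norm x)\<^sup>2)"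
      using g(1) C st le[of "norm x"] by (force simp: flow_init)
    show "1 + (norm x)\<^sup>2 \<le> exp (4 * C * \<tau>) * (1 + (norm (flow s x t))\<^sup>2)"
      using g(2) C st le[of "norm (flow s x t)"] by (force simp: flow_init)
  qed simp
qed

lemma flow_bounded:
  obtains R' where "R' \<ge> R" "\<And>s t x. 0 \<le> s \<Longrightarrow> s \<le> t \<Longrightarrow> t \<le> \<tau> \<Longrightarrow> norm x \<le> R \<Longrightarrow> norm (flow s x t) \<le> R'"
proof -
  obtain E where E: "E > 0"
    "\<And>s t x. 0 \<le> s \<Longrightarrow> s \<le> t \<Longrightarrow> t \<le> \<tau> \<Longrightarrow> 1 + (norm (flow s x t))\<^sup>2 \<le> E * (1 + (norm x)\<^sup>2)"
    using flow_growth by metis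
  let ?R = "max R (sqrt (E * (1 + R\<^sup>2)))"
  show thesis
  proof (rule that[of ?R])
    fix s t and x :: "real^'n" assume *: "0 \<le> s" "s \<le> t" "t \<le> \<tau>" "norm x \<le> R"
    have "(norm (flow s x t))\<^sup>2 \<le> E * (1 + (norm x)\<^sup>2)" using E(2)[of s t x] * by simp
    also have "\<dots> \<le> E * (1 + R\<^sup>2)" using E(1) * by (intro mult_left_mono add_left_mono power_mono) auto
    finally show "norm (flow s x t) \<le> ?R" using real_le_rsqrt by fastforce
  qed simp
qed

section \<open>First-order expansions along an Euler step\<close>

text \<open>The trajectory minus its tangent line has derivative
  \<open>v t (flow s x t) - v s x\<close>, small by uniform continuity of \<open>v\<close> on a
  cylinder that contains all trajectories from the ball.\<close>

lemma flow_euler: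
  assumes e: "e > 0"
  obtains \<delta> where "\<delta> > 0" "\<And>s h x. 0 \<le> s \<Longrightarrow> 0 < h \<Longrightarrow> h < \<delta> \<Longrightarrow> s + h \<le> \<tau> \<Longrightarrow> norm x \<le> R \<Longrightarrow>
    norm (flow s x (s + h) - (x + h *\<^sub>R v s x)) \<le> e * h"
proof -
  obtain R' where R': "R' \<ge> R" "\<And>s t x. 0 \<le> s \<Longrightarrow> s \<le> t \<Longrightarrow> t \<le> \<tau> \<Longrightarrow> norm x \<le> R \<Longrightarrow> norm (flow s x t) \<le> R'"
    using flow_bounded[of R] by blast
  obtain B where B: "B > 0" "\<And>t x. t \<in> {0..\<tau>} \<Longrightarrow> norm x \<le> R' \<Longrightarrow> norm (v t x) \<le> B"
    using bounded_on_cylinder[OF v_cont, of R'] by blast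
  obtain d where d: "d > 0" "\<And>t x s y. t \<in> {0..\<tau>} \<Longrightarrow> s \<in> {0..\<tau>} \<Longrightarrow> norm x \<le> R' \<Longrightarrow> norm y \<le> R'
    \<Longrightarrow> \<bar>t - s\<bar> + norm (x - y) < d \<Longrightarrow> norm (v t x - v s y) \<le> e"
    using uniform_on_cylinder[OF v_cont e, of R'] by blast
  show thesis
  \<comment> \<open>Within time \<open>h\<close> a trajectory moves by at most \<open>B * h\<close>,
    so its distance in time and space together is at most \<open>h * (1 + B)\<close>.\<close>
  proof (rule that[of "d / (1 + B)"])
    show "d / (1 + B) > 0" using d B by simp
    fix s h and x :: "real^'n" assume *: "0 \<le> s" "0 < h" "h < d / (1 + B)" "s + h \<le> \<tau>" "norm x \<le> R"
    have hd: "h * (1 + B) < d" using * B by (simp add: pos_less_divide_eq)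
    have sol: "(flow s x has_vector_derivative v t (flow s x t)) (at t within {s..r})"
      if "t \<in> {s..r}" "r \<le> s + h" for t r
      using solves_ode_subset[OF flow_solves[of s x], of s r] that * by (auto simp: solves_ode_def)
    have near: "norm (flow s x r - x) \<le> B * (r - s)" if "r \<in> {s..s+h}" for r
    proof -
      have "norm (flow s x r - flow s x s) \<le> B * (r - s)"
        using that * R' B by (intro vector_derivative_bound[OF sol]) auto
      then show ?thesis using * by (simp add: flow_init)
    qed
    have "norm ((flow s x (s + h) - (s + h) *\<^sub>R v s x) - (flow s x s - s *\<^sub>R v s x)) \<le> e * (s + h - s)"
    proof (rule vector_derivative_bound[where f = "\<lambda>t. flow s x t - t *\<^sub>R v s x" and f' = "\<lambda>t. v t (flow s x t) - v s x"])
      fix t assume t: "t \<in> {s..s+h}"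
      show "((\<lambda>t. flow s x t - t *\<^sub>R v s x) has_vector_derivative v t (flow s x t) - v s x) (at t within {s..s + h})"
        using sol[OF t] by (auto intro!: derivative_eq_intros)
      have "\<bar>t - s\<bar> + norm (flow s x t - x) \<le> h + B * h"
      proof -
        have "B * (t - s) \<le> B * h" using t B(1) by (intro mult_left_mono) auto
        then show ?thesis using near[OF t] t by auto
      qed
      then show "norm (v t (flow s x t) - v s x) \<le> e"
        using * R' t hd by (intro d(2)) (auto simp: algebra_simps)
    qed (use * in simp)
    then show "norm (flow s x (s + h) - (x + h *\<^sub>R v s x)) \<le> e * h"
      using * by (simp add: flow_init algebra_simps)
  qed
qed

text \<open>A mean value estimate on the segment from \<open>(s, x)\<close> to
  \<open>(s + h, x + h *\<^sub>R v s x)\<close>. That segment has length at most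
  \<open>h * (1 + B)\<close>, whence the tolerance \<open>e / (1 + B)\<close> for the variation of
  \<open>q'\<close>.\<close>

lemma q_euler:
  assumes e: "e > 0"
  obtains \<delta> where "\<delta> > 0" "\<And>s h x. 0 \<le> s \<Longrightarrow> 0 < h \<Longrightarrow> h < \<delta> \<Longrightarrow> s + h \<le> \<tau> \<Longrightarrow> norm x \<le> R \<Longrightarrow>
    \<bar>q (s + h) (x + h *\<^sub>R v s x) - q s x - h * blinfun_apply (q' s x) (1, v s x)\<bar> \<le> e * h"
proof -
  obtain B where B: "B > 0" "\<And>t x. t \<in> {0..\<tau>} \<Longrightarrow> norm x \<le> R \<Longrightarrow> norm (v t x) \<le> B"
    using bounded_on_cylinder[OF v_cont, of R] by blast
  have "e / (1 + B) > 0" using e B by simp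
  then obtain d where d: "d > 0" "\<And>t x s y. t \<in> {0..\<tau>} \<Longrightarrow> s \<in> {0..\<tau>} \<Longrightarrow> norm x \<le> R + B \<Longrightarrow> norm y \<le> R + B
    \<Longrightarrow> \<bar>t - s\<bar> + norm (x - y) < d \<Longrightarrow> norm (q' t x - q' s y) \<le> e / (1 + B)"
    using uniform_on_cylinder[OF q'_cont, of "e / (1 + B)" "R + B"] by metis
  show thesis
  \<comment> \<open>The bound \<open>h < 1\<close> keeps the segment inside the ball of radius
    \<open>R + B\<close>, where uniform continuity was taken.\<close>
  proof (rule that[of "min 1 (d / (1 + B))"])
    show "min 1 (d / (1 + B)) > 0" using d B by simp
    fix s h and x :: "real^'n" assume *: "0 \<le> s" "0 < h" "h < min 1 (d / (1 + B))" "s + h \<le> \<tau>" "norm x \<le> R"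
    have hd: "h * (1 + B) < d" using * B by (simp add: pos_less_divide_eq)
    have vB: "norm (v s x) \<le> B" using * by (intro B) auto
    let ?p = "\<lambda>r. (s + r * h, x + (r * h) *\<^sub>R v s x)"
    let ?S = "?p ` {0..1}"
    let ?q = "\<lambda>(t, x). q t x" and ?q' = "\<lambda>z. blinfun_apply (case z of (t, x) \<Rightarrow> q' t x)"
    have p_dom: "s + r * h \<in> {0..\<tau>}" if "r \<in> {0..1}" for r
    proof -
      have "r * h \<le> h" "0 \<le> r * h" using that * by (auto simp: mult_left_le_one_le)
      then show ?thesis using * unfolding atLeastAtMost_iff by linarith
    qed
    have "norm (?q (?p 1) - ?q (?p 0) - ?q' (?p 0) (?p 1 - ?p 0)) \<le> norm (?p 1 - ?p 0) * (e / (1 + B))"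
    proof (rule differentiable_bound_linearization[where S = ?S])
      fix t :: real assume "t \<in> {0..1}"
      then show "?p 0 + t *\<^sub>R (?p 1 - ?p 0) \<in> ?S"
        by (intro image_eqI[of _ _ t]) auto
    next
      fix z assume "z \<in> ?S"
      then obtain r where r: "r \<in> {0..1}" "z = ?p r" by blast
      show "(?q has_derivative ?q' z) (at z within ?S)"
        unfolding r(2) prod.case
      proof (rule has_derivative_subset[OF q_der[OF p_dom[OF r(1)]]], rule image_subsetI)
        fix r' :: real assume "r' \<in> {0..1}"
        then show "?p r' \<in> {0..\<tau>} \<times> UNIV" using p_dom by blast
      qed
      have rh: "r * h \<le> h" "0 \<le> r * h" using r * mult_right_mono[of r 1 h] by auto
      have nb: "norm ((r * h) *\<^sub>R v s x) \<le> h * B"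
        using rh vB * by (simp add: abs_of_nonneg mult_mono)
      have "h * B \<le> B" using * B by (simp add: mult_left_le_one_le)
      then have "norm (x + (r * h) *\<^sub>R v s x) \<le> R + B"
        using nb * norm_triangle_ineq[of x "(r * h) *\<^sub>R v s x"] by linarith
      moreover have "\<bar>s + r * h - s\<bar> + norm (x + (r * h) *\<^sub>R v s x - x) \<le> h * (1 + B)"
        using nb rh by (simp add: distrib_left)
      ultimately have "norm (q' (s + r * h) (x + (r * h) *\<^sub>R v s x) - q' s x) \<le> e / (1 + B)"
        using p_dom[OF r(1)] * B(1) hd by (intro d(2)) auto
      then show "onorm (?q' z - ?q' (?p 0)) \<le> e / (1 + B)"
        by (simp add: r(2) norm_blinfun.rep_eq minus_blinfun.rep_eq fun_diff_def)
    next
      show "?p 0 \<in> ?S" by (rule image_eqI[of _ _ 0]) auto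
    qed
    also have "norm (?p 1 - ?p 0) \<le> h * (1 + B)"
    proof -
      have "?p 1 - ?p 0 = (h, h *\<^sub>R v s x)" by simp
      moreover have "norm (h *\<^sub>R v s x) \<le> h * B" "norm h = h" using vB * by simp_all
      ultimately show ?thesis using norm_Pair_le[of h "h *\<^sub>R v s x"] by (simp only: distrib_left mult_1_right)
    qed
    then have "norm (?p 1 - ?p 0) * (e / (1 + B)) \<le> h * (1 + B) * (e / (1 + B))"
      using e B(1) by (intro mult_right_mono) auto
    also have "\<dots> = e * h" using B(1) by simp
    also have "?p 1 - ?p 0 = h *\<^sub>R (1, v s x)" by simp
    finally show "\<bar>q (s + h) (x + h *\<^sub>R v s x) - q s x - h * blinfun_apply (q' s x) (1, v s x)\<bar> \<le> e * h"
      using blinfun.scaleR_right[of "q' s x" h "(1, v s x)"] by simp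
  qed
qed

text \<open>To first order the Jacobian is \<open>1 + h * \<theta>\<close> and the density
  \<open>q s x + h * \<alpha>\<close>, with \<open>\<theta>\<close> the divergence and
  \<open>\<alpha>\<close> the derivative along \<open>(1, v)\<close>. The term
  \<open>h * (\<alpha> + q s x * \<theta>)\<close> of the product vanishes by \<open>pde\<close>;
  the rest is o(h) uniformly on the ball.\<close>

lemma jacobian_euler:
  assumes e: "e > 0"
  obtains \<delta> where "\<delta> > 0" "\<And>s h x. 0 \<le> s \<Longrightarrow> 0 < h \<Longrightarrow> h < \<delta> \<Longrightarrow> s + h \<le> \<tau> \<Longrightarrow> norm x \<le> R \<Longrightarrow>
    \<bar>\<bar>det (mat 1 + h *\<^sub>R v' s x)\<bar> * q (s + h) (x + h *\<^sub>R v s x) - q s x\<bar> \<le> e * h"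
proof -
  have cont_dq: "continuous_on ({0..\<tau>} \<times> UNIV) (\<lambda>(t, x). blinfun_apply (q' t x) (1, v t x))"
    using q'_cont v_cont by (auto simp: case_prod_beta intro!: continuous_intros)
  have "continuous_on UNIV (trace :: real^'n^'n \<Rightarrow> real)"
    unfolding trace_def[abs_def] by (intro continuous_intros)
  then have "continuous_on ({0..\<tau>} \<times> UNIV) (trace \<circ> (\<lambda>(t, x). v' t x))"
    by (intro continuous_on_compose v'_cont) (auto intro: continuous_on_subset)
  then have cont_tr: "continuous_on ({0..\<tau>} \<times> UNIV) (\<lambda>(t, x). trace (v' t x))"
    by (simp add: o_def case_prod_beta)
  obtain Kq where Kq: "Kq > 0" "\<And>t x. t \<in> {0..\<tau>} \<Longrightarrow> norm x \<le> R \<Longrightarrow> norm (q t x) \<le> Kq"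
    using bounded_on_cylinder[OF q_cont, of R] by blast
  obtain Ka where Ka: "Ka > 0" "\<And>t x. t \<in> {0..\<tau>} \<Longrightarrow> norm x \<le> R \<Longrightarrow> norm (blinfun_apply (q' t x) (1, v t x)) \<le> Ka"
    using bounded_on_cylinder[OF cont_dq, of R] by blast
  obtain Kt where Kt: "Kt > 0" "\<And>t x. t \<in> {0..\<tau>} \<Longrightarrow> norm x \<le> R \<Longrightarrow> norm (trace (v' t x)) \<le> Kt"
    using bounded_on_cylinder[OF cont_tr, of R] by blast
  obtain Km where Km: "Km > 0" "\<And>t x. t \<in> {0..\<tau>} \<Longrightarrow> norm x \<le> R \<Longrightarrow> norm (v' t x) \<le> Km"
    using bounded_on_cylinder[OF v'_cont, of R] by blast
  \<comment> \<open>The determinant error is multiplied by \<open>q\<close>, at most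
    \<open>Kq\<close>, and the density error by the determinant, at most 2; together they may use
    half of \<open>e\<close>. The cap 1 bounds the determinant error by \<open>h\<close>.\<close>
  define e1 where "e1 = min 1 (e / (2 * (Kq + 2)))"
  have e1: "e1 > 0" "e1 \<le> 1" "e1 * (Kq + 2) \<le> e / 2"
  proof -
    show "e1 > 0" "e1 \<le> 1" using e Kq by (auto simp: e1_def)
    have "e1 * (Kq + 2) \<le> e / (2 * (Kq + 2)) * (Kq + 2)"
      using Kq by (intro mult_right_mono) (auto simp: e1_def)
    also have "\<dots> = e / 2" using Kq by (simp add: field_simps)
    finally show "e1 * (Kq + 2) \<le> e / 2" .
  qed
  obtain d1 where d1: "d1 > 0" "\<And>s h x. 0 \<le> s \<Longrightarrow> 0 < h \<Longrightarrow> h < d1 \<Longrightarrow> s + h \<le> \<tau> \<Longrightarrow> norm x \<le> R \<Longrightarrow>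
    \<bar>q (s + h) (x + h *\<^sub>R v s x) - q s x - h * blinfun_apply (q' s x) (1, v s x)\<bar> \<le> e1 * h"
    using q_euler[OF e1(1), of R] by blast
  obtain d2 where d2: "d2 > 0" "\<And>h (M::real^'n^'n). 0 < h \<Longrightarrow> h < d2 \<Longrightarrow> norm M \<le> Km \<Longrightarrow>
    \<bar>det (mat 1 + h *\<^sub>R M) - 1 - h * trace M\<bar> \<le> e1 * h"
    using det_near_mat_1[OF e1(1), of Km] Km(1) by (metis less_imp_le)
  define d3 where "d3 = min (1 / (Kt + 1)) (e / (2 * (Ka * (Kt + 1))))"
  have d3: "d3 > 0" "d3 * (Kt + 1) \<le> 1" "d3 * (Ka * (Kt + 1)) \<le> e / 2"
  proof -
    show "d3 > 0" using e Ka Kt by (simp add: d3_def)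
    have "d3 * (Kt + 1) \<le> 1 / (Kt + 1) * (Kt + 1)"
      using Kt by (intro mult_right_mono) (auto simp: d3_def)
    then show "d3 * (Kt + 1) \<le> 1" using Kt by simp
    have "d3 * (Ka * (Kt + 1)) \<le> e / (2 * (Ka * (Kt + 1))) * (Ka * (Kt + 1))"
      using Kt Ka by (intro mult_right_mono) (auto simp: d3_def)
    then show "d3 * (Ka * (Kt + 1)) \<le> e / 2" using Kt Ka by simp
  qed
  show thesis
  proof (rule that[of "min d1 (min d2 d3)"])
    show "0 < min d1 (min d2 d3)" using d1 d2 d3 by simp
    fix s h and x :: "real^'n" assume *: "0 \<le> s" "0 < h" "h < min d1 (min d2 d3)" "s + h \<le> \<tau>" "norm x \<le> R"
    have s: "s \<in> {0..\<tau>}" using * by auto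
    define \<alpha> where "\<alpha> = blinfun_apply (q' s x) (1, v s x)"
    define \<theta> where "\<theta> = trace (v' s x)"
    define r1 where "r1 = q (s + h) (x + h *\<^sub>R v s x) - q s x - h * \<alpha>"
    define d where "d = det (mat 1 + h *\<^sub>R v' s x)"
    define r2 where "r2 = d - 1 - h * \<theta>"
    have r1: "\<bar>r1\<bar> \<le> e1 * h" using d1(2)[of s h x] * by (simp add: r1_def \<alpha>_def)
    have r2: "\<bar>r2\<bar> \<le> e1 * h" using d2(2)[of h "v' s x"] Km(2)[OF s] * by (simp add: r2_def d_def \<theta>_def)
    have q: "\<bar>q s x\<bar> \<le> Kq" using Kq(2)[OF s] * by simp
    have \<alpha>: "\<bar>\<alpha>\<bar> \<le> Ka" using Ka(2)[OF s] * by (simp add: \<alpha>_def)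
    have \<theta>: "\<bar>\<theta>\<bar> \<le> Kt" using Kt(2)[OF s] * by (simp add: \<theta>_def)
    have d': "\<bar>d - 1\<bar> \<le> h * (Kt + 1)"
    proof -
      have "\<bar>d - 1\<bar> \<le> h * \<bar>\<theta>\<bar> + \<bar>r2\<bar>" proof -
        have "d - 1 = h * \<theta> + r2" by (simp add: r2_def)
        then have "\<bar>d - 1\<bar> \<le> \<bar>h * \<theta>\<bar> + \<bar>r2\<bar>" by linarith
        then show ?thesis using * by (simp add: abs_mult)
      qed
      also have "\<dots> \<le> h * Kt + h * 1"
      proof (intro add_mono mult_left_mono \<theta>)
        have "e1 * h \<le> h" using e1 * by (simp add: mult_left_le_one_le)
        then show "\<bar>r2\<bar> \<le> h * 1" using r2 by simp
      qed (use * in simp)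
      finally show ?thesis by (simp add: algebra_simps)
    qed
    have "h * (Kt + 1) \<le> d3 * (Kt + 1)" using * Kt by (intro mult_right_mono) auto
    then have d1': "\<bar>d - 1\<bar> \<le> 1" using d' d3 by linarith
    then have d0: "0 \<le> d" "\<bar>d\<bar> \<le> 2" by auto
    have pde': "\<alpha> + q s x * \<theta> = 0" using pde[OF s] by (simp add: \<alpha>_def \<theta>_def)
    have "d * q (s + h) (x + h *\<^sub>R v s x) - q s x = h * (\<alpha> + q s x * \<theta>) + q s x * r2 + h * \<alpha> * (d - 1) + r1 * d"
      by (simp add: r1_def r2_def algebra_simps)
    also have "\<bar>\<dots>\<bar> \<le> \<bar>q s x * r2\<bar> + \<bar>h * \<alpha> * (d - 1)\<bar> + \<bar>r1 * d\<bar>"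
      unfolding pde' by simp
    also have "\<dots> \<le> Kq * (e1 * h) + h * Ka * (h * (Kt + 1)) + e1 * h * 2"
      unfolding abs_mult using q r1 r2 \<alpha> d' d0 * Kq(1) Ka(1) e1(1)
      by (intro add_mono mult_mono) auto
    also have "\<dots> = h * (e1 * (Kq + 2)) + h * (h * (Ka * (Kt + 1)))" by (simp add: algebra_simps)
    also have "\<dots> \<le> h * (e / 2) + h * (d3 * (Ka * (Kt + 1)))"
      using * e1(3) Ka(1) Kt(1) by (intro add_mono mult_left_mono mult_right_mono) auto
    also have "\<dots> \<le> h * (e / 2) + h * (e / 2)"
      using * d3(3) by (intro add_mono mult_left_mono) auto
    also have "\<dots> = e * h" by simp
    finally show "\<bar>\<bar>det (mat 1 + h *\<^sub>R v' s x)\<bar> * q (s + h) (x + h *\<^sub>R v s x) - q s x\<bar> \<le> e * h"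
      using d0 by (simp add: d_def)
  qed
qed

text \<open>Solving \<open>x + h *\<^sub>R v s x = z\<close> means finding the fixed point of
  \<open>z - h *\<^sub>R v s x\<close>, a contraction with factor 1/2 for such
  \<open>h\<close>.\<close>

lemma euler_step_bij:
  assumes s: "s \<in> {0..\<tau>}" and h: "0 < h" "h * L \<le> 1 / 2"
  shows "bij (\<lambda>x. x + h *\<^sub>R v s x)"
proof (rule bijI)
  have contr: "dist (z - h *\<^sub>R v s x) (z - h *\<^sub>R v s y) \<le> (1 / 2) * dist x y" for x y z
  proof -
    have "dist (z - h *\<^sub>R v s x) (z - h *\<^sub>R v s y) = h * norm (v s x - v s y)"
      using h by (simp add: dist_norm scaleR_diff_right[symmetric] norm_minus_commute)
    also have "\<dots> \<le> h * (L * norm (x - y))" using h v_lip[OF s] by (intro mult_left_mono) auto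
    also have "\<dots> \<le> (1 / 2) * norm (x - y)" using h mult_right_mono[OF h(2), of "norm (x - y)"] by simp
    finally show ?thesis by (simp add: dist_norm)
  qed
  have fp: "\<exists>!x. z - h *\<^sub>R v s x = x" for z
    using contr by (intro banach_fix_type[of "1/2"]) auto
  show "inj (\<lambda>x. x + h *\<^sub>R v s x)"
  proof (rule injI)
    fix x y assume "x + h *\<^sub>R v s x = y + h *\<^sub>R v s y"
    then show "x = y" using fp[of "x + h *\<^sub>R v s x"] by (metis add_diff_cancel_right')
  qed
  show "surj (\<lambda>x. x + h *\<^sub>R v s x)"
  proof (rule surjI)
    fix z
    show "(THE x. z - h *\<^sub>R v s x = x) + h *\<^sub>R v s (THE x. z - h *\<^sub>R v s x = x) = z"
      using theI'[OF fp[of z]] by (simp add: diff_eq_eq)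
  qed
qed

section \<open>Transport of the density by duality\<close>

lemma pushforward_test_function:
  fixes \<phi> :: "real^'n \<Rightarrow> real"
  assumes \<phi>_lip: "\<And>x y. \<bar>\<phi> x - \<phi> y\<bar> \<le> K * norm (x - y)" and K: "K \<ge> 0"
    and \<phi>_bd: "\<And>x. \<bar>\<phi> x\<bar> \<le> 1" and \<phi>_supp: "\<And>x. norm x > R0 \<Longrightarrow> \<phi> x = 0"
  shows "(\<integral>x. \<phi> (flow 0 x \<tau>) * q 0 x \<partial>lborel) = (\<integral>x. \<phi> x * q \<tau> x \<partial>lborel)"
proof -
  define u where "u s x = \<phi> (flow s x \<tau>)" for s x
  define F where "F s = (\<integral>x. u s x * q s x \<partial>lborel)" for s
  define Lu where "Lu = K * exp (L * \<tau>)"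
  have Lu: "Lu \<ge> 0" using K by (simp add: Lu_def)
  have u_lip: "\<bar>u s x - u s y\<bar> \<le> Lu * norm (x - y)" if "s \<in> {0..\<tau>}" for s x y
  proof -
    have "\<bar>u s x - u s y\<bar> \<le> K * norm (flow s x \<tau> - flow s y \<tau>)"
      unfolding u_def by (rule \<phi>_lip)
    also have "\<dots> \<le> K * (exp (L * \<tau>) * norm (x - y))"
      using that K by (intro mult_left_mono flow_lipschitz) auto
    finally show ?thesis by (simp add: Lu_def)
  qed
  have u_cont: "continuous_on UNIV (u s)" if "s \<in> {0..\<tau>}" for s
    using u_lip[OF that] Lu
    by (intro lipschitz_on_continuous_on[of Lu] lipschitz_onI) (auto simp: dist_norm)
  have q_cont1: "continuous_on S (q s)" if "s \<in> {0..\<tau>}" for s S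
    by (rule continuous_slice[OF q_cont that])
  \<comment> \<open>The backward growth bound gives all functions \<open>u s\<close> a common ball
    outside which they vanish.\<close>
  obtain R1 where R1: "R1 \<ge> 0" "\<And>s x. s \<in> {0..\<tau>} \<Longrightarrow> norm x > R1 \<Longrightarrow> u s x = 0"
  proof -
    obtain E where E: "E > 0"
      "\<And>s t x. 0 \<le> s \<Longrightarrow> s \<le> t \<Longrightarrow> t \<le> \<tau> \<Longrightarrow> 1 + (norm x)\<^sup>2 \<le> E * (1 + (norm (flow s x t))\<^sup>2)"
      using flow_growth by metis
    show thesis
    proof (rule that[of "sqrt (E * (1 + R0\<^sup>2))"])
      show "sqrt (E * (1 + R0\<^sup>2)) \<ge> 0" using E by simp
      fix s and x :: "real^'n" assume s: "s \<in> {0..\<tau>}" and x: "norm x > sqrt (E * (1 + R0\<^sup>2))"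
      have "E * (1 + R0\<^sup>2) < (norm x)\<^sup>2"
        using x real_le_rsqrt[of "norm x" "E * (1 + R0\<^sup>2)"] by (meson not_le)
      also have "\<dots> \<le> E * (1 + (norm (flow s x \<tau>))\<^sup>2)" using E(2)[of s \<tau> x] s by auto
      finally have "R0\<^sup>2 < (norm (flow s x \<tau>))\<^sup>2" using E(1) by simp
      then have "norm (flow s x \<tau>) > R0" using power2_less_imp_less by force
      then show "u s x = 0" by (simp add: u_def \<phi>_supp)
    qed
  qed
  \<comment> \<open>For \<open>h * C \<le> 1 / 2\<close> an Euler step leaves
    \<open>norm (S x) \<ge> (norm x - 1) / 2\<close>. Hence beyond radius \<open>2 * R1 + 1\<close>
    both \<open>x\<close> and \<open>S x\<close> lie outside the ball of radius \<open>R1\<close>,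
    and both integrands vanish.\<close>
  define R2 where "R2 = 2 * R1 + 1"
  obtain C where C: "C > 0" "\<And>t x. t \<in> {0..\<tau>} \<Longrightarrow> norm (v t x) \<le> C * (1 + norm x)"
    using v_growth by blast
  obtain Kq where Kq: "Kq > 0" "\<And>t x. t \<in> {0..\<tau>} \<Longrightarrow> norm x \<le> R2 \<Longrightarrow> norm (q t x) \<le> Kq"
    using bounded_on_cylinder[OF q_cont, of R2] by blast
  define V where "V = measure lborel (cball (0::real^'n) R2)"
  have V: "V \<ge> 0" by (simp add: V_def)
  have int_uq: "integrable lborel (\<lambda>x. u s x * q s x)" if "s \<in> {0..\<tau>}" for s
    using R1(2)[OF that] by (intro integrable_compact_support[of _ R1] continuous_intros u_cont q_cont1 that) auto
  have incr: "\<exists>\<delta>>0. \<forall>s h. 0 \<le> s \<longrightarrow> 0 < h \<longrightarrow> h < \<delta> \<longrightarrow> s + h \<le> \<tau> \<longrightarrow> \<bar>F (s + h) - F s\<bar> \<le> e * h"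
    if e: "e > 0" for e
  proof -
    \<comment> \<open>The integrand of the increment will be at most
      \<open>e1 * h * (1 + Lu * Kq)\<close>: 1 for the Jacobian defect, \<open>Lu * Kq\<close> for
      the Euler error of the flow. It lives on a ball of volume \<open>V\<close>.\<close>
    define e1 where "e1 = e / ((1 + Lu * Kq) * (V + 1))"
    have e1: "e1 > 0" using e Lu Kq V by (simp add: e1_def add_pos_nonneg)
    obtain d1 where d1: "d1 > 0" "\<And>s h x. 0 \<le> s \<Longrightarrow> 0 < h \<Longrightarrow> h < d1 \<Longrightarrow> s + h \<le> \<tau> \<Longrightarrow> norm x \<le> R2 \<Longrightarrow>
      \<bar>\<bar>det (mat 1 + h *\<^sub>R v' s x)\<bar> * q (s + h) (x + h *\<^sub>R v s x) - q s x\<bar> \<le> e1 * h"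
      using jacobian_euler[OF e1, of R2] by blast
    obtain d2 where d2: "d2 > 0" "\<And>s h x. 0 \<le> s \<Longrightarrow> 0 < h \<Longrightarrow> h < d2 \<Longrightarrow> s + h \<le> \<tau> \<Longrightarrow> norm x \<le> R2 \<Longrightarrow>
      norm (flow s x (s + h) - (x + h *\<^sub>R v s x)) \<le> e1 * h"
      using flow_euler[OF e1, of R2] by blast
    define d where "d = min (min d1 d2) (min (1 / (2 * L)) (1 / (2 * C)))"
    have "\<bar>F (s + h) - F s\<bar> \<le> e * h" if h: "0 \<le> s" "0 < h" "h < d" "s + h \<le> \<tau>" for s h
    proof -
      have s: "s \<in> {0..\<tau>}" "s + h \<in> {0..\<tau>}" using h by auto
      have hL: "h * L \<le> 1 / 2" and hC: "h * C \<le> 1 / 2"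
        using h L C(1) by (auto simp: d_def field_simps)
      define S where "S x = x + h *\<^sub>R v s x" for x
      define J where "J x = \<bar>det (mat 1 + h *\<^sub>R v' s x)\<bar>" for x
      define f where "f x = u (s + h) x * q (s + h) x" for x
      have S_der: "(S has_derivative (\<lambda>k. (mat 1 + h *\<^sub>R v' s x) *v k)) (at x)" for x
        unfolding S_def using v_der[OF s(1), of x]
        by (auto intro!: derivative_eq_intros simp: matrix_vector_mult_add_rdistrib scaleR_matrix_vector_assoc)
      have J_meas: "(\<lambda>x. det (matrix (\<lambda>k. (mat 1 + h *\<^sub>R v' s x) *v k))) \<in> borel_measurable borel"
      proof -
        have "continuous_on UNIV (v' s)" by (rule continuous_slice[OF v'_cont s(1)])
        then show ?thesis
          unfolding matrix_of_matrix_vector_mul det_def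
          by (intro borel_measurable_continuous_onI continuous_intros)
      qed
      have S_bij: "bij S" unfolding S_def using euler_step_bij[OF s(1) h(2) hL] .
      have f_int: "integrable lborel f" unfolding f_def by (rule int_uq[OF s(2)])
      have Jf: "integrable lborel (\<lambda>x. J x * f (S x))" "(\<integral>x. J x * f (S x) \<partial>lborel) = (\<integral>x. f x \<partial>lborel)"
        using change_of_variables[OF S_der S_bij J_meas f_int] by (simp_all add: J_def)
      \<comment> \<open>Substituting \<open>S x\<close> in the later integral brings both densities
        to the same base point.\<close>
      have "F (s + h) - F s = (\<integral>x. J x * f (S x) - u s x * q s x \<partial>lborel)"
        unfolding Bochner_Integration.integral_diff[OF Jf(1) int_uq[OF s(1)]] Jf(2) by (simp add: F_def f_def[abs_def])
      also have "\<bar>\<dots>\<bar> \<le> (\<integral>x. e1 * h * (1 + Lu * Kq) * indicator (cball (0::real^'n) R2) x \<partial>lborel)"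
      proof (rule Bochner_Integration.integral_abs_bound_integral)
        show "integrable lborel (\<lambda>x. J x * f (S x) - u s x * q s x)"
          using Jf(1) int_uq[OF s(1)] by (rule Bochner_Integration.integrable_diff)
        show "integrable lborel (\<lambda>x::real^'n. e1 * h * (1 + Lu * Kq) * indicator (cball 0 R2) x)"
          by (intro integrable_mult_right integrable_real_indicator) (use emeasure_lborel_cball_finite in auto)
        fix x :: "real^'n"
        show "\<bar>J x * f (S x) - u s x * q s x\<bar> \<le> e1 * h * (1 + Lu * Kq) * indicator (cball 0 R2) x"
        proof (cases "norm x \<le> R2")
          case True
          \<comment> \<open>\<open>u\<close> is constant along trajectories, so its variation across
            the Euler step is only the error between step and flow.\<close>
          have us: "u s x = u (s + h) (flow s x (s + h))"
            using flow_semigroup[of s "s + h" \<tau> x] h by (simp add: u_def)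
          have "\<bar>u (s + h) (S x) - u s x\<bar> \<le> Lu * norm (S x - flow s x (s + h))"
            unfolding us by (rule u_lip[OF s(2)])
          also have "\<dots> \<le> Lu * (e1 * h)"
            using d2(2)[of s h x] h True Lu unfolding S_def
            by (intro mult_left_mono) (auto simp: d_def norm_minus_commute)
          finally have A: "\<bar>u (s + h) (S x) - u s x\<bar> \<le> Lu * (e1 * h)" .
          have B: "\<bar>J x * q (s + h) (S x) - q s x\<bar> \<le> e1 * h"
            using d1(2)[of s h x] h True by (auto simp: d_def J_def S_def)
          have "J x * f (S x) - u s x * q s x = u (s + h) (S x) * (J x * q (s + h) (S x) - q s x)
              + (u (s + h) (S x) - u s x) * q s x"
            by (simp add: f_def algebra_simps)
          also have "\<bar>\<dots>\<bar> \<le> \<bar>u (s + h) (S x)\<bar> * \<bar>J x * q (s + h) (S x) - q s x\<bar> + \<bar>u (s + h) (S x) - u s x\<bar> * \<bar>q s x\<bar>"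
            unfolding abs_mult[symmetric] by (rule abs_triangle_ineq)
          also have "\<dots> \<le> 1 * (e1 * h) + Lu * (e1 * h) * Kq"
            using A B Kq(2)[OF s(1) True] \<phi>_bd e1 h Lu
            by (intro add_mono mult_mono) (auto simp: u_def)
          also have "\<dots> = e1 * h * (1 + Lu * Kq)" by (simp add: algebra_simps)
          finally show ?thesis using True by simp
        next
          case False
          then have x: "norm x > R2" by simp
          have "norm (h *\<^sub>R v s x) \<le> h * (C * (1 + norm x))"
            using C(2)[OF s(1), of x] h by simp
          also have "\<dots> \<le> (1 / 2) * (1 + norm x)"
            using mult_right_mono[OF hC, of "1 + norm x"] by (simp add: algebra_simps)
          finally have "norm (S x) \<ge> norm x - (1 / 2) * (1 + norm x)"
            unfolding S_def using norm_diff_ineq[of x "h *\<^sub>R v s x"] by linarith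
          then have "norm (S x) > R1" using x R1(1) by (simp add: R2_def field_simps)
          then have "u (s + h) (S x) = 0" by (rule R1(2)[OF s(2)])
          moreover have "u s x = 0" using x R1(1) by (intro R1(2)[OF s(1)]) (simp add: R2_def)
          ultimately show ?thesis using e1 h Lu Kq(1) by (simp add: f_def)
        qed
      qed
      also have "\<dots> = e1 * h * (1 + Lu * Kq) * V"
        by (simp add: V_def)
      also have "\<dots> \<le> e1 * h * (1 + Lu * Kq) * (V + 1)"
        using e1 h Lu Kq(1) by (intro mult_left_mono) auto
      also have "\<dots> = e * h"
      proof -
        have "1 + Lu * Kq > 0" "V + 1 > 0" using Lu Kq(1) V by (auto simp: add_pos_nonneg)
        then show ?thesis by (simp add: e1_def)
      qed
      finally show ?thesis .
    qed
    moreover have "d > 0" using d1 d2 L C by (simp add: d_def)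
    ultimately show ?thesis by blast
  qed
  \<comment> \<open>For \<open>t < s\<close> the forward estimate is applied with base time
    \<open>t\<close>; this is possible because \<open>\<delta>\<close> does not depend on the base
    time.\<close>
  have "(F has_derivative (\<lambda>h. 0)) (at s within {0..\<tau>})" if s: "s \<in> {0..\<tau>}" for s
    unfolding has_derivative_within_alt
  proof (intro conjI allI impI bounded_linear_zero)
    fix e :: real assume "e > 0"
    then obtain \<delta> where \<delta>: "\<delta> > 0"
      "\<And>s h. 0 \<le> s \<Longrightarrow> 0 < h \<Longrightarrow> h < \<delta> \<Longrightarrow> s + h \<le> \<tau> \<Longrightarrow> \<bar>F (s + h) - F s\<bar> \<le> e * h"
      using incr by metis
    have "\<bar>F t - F s\<bar> \<le> e * \<bar>t - s\<bar>" if "t \<in> {0..\<tau>}" "\<bar>t - s\<bar> < \<delta>" for t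
      using \<delta>(2)[of s "t - s"] \<delta>(2)[of t "s - t"] that s by (cases s t rule: linorder_cases) auto
    then show "\<exists>d>0. \<forall>y\<in>{0..\<tau>}. norm (y - s) < d \<longrightarrow> norm (F y - F s - 0) \<le> e * norm (y - s)"
      using \<delta>(1) by auto
  qed
  then have "F 0 = F \<tau>"
    using has_derivative_zero_unique[of "{0..\<tau>}" F 0 \<tau>] tau by auto
  moreover have "flow \<tau> x \<tau> = x" for x using tau by (simp add: flow_init)
  ultimately show ?thesis by (simp add: F_def u_def)
qed

lemma pushforward_density:
  assumes q0: "integrable lborel (q 0)" "\<And>x. q 0 x \<ge> 0" and q1: "integrable lborel (q \<tau>)" "\<And>x. q \<tau> x \<ge> 0"
  shows "distr (density lborel (\<lambda>x. ennreal (q 0 x))) borel (\<lambda>x. flow 0 x \<tau>) = density lborel (\<lambda>x. ennreal (q \<tau> x))"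
proof (rule measure_eqI_test_functions)
  have [measurable]: "q 0 \<in> borel_measurable borel" "q \<tau> \<in> borel_measurable borel"
    using q0 q1 by auto
  have "continuous_on UNIV (\<lambda>x. flow 0 x \<tau>)"
    using flow_lipschitz[of 0 \<tau>] tau
    by (intro lipschitz_on_continuous_on[of "exp (L * \<tau>)"] lipschitz_onI) (auto simp: dist_norm)
  then have [measurable]: "(\<lambda>x. flow 0 x \<tau>) \<in> borel_measurable borel"
    by (rule borel_measurable_continuous_onI)
  have fin: "finite_measure (density lborel (\<lambda>x. ennreal (f x)))" if "integrable lborel f" "\<And>x. f x \<ge> 0" for f :: "real^'n \<Rightarrow> real"
    using that nn_integral_eq_integral[OF that(1)]
    by (intro finite_measureI) (auto simp: emeasure_density)
  show "finite_measure (distr (density lborel (\<lambda>x. ennreal (q 0 x))) borel (\<lambda>x. flow 0 x \<tau>))"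
    by (rule finite_measure.finite_measure_distr[OF fin[OF q0]]) simp
  show "finite_measure (density lborel (\<lambda>x. ennreal (q \<tau> x)))" by (rule fin[OF q1])
  fix \<phi> :: "real^'n \<Rightarrow> real" and K R0
  assume \<phi>: "\<And>x y. \<bar>\<phi> x - \<phi> y\<bar> \<le> K * norm (x - y)" "0 \<le> K" "\<And>x. \<bar>\<phi> x\<bar> \<le> 1" "\<And>x. R0 < norm x \<Longrightarrow> \<phi> x = 0"
  have "continuous_on UNIV \<phi>"
    using \<phi>(1,2) by (intro lipschitz_on_continuous_on[of K] lipschitz_onI) (auto simp: dist_norm)
  then have [measurable]: "\<phi> \<in> borel_measurable borel" by (rule borel_measurable_continuous_onI)
  have "(\<integral>x. \<phi> x \<partial>(distr (density lborel (\<lambda>x. ennreal (q 0 x))) borel (\<lambda>x. flow 0 x \<tau>)))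
      = (\<integral>x. q 0 x * \<phi> (flow 0 x \<tau>) \<partial>lborel)"
    using q0(2) by (simp add: integral_distr integral_density)
  also have "\<dots> = (\<integral>x. q \<tau> x * \<phi> x \<partial>lborel)"
    using pushforward_test_function[OF \<phi>] by (simp add: mult.commute)
  also have "\<dots> = (\<integral>x. \<phi> x \<partial>(density lborel (\<lambda>x. ennreal (q \<tau> x))))"
    using q1(2) by (simp add: integral_density)
  finally show "(\<integral>x. \<phi> x \<partial>(distr (density lborel (\<lambda>x. ennreal (q 0 x))) borel (\<lambda>x. flow 0 x \<tau>)))
      = (\<integral>x. \<phi> x \<partial>(density lborel (\<lambda>x. ennreal (q \<tau> x))))" .
qed auto

end

section \<open>Matrix exponential and Gramian\<close>

lemma has_vector_derivative_matrixI:
  fixes F :: "real \<Rightarrow> real^'n^'m"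
  assumes "\<And>i j. ((\<lambda>t. F t $ i $ j) has_real_derivative F' $ i $ j) (at t within S)"
  shows "(F has_vector_derivative F') (at t within S)"
  unfolding has_vector_derivative_def
proof (subst has_derivative_componentwise_within, intro ballI)
  fix u :: "real^'n^'m" assume "u \<in> Basis"
  then obtain i w where u: "u = axis i w" "w \<in> Basis" unfolding Basis_vec_def by blast
  then obtain j where w: "w = axis j 1" unfolding Basis_vec_def by auto
  have "X \<bullet> u = X $ i $ j" for X :: "real^'n^'m"
    by (simp add: u w inner_axis)
  then show "((\<lambda>x. F x \<bullet> u) has_derivative (\<lambda>x. x *\<^sub>R F' \<bullet> u)) (at t within S)"
    using assms[of i j] by (simp add: has_field_derivative_def mult.commute[of _ "F' $ i $ j"])
qed

lemma mpow_0 [simp]: "mpow M 0 = mat 1" and mpow_Suc: "mpow M (Suc k) = M ** mpow M k"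
  by (simp_all add: mpow_def)

text \<open>The sum of all absolute entries dominates every row sum, so one more factor
  \<open>A\<close> costs at most one more factor of it.\<close>

lemma mpow_bound: "\<exists>C\<ge>0. \<forall>k i j. \<bar>mpow (A::real^'n^'n) k $ i $ j\<bar> \<le> C ^ k"
proof (intro exI[of _ "\<Sum>i\<in>UNIV. \<Sum>l\<in>UNIV. \<bar>A $ i $ l\<bar>"] conjI allI)
  let ?C = "\<Sum>i\<in>UNIV. \<Sum>l\<in>UNIV. \<bar>A $ i $ l\<bar>"
  show "0 \<le> ?C" by (intro sum_nonneg) auto
  fix k i j
  show "\<bar>mpow A k $ i $ j\<bar> \<le> ?C ^ k"
  proof (induction k arbitrary: i)
    case 0
    then show ?case by (simp add: mat_def)
  next
    case (Suc k)
    have "\<bar>mpow A (Suc k) $ i $ j\<bar> = \<bar>\<Sum>l\<in>UNIV. A $ i $ l * mpow A k $ l $ j\<bar>"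
      by (simp add: mpow_Suc matrix_matrix_mult_def)
    also have "\<dots> \<le> (\<Sum>l\<in>UNIV. \<bar>A $ i $ l * mpow A k $ l $ j\<bar>)" by (rule sum_abs)
    also have "\<dots> \<le> (\<Sum>l\<in>UNIV. \<bar>A $ i $ l\<bar> * ?C ^ k)"
      unfolding abs_mult by (intro sum_mono mult_left_mono Suc abs_ge_zero)
    also have "\<dots> = (\<Sum>l\<in>UNIV. \<bar>A $ i $ l\<bar>) * ?C ^ k" by (simp add: sum_distrib_right)
    also have "\<dots> \<le> ?C * ?C ^ k"
      by (intro mult_right_mono member_le_sum[of i UNIV "\<lambda>i. \<Sum>l\<in>UNIV. \<bar>A $ i $ l\<bar>"])
        (auto intro!: sum_nonneg zero_le_power)
    finally show ?case by simp
  qed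
qed

lemma summable_mexp_coeff: "summable (\<lambda>k. (mpow (A::real^'n^'n) k $ i $ j / fact k) * t ^ k)"
proof -
  obtain C where C: "C \<ge> 0" "\<And>k i j. \<bar>mpow A k $ i $ j\<bar> \<le> C ^ k" using mpow_bound[of A] by blast
  have "summable (\<lambda>k. inverse (fact k) * (C * \<bar>t\<bar>) ^ k)" by (rule summable_exp)
  then show ?thesis
  proof (rule summable_comparison_test'[of _ 0])
    fix k :: nat
    have "norm ((mpow A k $ i $ j / fact k) * t ^ k) = \<bar>mpow A k $ i $ j\<bar> * (inverse (fact k) * \<bar>t\<bar> ^ k)"
      by (simp add: abs_mult power_abs divide_inverse)
    also have "\<dots> \<le> C ^ k * (inverse (fact k) * \<bar>t\<bar> ^ k)" by (intro mult_right_mono C) auto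
    finally show "norm ((mpow A k $ i $ j / fact k) * t ^ k) \<le> inverse (fact k) * (C * \<bar>t\<bar>) ^ k"
      by (simp add: power_mult_distrib mult_ac)
  qed
qed

text \<open>Entrywise the exponential is an everywhere convergent real power series, which can be
  differentiated term by term.\<close>

lemma mexp_component: "mexp t (A::real^'n^'n) $ i $ j = (\<Sum>k. (mpow A k $ i $ j / fact k) * t ^ k)"
proof -
  let ?E = "\<chi> i j. (\<Sum>k. (mpow A k $ i $ j / fact k) * t ^ k)"
  have "(\<lambda>k. ((t ^ k) / fact k) *\<^sub>R mpow A k) sums ?E"
    unfolding sums_def
  proof (intro vec_tendstoI)
    fix i j
    show "(\<lambda>n. (\<Sum>k<n. ((t ^ k) / fact k) *\<^sub>R mpow A k) $ i $ j) \<longlonglongrightarrow> ?E $ i $ j"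
      using summable_LIMSEQ[OF summable_mexp_coeff[of A i j t]] by (simp add: mult.commute)
  qed
  then show ?thesis by (simp add: mexp_def sums_unique[symmetric])
qed

lemma mexp_0: "mexp 0 (A::real^'n^'n) = mat 1"
  unfolding vec_eq_iff mexp_component powser_zero by simp

lemma mexp_has_vector_derivative:
  "((\<lambda>t. mexp t (A::real^'n^'n)) has_vector_derivative A ** mexp t A) (at t within S)"
proof (rule has_vector_derivative_matrixI)
  fix i j
  let ?c = "\<lambda>l k. mpow A k $ l $ j / fact k"
  have "((\<lambda>t. \<Sum>k. ?c i k * t ^ k) has_real_derivative (\<Sum>k. diffs (?c i) k * t ^ k)) (at t)"
    by (rule termdiffs_strong_converges_everywhere[OF summable_mexp_coeff])
  moreover have "(\<Sum>k. diffs (?c i) k * t ^ k) = (A ** mexp t A) $ i $ j"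
  proof -
    have "diffs (?c i) k * t ^ k = (\<Sum>l\<in>UNIV. A $ i $ l * (?c l k * t ^ k))" for k
    proof -
      have "diffs (?c i) k = (\<Sum>l\<in>UNIV. A $ i $ l * mpow A k $ l $ j) / fact k"
        by (simp add: diffs_def mpow_Suc matrix_matrix_mult_def fact_Suc del: of_nat_Suc)
      then show ?thesis by (simp add: sum_divide_distrib sum_distrib_right mult.assoc)
    qed
    then have "(\<Sum>k. diffs (?c i) k * t ^ k) = (\<Sum>k. \<Sum>l\<in>UNIV. A $ i $ l * (?c l k * t ^ k))" by simp
    also have "\<dots> = (\<Sum>l\<in>UNIV. \<Sum>k. A $ i $ l * (?c l k * t ^ k))"
      by (rule suminf_sum) (rule summable_mult[OF summable_mexp_coeff])
    also have "\<dots> = (\<Sum>l\<in>UNIV. A $ i $ l * mexp t A $ l $ j)"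
      unfolding mexp_component by (intro sum.cong refl suminf_mult summable_mexp_coeff)
    finally show ?thesis by (simp add: matrix_matrix_mult_def)
  qed
  ultimately show "((\<lambda>t. mexp t A $ i $ j) has_real_derivative (A ** mexp t A) $ i $ j) (at t within S)"
    unfolding mexp_component by (simp add: has_field_derivative_at_within)
qed

lemma bounded_linear_transpose: "bounded_linear (transpose :: real^'n^'m \<Rightarrow> real^'m^'n)"
  by (rule linear_conv_bounded_linear[THEN iffD1]) (auto intro!: linearI simp: transpose_def vec_eq_iff)

section \<open>Lyapunov equation and symmetry of the Gramian\<close>

lemma gramian_integrand_has_vector_derivative:
  fixes A :: "real^'n^'n" and B :: "real^'m^'n"
  defines "W \<equiv> (\<lambda>\<tau>. mexp \<tau> A ** B ** transpose B ** transpose (mexp \<tau> A))"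
  shows "(W has_vector_derivative (A ** W t + W t ** transpose A)) (at t within S)"
proof -
  note mm = bounded_bilinear.has_vector_derivative[OF bounded_bilinear_matrix_mult]
  note E = mexp_has_vector_derivative[of A t S]
  have "((\<lambda>t. mexp t A ** (B ** transpose B)) has_vector_derivative (A ** mexp t A) ** (B ** transpose B)) (at t within S)"
    using bounded_linear.has_vector_derivative[OF bounded_bilinear.bounded_linear_left[OF bounded_bilinear_matrix_mult] E] .
  from mm[OF this bounded_linear.has_vector_derivative[OF bounded_linear_transpose E]]
  show ?thesis unfolding W_def
    by (simp add: matrix_mul_assoc matrix_transpose_mul add.commute)
qed

text \<open>The derivative is the integrand \<open>W t\<close>. Integrating
  \<open>W' = A ** W + W ** transpose A\<close> from 0 expresses \<open>W t - W 0\<close> through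
  the Gramian itself, and \<open>W 0 = B ** transpose B\<close>.\<close>

lemma gramian_has_vector_derivative:
  fixes A :: "real^'n^'n" and B :: "real^'m^'n"
  assumes t: "t > 0"
  shows "(gramian A B has_vector_derivative
    (A ** gramian A B t + gramian A B t ** transpose A + B ** transpose B)) (at t)"
proof -
  define W where "W \<tau> = mexp \<tau> A ** B ** transpose B ** transpose (mexp \<tau> A)" for \<tau>
  have W_der: "(W has_vector_derivative (A ** W t + W t ** transpose A)) (at t within S)" for t S
    unfolding W_def by (rule gramian_integrand_has_vector_derivative)
  have W_cont: "continuous_on S W" for S
    using W_der by (meson continuous_on_eq_continuous_within has_vector_derivative_continuous)
  have G: "gramian A B = (\<lambda>t. integral {0..t} W)"
    by (simp add: gramian_def[abs_def] W_def[abs_def])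
  have "(gramian A B has_vector_derivative W t) (at t within {0..t+1})"
    unfolding G using t by (intro integral_has_vector_derivative W_cont) auto
  then have 1: "(gramian A B has_vector_derivative W t) (at t)"
    using t at_within_Icc_at[of 0 t "t + 1"] by simp
  let ?L = "\<lambda>X. A ** X + X ** transpose A"
  have L: "bounded_linear ?L"
    by (intro bounded_linear_add bounded_bilinear.bounded_linear_right[OF bounded_bilinear_matrix_mult]
        bounded_bilinear.bounded_linear_left[OF bounded_bilinear_matrix_mult])
  have "((\<lambda>\<tau>. ?L (W \<tau>)) has_integral W t - W 0) {0..t}"
    using t by (intro fundamental_theorem_of_calculus W_der) auto
  moreover have "((\<lambda>\<tau>. ?L (W \<tau>)) has_integral ?L (gramian A B t)) {0..t}"
    using has_integral_linear[OF integrable_integral[OF integrable_continuous_interval[OF W_cont]] L]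
    by (simp add: G o_def)
  ultimately have "W t - W 0 = ?L (gramian A B t)" by (rule has_integral_unique)
  then have "W t = ?L (gramian A B t) + B ** transpose B"
    by (simp add: W_def mexp_0 transpose_mat algebra_simps)
  with 1 show ?thesis by simp
qed

text \<open>Both properties pass from the integrand through linear maps; its quadratic form is a
  squared norm.\<close>

lemma gramian_symmetric_nonneg:
  fixes A :: "real^'n^'n" and B :: "real^'m^'n"
  shows "transpose (gramian A B t) = gramian A B t" and "0 \<le> x \<bullet> (gramian A B t *v x)"
proof -
  define W where "W \<tau> = mexp \<tau> A ** B ** transpose B ** transpose (mexp \<tau> A)" for \<tau>
  have W_cont: "continuous_on S W" for S
    using gramian_integrand_has_vector_derivative[of A B] unfolding W_def[abs_def]
    by (meson continuous_on_eq_continuous_within has_vector_derivative_continuous)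
  have int: "(W has_integral gramian A B t) {0..t}"
    using integrable_integral[OF integrable_continuous_interval[OF W_cont]]
    by (simp add: gramian_def W_def[abs_def])
  have "transpose (W \<tau>) = W \<tau>" for \<tau>
    by (simp add: W_def matrix_transpose_mul transpose_transpose matrix_mul_assoc)
  then have "(W has_integral transpose (gramian A B t)) {0..t}"
    using has_integral_linear[OF int bounded_linear_transpose] by (simp add: o_def)
  with int show "transpose (gramian A B t) = gramian A B t" by (rule has_integral_unique[symmetric])
  have lin: "bounded_linear (\<lambda>X. x \<bullet> (X *v x))"
    by (intro bounded_linear_inner_right_comp bounded_bilinear.bounded_linear_left[OF bounded_bilinear_matrix_vector_mult])
  have "x \<bullet> (W \<tau> *v x) = (norm (transpose B *v (transpose (mexp \<tau> A) *v x)))\<^sup>2" for \<tau>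
    by (simp add: W_def power2_norm_eq_inner matrix_vector_mul_assoc[symmetric])
      (metis dot_lmul_matrix matrix_vector_mul_assoc transpose_matrix_vector)
  then have "((\<lambda>\<tau>. (norm (transpose B *v (transpose (mexp \<tau> A) *v x)))\<^sup>2) has_integral x \<bullet> (gramian A B t *v x)) {0..t}"
    using has_integral_linear[OF int lin] by (simp add: o_def)
  then show "0 \<le> x \<bullet> (gramian A B t *v x)" by (rule has_integral_nonneg) simp
qed

section \<open>Gaussian integrals\<close>

text \<open>Cramer's rule displays the entries of the inverse as quotients of polynomials in the
  entries of \<open>M\<close>, from which continuity can be read off.\<close>

lemma matrix_inv_cramer:
  fixes M :: "real^'n^'n"
  assumes "invertible M"
  shows "matrix_inv M = (\<chi> k j. det (\<chi> i l. if l = k then axis j 1 $ i else M $ i $ l) / det M)"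
proof -
  have "det M \<noteq> 0" using assms by (simp add: invertible_det_nz)
  have "matrix_inv M $ k $ j = det (\<chi> i l. if l = k then axis j 1 $ i else M $ i $ l) / det M" for k j
  proof -
    have "M *v (matrix_inv M *v axis j 1) = axis j 1"
      using assms by (simp add: matrix_vector_mul_assoc matrix_inv_mult)
    then have "matrix_inv M *v axis j 1 = (\<chi> k. det (\<chi> i l. if l = k then axis j 1 $ i else M $ i $ l) / det M)"
      using cramer[OF \<open>det M \<noteq> 0\<close>] by blast
    moreover have "(matrix_inv M *v axis j 1) $ k = matrix_inv M $ k $ j"
      by (simp add: matrix_vector_mult_basis column_def)
    ultimately show ?thesis by simp
  qed
  then show ?thesis by (simp add: vec_eq_iff)
qed

lemma continuous_on_matrix_inv:
  fixes F :: "'a::topological_space \<Rightarrow> real^'n^'n"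
  assumes "continuous_on S F" "\<And>t. t \<in> S \<Longrightarrow> invertible (F t)"
  shows "continuous_on S (\<lambda>t. matrix_inv (F t))"
proof -
  have [continuous_intros]: "continuous_on S (\<lambda>t. if l = k then c else F t $ i $ l)" for i l k :: 'n and c
    by (cases "l = k") (auto intro!: continuous_intros assms(1))
  have "continuous_on S (\<lambda>t. \<chi> k j. det (\<chi> i l. if l = k then axis j 1 $ i else F t $ i $ l) / det (F t))"
    unfolding det_def
    by (intro continuous_intros assms(1))
      (use assms(2) in \<open>auto simp: invertible_det_nz det_def intro!: continuous_intros\<close>)
  then show ?thesis
    by (rule continuous_on_eq) (simp add: matrix_inv_cramer[OF assms(2)])
qed

lemma has_vector_derivative_iff_quotient:
  "(f has_vector_derivative D) (at t) \<longleftrightarrow> ((\<lambda>s. (f s - f t) /\<^sub>R (s - t)) \<longlongrightarrow> D) (at t)"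
proof -
  have *: "norm (f s - f t - (s - t) *\<^sub>R D) / \<bar>s - t\<bar> = norm ((f s - f t) /\<^sub>R (s - t) - D)" if "s \<noteq> t" for s
  proof -
    have "(f s - f t) /\<^sub>R (s - t) - D = (f s - f t - (s - t) *\<^sub>R D) /\<^sub>R (s - t)"
      using that by (simp add: scaleR_diff_right)
    then show ?thesis by (simp add: divide_inverse mult.commute)
  qed
  have "(f has_vector_derivative D) (at t) \<longleftrightarrow> ((\<lambda>s. norm (f s - f t - (s - t) *\<^sub>R D) / norm (s - t)) \<longlongrightarrow> 0) (at t)"
    unfolding has_vector_derivative_def has_derivative_iff_norm by (simp add: bounded_linear_scaleR_left)
  also have "\<dots> \<longleftrightarrow> ((\<lambda>s. norm ((f s - f t) /\<^sub>R (s - t) - D)) \<longlongrightarrow> 0) (at t)"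
    by (rule tendsto_cong) (auto simp: eventually_at_filter * intro!: always_eventually)
  finally show ?thesis by (simp add: tendsto_norm_zero_iff Lim_null[of _ D])
qed

text \<open>From the identity \<open>?P s - ?P t = - (?P s ** (F s - F t) ** ?P t)\<close>: the
  difference quotient converges once inversion is known to be continuous.\<close>

lemma matrix_inv_has_vector_derivative:
  fixes F :: "real \<Rightarrow> real^'n^'n"
  assumes S: "open S" "t \<in> S" and F: "continuous_on S F" "\<And>s. s \<in> S \<Longrightarrow> invertible (F s)"
    and der: "(F has_vector_derivative F') (at t)"
  shows "((\<lambda>s. matrix_inv (F s)) has_vector_derivative - (matrix_inv (F t) ** F' ** matrix_inv (F t))) (at t)"
proof -
  let ?P = "\<lambda>s. matrix_inv (F s)"
  note tendsto_mult_matrix = bounded_bilinear.tendsto[OF bounded_bilinear_matrix_mult]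
  have scale: "c *\<^sub>R (X ** Y ** Z) = X ** (c *\<^sub>R Y) ** Z" for c and X Y Z :: "real^'n^'n"
    by (simp add: bounded_bilinear.scaleR_left[OF bounded_bilinear_matrix_mult]
        bounded_bilinear.scaleR_right[OF bounded_bilinear_matrix_mult])
  have diff: "?P s - ?P t = - (?P s ** (F s - F t) ** ?P t)" if "s \<in> S" for s
  proof -
    have "?P s ** (F s - F t) ** ?P t = (?P s ** F s) ** ?P t - ?P s ** (F t ** ?P t)"
      by (simp add: bounded_bilinear.diff_right[OF bounded_bilinear_matrix_mult]
          bounded_bilinear.diff_left[OF bounded_bilinear_matrix_mult] matrix_mul_assoc)
    then show ?thesis using matrix_inv_mult[OF F(2)[OF that]] matrix_inv_mult[OF F(2)[OF S(2)]] by simp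
  qed
  have Pt: "(?P \<longlongrightarrow> ?P t) (at t)"
    using continuous_on_matrix_inv[OF F] S by (simp add: continuous_on_eq_continuous_at isCont_def)
  have "((\<lambda>s. - (?P s ** ((F s - F t) /\<^sub>R (s - t)) ** ?P t)) \<longlongrightarrow> - (?P t ** F' ** ?P t)) (at t)"
    using der unfolding has_vector_derivative_iff_quotient
    by (intro tendsto_minus tendsto_mult_matrix Pt tendsto_const)
  moreover have "\<forall>\<^sub>F s in at t. - (?P s ** ((F s - F t) /\<^sub>R (s - t)) ** ?P t) = (?P s - ?P t) /\<^sub>R (s - t)"
    using eventually_at_in_open'[OF S] by eventually_elim (simp add: diff scale)
  ultimately show ?thesis
    unfolding has_vector_derivative_iff_quotient by (rule Lim_transform_eventually)
qed

section \<open>Reduction of a Gaussian to the standard one\<close>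

lemma symmetric_inner: "transpose Q = Q \<Longrightarrow> (x::real^'n) \<bullet> (Q *v y) = (Q *v x) \<bullet> y"
  by (metis dot_lmul_matrix transpose_matrix_vector)

text \<open>If the form vanished at \<open>x\<close>, moving by \<open>r\<close> against
  \<open>Q *v x\<close> would change it by \<open>- 2 * r * (y \<bullet> y) + r\<^sup>2 * c\<close>,
  which is negative for small positive \<open>r\<close>.\<close>

lemma pos_def_of_invertible:
  fixes Q :: "real^'n^'n"
  assumes sym: "transpose Q = Q" and psd: "\<And>x. 0 \<le> x \<bullet> (Q *v x)" and inv: "invertible Q" and x: "x \<noteq> 0"
  shows "0 < x \<bullet> (Q *v x)"
proof (rule ccontr)
  assume "\<not> 0 < x \<bullet> (Q *v x)"
  then have 0: "x \<bullet> (Q *v x) = 0" using psd[of x] by simp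
  define y where "y = Q *v x"
  define c where "c = y \<bullet> (Q *v y)"
  have "y \<noteq> 0"
  proof
    assume "y = 0"
    then have "matrix_inv Q *v (Q *v x) = 0" by (simp add: y_def)
    then show False using x by (simp add: matrix_vector_mul_assoc matrix_inv_mult[OF inv])
  qed
  then have yy: "y \<bullet> y > 0" by simp
  have c: "c \<ge> 0" unfolding c_def by (rule psd)
  have *: "0 \<le> - 2 * r * (y \<bullet> y) + r\<^sup>2 * c" for r
  proof -
    have "0 \<le> (x - r *\<^sub>R y) \<bullet> (Q *v (x - r *\<^sub>R y))" by (rule psd)
    also have "\<dots> = x \<bullet> (Q *v x) - r * (x \<bullet> (Q *v y)) - r * (y \<bullet> (Q *v x)) + r\<^sup>2 * (y \<bullet> (Q *v y))"
      by (simp add: matrix_vector_mult_diff_distrib matrix_vector_mult_scaleR inner_diff_left inner_diff_right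
          power2_eq_square algebra_simps)
    also have "x \<bullet> (Q *v y) = y \<bullet> y" using symmetric_inner[OF sym, of x y] by (simp add: y_def)
    also have "y \<bullet> (Q *v x) = y \<bullet> y" by (simp add: y_def)
    finally show ?thesis using 0 by (simp add: c_def)
  qed
  \<comment> \<open>The denominator \<open>c + 1\<close> makes \<open>r * c < y \<bullet> y\<close>
    even when \<open>c\<close> is 0.\<close>
  define r where "r = (y \<bullet> y) / (c + 1)"
  have r: "r > 0" "r * (c + 1) = y \<bullet> y" using yy c by (simp_all add: r_def)
  have "r * (r * c) \<le> r * (y \<bullet> y)"
    using r by (intro mult_left_mono) (auto simp: algebra_simps)
  moreover have "0 < r * (y \<bullet> y)" using r yy by simp
  ultimately show False using *[of r] by (simp add: power2_eq_square algebra_simps)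
qed

text \<open>Gram-Schmidt for the inner product of \<open>Q\<close>, by induction over index sets:
  while fewer than CARD('n) vectors are chosen, a dimension count leaves a nonzero vector orthogonal
  to all \<open>Q *v r i\<close>. The resulting matrix satisfies
  \<open>R ** transpose R = matrix_inv Q\<close>.\<close>

lemma orthonormalize_form:
  fixes Q :: "real^'n^'n"
  assumes sym: "transpose Q = Q" and pd: "\<And>x. x \<noteq> 0 \<Longrightarrow> 0 < x \<bullet> (Q *v x)"
  obtains R :: "real^'n^'n" where "transpose R ** Q ** R = mat 1"
proof -
  have ex: "\<exists>r :: 'n \<Rightarrow> real^'n. \<forall>i\<in>S. \<forall>j\<in>S. r i \<bullet> (Q *v r j) = (if i = j then 1 else 0)" for S :: "'n set"
  proof (induction S rule: finite_induct[OF finite])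
    case 1
    then show ?case by simp
  next
    case (2 k S)
    then obtain r where r: "\<And>i j. i \<in> S \<Longrightarrow> j \<in> S \<Longrightarrow> r i \<bullet> (Q *v r j) = (if i = j then 1 else 0)" by blast
    have "dim ((\<lambda>i. Q *v r i) ` S) \<le> card ((\<lambda>i. Q *v r i) ` S)" using 2(1) by (intro dim_le_card') auto
    also have "\<dots> \<le> card S" by (rule card_image_le[OF 2(1)])
    also have "\<dots> < CARD('n)" using 2(2) by (intro psubset_card_mono) auto
    finally obtain x where x: "x \<noteq> 0" "\<And>y. y \<in> span ((\<lambda>i. Q *v r i) ` S) \<Longrightarrow> orthogonal x y"
      using orthogonal_to_subspace_exists[of "(\<lambda>i. Q *v r i) ` S"] by auto
    define c where "c = x \<bullet> (Q *v x)"
    have c: "c > 0" unfolding c_def by (rule pd[OF x(1)])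
    have xr: "x \<bullet> (Q *v r i) = 0" "r i \<bullet> (Q *v x) = 0" if "i \<in> S" for i
    proof -
      show "x \<bullet> (Q *v r i) = 0" using x(2)[of "Q *v r i"] that by (auto simp: orthogonal_def span_base)
      then show "r i \<bullet> (Q *v x) = 0" using symmetric_inner[OF sym, of "r i" x] by (simp add: inner_commute)
    qed
    define r' where "r' = r(k := (1 / sqrt c) *\<^sub>R x)"
    have "r' i \<bullet> (Q *v r' j) = (if i = j then 1 else 0)" if "i \<in> insert k S" "j \<in> insert k S" for i j
    proof (cases "i = k"; cases "j = k")
      assume "i = k" "j = k"
      then show ?thesis using c by (simp add: r'_def matrix_vector_mult_scaleR c_def[symmetric])
    qed (use that 2(2) xr r in \<open>auto simp: r'_def matrix_vector_mult_scaleR\<close>)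
    then show ?case by blast
  qed
  obtain r :: "'n \<Rightarrow> real^'n" where r: "\<And>i j. r i \<bullet> (Q *v r j) = (if i = j then 1 else 0)"
    using ex[of UNIV] by auto
  define R where "R = (\<chi> i j. r j $ i)"
  have "(transpose R ** Q ** R) $ i $ j = r i \<bullet> (Q *v r j)" for i j
  proof -
    have "(Q ** R) $ k $ j = (Q *v r j) $ k" for k
      by (simp add: R_def matrix_matrix_mult_def matrix_vector_mult_def)
    then have "(transpose R ** (Q ** R)) $ i $ j = r i \<bullet> (Q *v r j)"
      by (subst matrix_matrix_mult_def) (simp add: R_def transpose_def inner_vec_def)
    then show ?thesis by (simp add: matrix_mul_assoc)
  qed
  then show thesis using r by (intro that[of R]) (simp add: vec_eq_iff mat_def)
qed

lemma standard_gaussian_integral: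
  "integrable lborel (\<lambda>w::real^'n. exp (- (1/2) * (w \<bullet> w)))"
  "(\<integral>w. exp (- (1/2) * (w \<bullet> w)) \<partial>(lborel :: (real^'n) measure)) = (2 * pi) powr (real CARD('n) / 2)"
proof -
  have 1: "(\<integral>\<^sup>+x. ennreal (exp (- (x\<^sup>2 / 2))) \<partial>lborel) = ennreal (sqrt (2 * pi))"
  proof -
    have "has_bochner_integral lborel (\<lambda>x. sqrt (2 * pi) * std_normal_density x) (sqrt (2 * pi) * 1)"
      using std_normal_moment_even[of 0] by (intro has_bochner_integral_mult_right) simp
    then have "has_bochner_integral lborel (\<lambda>x::real. exp (- x\<^sup>2 / 2)) (sqrt (2 * pi))"
      by (simp add: std_normal_density_def)
    then show ?thesis by (subst nn_integral_eq_integral) (auto simp: has_bochner_integral_iff)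
  qed
  have "ennreal (exp (- (1/2) * (w \<bullet> w))) = (\<Prod>b\<in>Basis. ennreal (exp (- (w \<bullet> b)\<^sup>2 / 2)))" for w :: "real^'n"
    by (subst euclidean_inner)
      (simp add: prod_ennreal exp_sum[symmetric] sum_negf sum_divide_distrib power2_eq_square)
  then have "(\<integral>\<^sup>+w. ennreal (exp (- (1/2) * (w \<bullet> w))) \<partial>(lborel :: (real^'n) measure)) = (\<Prod>b\<in>(Basis :: (real^'n) set). ennreal (sqrt (2 * pi)))"
    using nn_integral_lborel_prod[of "\<lambda>b::real^'n. \<lambda>x. ennreal (exp (- x\<^sup>2 / 2))"] by (simp add: 1)
  also have "\<dots> = ennreal ((2 * pi) powr (real CARD('n) / 2))"
    by (simp add: ennreal_power powr_half_sqrt[symmetric] powr_realpow[symmetric] powr_powr)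
  finally have *: "(\<integral>\<^sup>+w. ennreal (exp (- (1/2) * (w \<bullet> w))) \<partial>(lborel :: (real^'n) measure)) = ennreal ((2 * pi) powr (real CARD('n) / 2))" .
  have "has_bochner_integral lborel (\<lambda>w::real^'n. exp (- (1/2) * (w \<bullet> w))) ((2 * pi) powr (real CARD('n) / 2))"
    by (rule has_bochner_integral_nn_integral[OF _ _ _ *]) auto
  then show "integrable lborel (\<lambda>w::real^'n. exp (- (1/2) * (w \<bullet> w)))"
    "(\<integral>w. exp (- (1/2) * (w \<bullet> w)) \<partial>(lborel :: (real^'n) measure)) = (2 * pi) powr (real CARD('n) / 2)"
    by (auto simp: has_bochner_integral_iff)
qed

text \<open>The substitution \<open>transpose R *v (y - m)\<close> turns the quadratic form into the
  standard one. Taking determinants in \<open>transpose R ** Q ** R = mat 1\<close> gives positivity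
  of \<open>det Q\<close> and the Jacobian \<open>det Q powr (-1/2)\<close>.\<close>

lemma gaussian_integral:
  fixes Q :: "real^'n^'n"
  assumes sym: "transpose Q = Q" and psd: "\<And>x. 0 \<le> x \<bullet> (Q *v x)" and inv: "invertible Q"
  shows "0 < det Q"
    and "integrable lborel (\<lambda>y. exp (- (1/2) * ((y - m) \<bullet> (matrix_inv Q *v (y - m)))))"
    and "(\<integral>y. exp (- (1/2) * ((y - m) \<bullet> (matrix_inv Q *v (y - m)))) \<partial>lborel)
      = (2 * pi) powr (real CARD('n) / 2) * det Q powr (1/2)"
proof -
  obtain R :: "real^'n^'n" where R: "transpose R ** Q ** R = mat 1"
    by (rule orthonormalize_form[OF sym pos_def_of_invertible[OF sym psd inv]])
  have "R ** (transpose R ** Q) = mat 1"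
    using R matrix_left_right_inverse by blast
  then have "(R ** transpose R) ** Q ** matrix_inv Q = matrix_inv Q"
    by (simp add: matrix_mul_assoc)
  then have P: "matrix_inv Q = R ** transpose R"
    by (simp add: matrix_mul_assoc[symmetric] matrix_inv_mult[OF inv])
  have d: "(det R)\<^sup>2 * det Q = 1"
    using arg_cong[OF R, of det] by (simp add: det_mul det_transpose power2_eq_square algebra_simps)
  show dQ: "0 < det Q"
    using d zero_less_mult_iff[of "(det R)\<^sup>2" "det Q"] by (auto simp: not_less[symmetric])
  have R0: "det R \<noteq> 0" using d by auto
  have dR: "1 / \<bar>det R\<bar> = det Q powr (1/2)"
  proof -
    have "det Q = (1 / \<bar>det R\<bar>)\<^sup>2" using d R0 by (simp add: field_simps)
    then have "sqrt (det Q) = 1 / \<bar>det R\<bar>" by (simp add: real_sqrt_unique)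
    then show ?thesis using dQ by (simp add: powr_half_sqrt)
  qed
  let ?f = "\<lambda>w::real^'n. exp (- (1/2) * (w \<bullet> w))"
  let ?g = "\<lambda>y. transpose R *v (y - m)"
  have inv': "invertible (transpose R)" using R0 by (simp add: invertible_det_nz det_transpose)
  have "bij ?g"
  proof (rule o_bij[of "\<lambda>w. matrix_inv (transpose R) *v w + m"])
    show "(\<lambda>w. matrix_inv (transpose R) *v w + m) \<circ> ?g = id"
      "?g \<circ> (\<lambda>w. matrix_inv (transpose R) *v w + m) = id"
      by (auto simp: matrix_vector_mul_assoc matrix_inv_mult[OF inv'] simp del: transpose_matrix_vector)
  qed
  moreover have "(?g has_derivative (\<lambda>h. transpose R *v h)) (at y)" for y
    by (rule bounded_linear.has_derivative[OF matrix_vector_mul_bounded_linear])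
      (auto intro!: derivative_eq_intros)
  ultimately have *: "integrable lborel (\<lambda>y. \<bar>det R\<bar> * ?f (?g y))" "(\<integral>y. \<bar>det R\<bar> * ?f (?g y) \<partial>lborel) = (2 * pi) powr (real CARD('n) / 2)"
    using change_of_variables[of ?g "\<lambda>_ h. transpose R *v h" ?f] standard_gaussian_integral[where 'n='n]
    by (simp_all only: matrix_of_matrix_vector_mul det_transpose) simp_all
  have f: "?f (?g y) = exp (- (1/2) * ((y - m) \<bullet> (matrix_inv Q *v (y - m))))" for y
    unfolding P matrix_vector_mul_assoc[symmetric]
    by (metis dot_lmul_matrix transpose_matrix_vector)
  show "integrable lborel (\<lambda>y. exp (- (1/2) * ((y - m) \<bullet> (matrix_inv Q *v (y - m)))))"
    using *(1) R0 unfolding f by simp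
  show "(\<integral>y. exp (- (1/2) * ((y - m) \<bullet> (matrix_inv Q *v (y - m)))) \<partial>lborel)
      = (2 * pi) powr (real CARD('n) / 2) * det Q powr (1/2)"
    using *(2) R0 unfolding f dR[symmetric] by (simp add: field_simps)
qed

section \<open>Differentiation under a compactly supported weight\<close>

text \<open>Where the weight is nonzero a continuous factor is bounded, so a multiple of
  \<open>w\<close> dominates. This lets continuity alone justify all integrals against
  \<open>p0\<close> below.\<close>

lemma integrable_weighted:
  fixes h :: "'a::euclidean_space \<Rightarrow> 'b::euclidean_space" and w :: "'a \<Rightarrow> real"
  assumes w: "integrable lborel w" "\<And>x. norm x > R \<Longrightarrow> w x = 0" and h: "continuous_on UNIV h"
  shows "integrable lborel (\<lambda>x. w x *\<^sub>R h x)"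
proof -
  have "bounded (h ` cball 0 R)"
    by (intro compact_imp_bounded compact_continuous_image continuous_on_subset[OF h]) auto
  then obtain C where C: "\<And>x. norm x \<le> R \<Longrightarrow> norm (h x) \<le> C" by (fastforce simp: bounded_iff)
  have [measurable]: "h \<in> borel_measurable borel" by (rule borel_measurable_continuous_onI[OF h])
  have [measurable]: "w \<in> borel_measurable borel" using w(1) by auto
  show ?thesis
  proof (rule Bochner_Integration.integrable_bound[of _ "\<lambda>x. C * w x"])
    show "AE x in lborel. norm (w x *\<^sub>R h x) \<le> norm (C * w x)"
    proof (intro AE_I2)
      fix x
      show "norm (w x *\<^sub>R h x) \<le> norm (C * w x)"
      proof (cases "norm x \<le> R")
        case True
        then have "norm (h x) \<le> \<bar>C\<bar>" using C[of x] by linarith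
        then show ?thesis by (simp add: abs_mult mult.commute[of "\<bar>C\<bar>"] mult_left_mono)
      qed (use w(2) in simp)
    qed
  qed (use w in auto)
qed

lemma norm_integral_weighted_le:
  fixes h :: "'a::euclidean_space \<Rightarrow> 'b::euclidean_space" and w :: "'a \<Rightarrow> real"
  assumes w: "integrable lborel w" "\<And>x. norm x > R \<Longrightarrow> w x = 0" "\<And>x. w x \<ge> 0"
    and h: "continuous_on UNIV h" and e: "\<And>x. norm x \<le> R \<Longrightarrow> norm (h x) \<le> e"
  shows "norm (\<integral>x. w x *\<^sub>R h x \<partial>lborel) \<le> e * (\<integral>x. w x \<partial>lborel)"
proof -
  have "norm (\<integral>x. w x *\<^sub>R h x \<partial>lborel) \<le> (\<integral>x. e * w x \<partial>lborel)"
  proof (rule Bochner_Integration.integral_norm_bound_integral)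
    show "integrable lborel (\<lambda>x. w x *\<^sub>R h x)" by (rule integrable_weighted[OF w(1,2) h])
    fix x
    show "norm (w x *\<^sub>R h x) \<le> e * w x"
    proof (cases "norm x \<le> R")
      case True
      show ?thesis using mult_left_mono[OF e[OF True] w(3)[of x]] w(3)[of x] by (simp add: mult.commute)
    qed (use w(2) in simp)
  qed (use w in auto)
  then show ?thesis by simp
qed

lemma uniform_parameter:
  fixes g :: "'p::euclidean_space \<Rightarrow> 'a::euclidean_space \<Rightarrow> 'b::real_normed_vector"
  assumes U: "open U" "\<theta> \<in> U" and g: "continuous_on (U \<times> UNIV) (\<lambda>(\<theta>, x). g \<theta> x)" and e: "e > 0"
  obtains d where "d > 0" "ball \<theta> d \<subseteq> U" "\<And>\<eta> x. \<eta> \<in> ball \<theta> d \<Longrightarrow> norm x \<le> R \<Longrightarrow> norm (g \<eta> x - g \<theta> x) \<le> e"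
proof -
  obtain r where r: "r > 0" "cball \<theta> r \<subseteq> U" using U open_contains_cball by blast
  have "uniformly_continuous_on (cball \<theta> r \<times> cball 0 R) (\<lambda>(\<theta>, x). g \<theta> x)"
    using r by (intro compact_uniformly_continuous compact_Times continuous_on_subset[OF g]) auto
  then obtain d where d: "d > 0" "\<And>z w. z \<in> cball \<theta> r \<times> cball 0 R \<Longrightarrow> w \<in> cball \<theta> r \<times> cball 0 R \<Longrightarrow>
      dist w z < d \<Longrightarrow> dist ((\<lambda>(\<theta>, x). g \<theta> x) w) ((\<lambda>(\<theta>, x). g \<theta> x) z) < e"
    using e unfolding uniformly_continuous_on_def by meson
  show thesis
  proof (rule that[of "min d r"])
    show "ball \<theta> (min d r) \<subseteq> U" using r(2) by force
    fix \<eta> and x :: 'a assume "\<eta> \<in> ball \<theta> (min d r)" "norm x \<le> R"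
    then show "norm (g \<eta> x - g \<theta> x) \<le> e"
      using d(2)[of "(\<theta>, x)" "(\<eta>, x)"] r(1) by (auto simp: dist_norm norm_minus_commute dist_Pair_Pair)
  qed (use d r in simp)
qed

lemma continuous_on_integral_weighted:
  fixes g :: "'p::euclidean_space \<Rightarrow> 'a::euclidean_space \<Rightarrow> 'b::euclidean_space" and w :: "'a \<Rightarrow> real"
  assumes w: "integrable lborel w" "\<And>x. norm x > R \<Longrightarrow> w x = 0" "\<And>x. w x \<ge> 0" "(\<integral>x. w x \<partial>lborel) = 1"
    and U: "open U" and g: "continuous_on (U \<times> UNIV) (\<lambda>(\<theta>, x). g \<theta> x)"
  shows "continuous_on U (\<lambda>\<theta>. \<integral>x. w x *\<^sub>R g \<theta> x \<partial>lborel)"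
  unfolding continuous_on_iff
proof (intro ballI allI impI)
  fix \<theta> and e :: real assume \<theta>: "\<theta> \<in> U" and e: "e > 0"
  then have "e / 2 > 0" by simp
  then obtain d where d: "d > 0" "ball \<theta> d \<subseteq> U" "\<And>\<eta> x. \<eta> \<in> ball \<theta> d \<Longrightarrow> norm x \<le> R \<Longrightarrow> norm (g \<eta> x - g \<theta> x) \<le> e / 2"
    using uniform_parameter[OF U \<theta> g, of "e / 2" R] by blast
  have "dist (\<integral>x. w x *\<^sub>R g \<eta> x \<partial>lborel) (\<integral>x. w x *\<^sub>R g \<theta> x \<partial>lborel) < e" if \<eta>: "\<eta> \<in> U" "dist \<eta> \<theta> < d" for \<eta>
  proof -
    note c = continuous_slice[OF g \<theta>] continuous_slice[OF g \<eta>(1)]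
    have "(\<integral>x. w x *\<^sub>R g \<eta> x \<partial>lborel) - (\<integral>x. w x *\<^sub>R g \<theta> x \<partial>lborel) = (\<integral>x. w x *\<^sub>R (g \<eta> x - g \<theta> x) \<partial>lborel)"
      using integrable_weighted[OF w(1,2) c(1)] integrable_weighted[OF w(1,2) c(2)]
      by (simp add: scaleR_diff_right)
    moreover have "norm (\<integral>x. w x *\<^sub>R (g \<eta> x - g \<theta> x) \<partial>lborel) \<le> e / 2 * (\<integral>x. w x \<partial>lborel)"
      using d(3)[of \<eta>] \<eta>(2) c
      by (intro norm_integral_weighted_le[OF w(1,2,3)] continuous_intros) (auto simp: dist_commute)
    ultimately show ?thesis using w(4) e by (simp add: dist_norm)
  qed
  then show "\<exists>d>0. \<forall>\<eta>\<in>U. dist \<eta> \<theta> < d \<longrightarrow> dist (\<integral>x. w x *\<^sub>R g \<eta> x \<partial>lborel) (\<integral>x. w x *\<^sub>R g \<theta> x \<partial>lborel) < e"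
    using d(1) by blast
qed

text \<open>The derivative is represented through a bilinear \<open>prod\<close> by an element
  \<open>g\<close> of a Euclidean space, which can itself be integrated. The inner product yields
  gradients, the matrix-vector product Jacobians.\<close>

lemma has_derivative_integral_weighted:
  fixes f :: "'p::euclidean_space \<Rightarrow> 'a::euclidean_space \<Rightarrow> 'b::euclidean_space" and w :: "'a \<Rightarrow> real"
    and g :: "'p \<Rightarrow> 'a \<Rightarrow> 'c::euclidean_space" and prod :: "'c \<Rightarrow> 'p \<Rightarrow> 'b"
  assumes w: "integrable lborel w" "\<And>x. norm x > R \<Longrightarrow> w x = 0" "\<And>x. w x \<ge> 0" "(\<integral>x. w x \<partial>lborel) = 1"
    and prod: "bounded_bilinear prod"
    and U: "open U" and \<theta>: "\<theta> \<in> U"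
    and f: "\<And>\<theta>. \<theta> \<in> U \<Longrightarrow> continuous_on UNIV (f \<theta>)"
    and g: "continuous_on (U \<times> UNIV) (\<lambda>(\<theta>, x). g \<theta> x)"
    and der: "\<And>\<theta> x. \<theta> \<in> U \<Longrightarrow> ((\<lambda>\<theta>. f \<theta> x) has_derivative prod (g \<theta> x)) (at \<theta>)"
  shows "((\<lambda>\<theta>. \<integral>x. w x *\<^sub>R f \<theta> x \<partial>lborel) has_derivative prod (\<integral>x. w x *\<^sub>R g \<theta> x \<partial>lborel)) (at \<theta>)"
  unfolding has_derivative_at_alt
proof (intro conjI allI impI)
  interpret prod: bounded_bilinear prod by fact
  show "bounded_linear (prod (\<integral>x. w x *\<^sub>R g \<theta> x \<partial>lborel))" by (rule prod.bounded_linear_right)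
  fix e :: real assume e: "e > 0"
  obtain K where K: "K > 0" "\<And>a b. norm (prod a b) \<le> norm a * norm b * K" using prod.pos_bounded by blast
  have "e / K > 0" using e K by simp
  then obtain d where d: "d > 0" "ball \<theta> d \<subseteq> U" "\<And>\<eta> x. \<eta> \<in> ball \<theta> d \<Longrightarrow> norm x \<le> R \<Longrightarrow> norm (g \<eta> x - g \<theta> x) \<le> e / K"
    using uniform_parameter[OF U \<theta> g, of "e / K" R] by blast
  let ?F = "\<lambda>\<theta>. \<integral>x. w x *\<^sub>R f \<theta> x \<partial>lborel" and ?G = "\<integral>x. w x *\<^sub>R g \<theta> x \<partial>lborel"
  have "norm (?F \<eta> - ?F \<theta> - prod ?G (\<eta> - \<theta>)) \<le> e * norm (\<eta> - \<theta>)" if \<eta>: "norm (\<eta> - \<theta>) < d" for \<eta>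
  proof -
    have \<eta>': "\<eta> \<in> ball \<theta> d" "\<eta> \<in> U" using \<eta> d(2) by (auto simp: dist_norm norm_minus_commute)
    have gc: "continuous_on UNIV (g \<theta>)" by (rule continuous_slice[OF g \<theta>])
    have pc: "continuous_on UNIV (\<lambda>x. prod (g \<theta> x) (\<eta> - \<theta>))"
      by (intro prod.continuous_on gc continuous_intros)
    have "prod ?G (\<eta> - \<theta>) = (\<integral>x. prod (w x *\<^sub>R g \<theta> x) (\<eta> - \<theta>) \<partial>lborel)"
      by (rule integral_bounded_linear[OF prod.bounded_linear_left integrable_weighted[OF w(1,2) gc], symmetric])
    then have "?F \<eta> - ?F \<theta> - prod ?G (\<eta> - \<theta>) = (\<integral>x. w x *\<^sub>R (f \<eta> x - f \<theta> x - prod (g \<theta> x) (\<eta> - \<theta>)) \<partial>lborel)"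
      using integrable_weighted[OF w(1,2) f[OF \<eta>'(2)]] integrable_weighted[OF w(1,2) f[OF \<theta>]]
        integrable_weighted[OF w(1,2) pc]
      by (simp add: scaleR_diff_right prod.scaleR_left)
    also have "norm \<dots> \<le> (e * norm (\<eta> - \<theta>)) * (\<integral>x. w x \<partial>lborel)"
    proof (rule norm_integral_weighted_le[OF w(1,2,3)])
      show "continuous_on UNIV (\<lambda>x. f \<eta> x - f \<theta> x - prod (g \<theta> x) (\<eta> - \<theta>))"
        by (intro continuous_intros f \<theta> \<eta>' pc)
      fix x :: 'a assume x: "norm x \<le> R"
      have "norm (f \<eta> x - f \<theta> x - prod (g \<theta> x) (\<eta> - \<theta>)) \<le> norm (\<eta> - \<theta>) * e"
      proof (rule differentiable_bound_linearization[where S = "ball \<theta> d" and f' = "\<lambda>\<theta>. prod (g \<theta> x)"])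
        fix t :: real assume "t \<in> {0..1}"
        then show "\<theta> + t *\<^sub>R (\<eta> - \<theta>) \<in> ball \<theta> d"
          using \<eta> by (auto simp: dist_norm) (meson le_less_trans mult_left_le_one_le norm_ge_zero)
      next
        fix \<xi> assume \<xi>: "\<xi> \<in> ball \<theta> d"
        show "((\<lambda>\<theta>. f \<theta> x) has_derivative prod (g \<xi> x)) (at \<xi> within ball \<theta> d)"
          using der[of \<xi> x] d(2) \<xi> by (meson has_derivative_at_withinI subsetD)
        show "onorm (prod (g \<xi> x) - prod (g \<theta> x)) \<le> e"
        proof (rule onorm_bound)
          fix h
          have "norm ((prod (g \<xi> x) - prod (g \<theta> x)) h) \<le> norm (g \<xi> x - g \<theta> x) * norm h * K"
            using K(2)[of "g \<xi> x - g \<theta> x" h] by (simp add: prod.diff_left)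
          also have "\<dots> \<le> (e / K) * norm h * K"
            using d(3)[OF \<xi> x] K(1) by (intro mult_right_mono) auto
          finally show "norm ((prod (g \<xi> x) - prod (g \<theta> x)) h) \<le> e * norm h" using K(1) by simp
        qed (use e in simp)
      qed (use d(1) in simp)
      then show "norm (f \<eta> x - f \<theta> x - prod (g \<theta> x) (\<eta> - \<theta>)) \<le> e * norm (\<eta> - \<theta>)" by (simp add: mult.commute)
    qed
    finally show ?thesis using w(4) by simp
  qed
  then show "\<exists>d>0. \<forall>\<eta>. norm (\<eta> - \<theta>) < d \<longrightarrow> norm (?F \<eta> - ?F \<theta> - prod ?G (\<eta> - \<theta>)) \<le> e * norm (\<eta> - \<theta>)"
    using d(1) by blast
qed

section \<open>The forward density\<close>

definition outer :: "real^'n \<Rightarrow> real^'m \<Rightarrow> real^'m^'n" where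
  "outer a b = (\<chi> i j. a $ i * b $ j)"

lemma bounded_bilinear_outer: "bounded_bilinear (outer :: real^'n \<Rightarrow> real^'m \<Rightarrow> real^'m^'n)"
  unfolding bilinear_conv_bounded_bilinear[symmetric] bilinear_def
  by (auto intro!: linearI simp: outer_def vec_eq_iff algebra_simps)

lemma outer_mult_vec: "outer a b *v h = (b \<bullet> h) *\<^sub>R a"
  by (simp add: outer_def matrix_vector_mult_def vec_eq_iff inner_vec_def sum_distrib_left sum_distrib_right mult_ac)

lemma trace_matrix_mult_outer: "trace (X ** outer a b) = b \<bullet> (X *v a)" for X :: "real^'n^'n"
  by (simp add: trace_def matrix_matrix_mult_def outer_def inner_vec_def matrix_vector_mult_def
      sum_distrib_left mult_ac)

lemma bounded_linear_trace: "bounded_linear (trace :: real^'n^'n \<Rightarrow> real)"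
  by (rule linear_conv_bounded_linear[THEN iffD1])
    (auto intro!: linearI simp: trace_def sum.distrib sum_distrib_left)

lemma trace_transpose: "trace (transpose X) = trace (X :: real^'n^'n)"
  by (simp add: trace_def transpose_def)

lemma inner_transpose: "(x::real^'n) \<bullet> (X *v y) = (transpose X *v x) \<bullet> y"
  by (metis dot_lmul_matrix transpose_matrix_vector)

lemma has_derivative_fst_vector:
  assumes "(F has_vector_derivative D) (at s)"
  shows "((\<lambda>z. F (fst z)) has_derivative (\<lambda>h. fst h *\<^sub>R D)) (at (s, y))"
  using has_derivative_compose[OF has_derivative_fst[OF has_derivative_ident], of F "\<lambda>h. h *\<^sub>R D" "(s, y)" UNIV] assms
  by (simp add: has_vector_derivative_def)

locale lti_density =
  fixes A :: "real^'n^'n" and B :: "real^'m^'n" and p0 :: "real^'n \<Rightarrow> real" and R :: real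
  assumes gram_inv: "\<And>t. t > 0 \<Longrightarrow> invertible (gramian A B t)"
    and p0_int: "integrable lborel p0"
    and p0_supp: "\<And>x. norm x > R \<Longrightarrow> p0 x = 0"
    and p0_nonneg: "\<And>x. p0 x \<ge> 0"
    and p0_mass: "(\<integral>x. p0 x \<partial>lborel) = 1"
begin

text \<open>With \<open>Q\<close> the Gramian and \<open>z = y - e\<^bsup>sA\<^esup> x\<close>: \<open>P = Q\<inverse>\<close>, and the logarithmic derivatives of the
  kernel \<open>k\<close> are \<open>\<zeta> = P z = - \<nabla>\<^sub>y log k\<close> and \<open>\<kappa> = \<partial>\<^sub>s log k\<close>.\<close>

definition P where "P s = matrix_inv (gramian A B s)"
definition N where "N = B ** transpose B"
definition c where "c s = (2 * pi) powr (- real CARD('n) / 2) * det (gramian A B s) powr (-1/2)"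
definition \<zeta> where "\<zeta> s x y = P s *v (y - mexp s A *v x)"
definition k where "k s x y = kernel A B s x y"
definition \<kappa> where "\<kappa> s x y = - trace A - trace (N ** P s) / 2 + (norm (transpose B *v \<zeta> s x y))\<^sup>2 / 2 + \<zeta> s x y \<bullet> (A *v y)"

lemma k_eq: "k s x y = c s * exp (- (1/2) * ((y - mexp s A *v x) \<bullet> \<zeta> s x y))"
  by (simp add: k_def kernel_def c_def \<zeta>_def P_def)

section \<open>Positivity and normalisation of the kernel\<close>

lemma P_mult: "s > 0 \<Longrightarrow> gramian A B s ** P s = mat 1" "s > 0 \<Longrightarrow> P s ** gramian A B s = mat 1"
  unfolding P_def by (simp_all add: matrix_inv_mult gram_inv)

lemma P_symmetric: "s > 0 \<Longrightarrow> transpose (P s) = P s"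
proof -
  assume s: "s > 0"
  have "transpose (P s) ** gramian A B s = mat 1"
    using arg_cong[OF P_mult(1)[OF s], of transpose]
    by (simp add: matrix_transpose_mul gramian_symmetric_nonneg(1) transpose_mat)
  then have "transpose (P s) ** gramian A B s ** P s = P s" by simp
  then show ?thesis by (simp add: matrix_mul_assoc[symmetric] P_mult[OF s])
qed

lemma det_gramian_pos: "s > 0 \<Longrightarrow> det (gramian A B s) > 0"
  by (rule gaussian_integral(1)[OF gramian_symmetric_nonneg gram_inv])

lemma c_pos: "s > 0 \<Longrightarrow> c s > 0"
  using det_gramian_pos[of s] by (simp add: c_def)

lemma k_pos: "s > 0 \<Longrightarrow> k s x y > 0"
  using c_pos[of s] by (simp add: k_eq)

lemma k_integral:
  assumes s: "s > 0"
  shows "integrable lborel (k s x)" "(\<integral>y. k s x y \<partial>lborel) = 1"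
proof -
  note G = gaussian_integral(2,3)[OF gramian_symmetric_nonneg gram_inv[OF s], where m = "mexp s A *v x"]
  have k: "k s x = (\<lambda>y. c s * exp (- (1/2) * ((y - mexp s A *v x) \<bullet> (matrix_inv (gramian A B s) *v (y - mexp s A *v x)))))"
    by (simp add: k_eq \<zeta>_def P_def fun_eq_iff)
  show "integrable lborel (k s x)" unfolding k by (intro integrable_mult_right G(1))
  have "c s * ((2 * pi) powr (real CARD('n) / 2) * det (gramian A B s) powr (1/2)) = 1"
    using det_gramian_pos[OF s] by (simp add: c_def powr_minus field_simps)
  then show "(\<integral>y. k s x y \<partial>lborel) = 1" unfolding k using G(2) by simp
qed

section \<open>Derivatives of the kernel\<close>

lemma gramian_der: "s > 0 \<Longrightarrow> (gramian A B has_vector_derivative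
    (A ** gramian A B s + gramian A B s ** transpose A + N)) (at s)"
  unfolding N_def by (rule gramian_has_vector_derivative)

lemma gramian_cont: "continuous_on {0<..} (gramian A B)"
  using gramian_der by (meson continuous_at_imp_continuous_on greaterThan_iff has_vector_derivative_continuous)

lemma P_cont: "continuous_on {0<..} P"
  unfolding P_def[abs_def] by (rule continuous_on_matrix_inv[OF gramian_cont]) (simp add: gram_inv)

text \<open>The Riccati equation, obtained by conjugating the Lyapunov equation with
  \<open>P s\<close>.\<close>

lemma P_der:
  assumes s: "s > 0"
  shows "(P has_vector_derivative - (P s ** A + transpose A ** P s + P s ** N ** P s)) (at s)"
proof -
  let ?Q = "gramian A B s"
  have "(P has_vector_derivative - (P s ** (A ** ?Q + ?Q ** transpose A + N) ** P s)) (at s)"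
    unfolding P_def[abs_def]
    by (rule matrix_inv_has_vector_derivative[of "{0<..}"]) (use s gram_inv gramian_cont gramian_der in auto)
  also have "P s ** (A ** ?Q + ?Q ** transpose A + N) ** P s
      = P s ** A ** (?Q ** P s) + (P s ** ?Q) ** transpose A ** P s + P s ** N ** P s"
    by (simp add: bounded_bilinear.add_right[OF bounded_bilinear_matrix_mult]
        bounded_bilinear.add_left[OF bounded_bilinear_matrix_mult] matrix_mul_assoc)
  finally show ?thesis by (simp add: P_mult[OF s])
qed

text \<open>Jacobi's formula with the Lyapunov equation: under the trace \<open>P s\<close> cancels
  the Gramian and leaves \<open>2 * trace A + trace (N ** P s)\<close>; the power -1/2 halves and
  negates it.\<close>

lemma c_der:
  assumes s: "s > 0"
  shows "(c has_vector_derivative c s * (- trace A - trace (N ** P s) / 2)) (at s)"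
proof -
  let ?Q = "gramian A B s"
  let ?D = "A ** ?Q + ?Q ** transpose A + N"
  have "trace (P s ** ?D) = trace (P s ** (A ** ?Q)) + trace (P s ** (?Q ** transpose A)) + trace (P s ** N)"
    by (simp add: bounded_bilinear.add_right[OF bounded_bilinear_matrix_mult] trace_add)
  also have "trace (P s ** (A ** ?Q)) = trace ((?Q ** P s) ** A)"
    by (metis matrix_mul_assoc trace_mul_sym)
  also have "P s ** (?Q ** transpose A) = (P s ** ?Q) ** transpose A" by (simp add: matrix_mul_assoc)
  finally have tr: "trace (P s ** ?D) = 2 * trace A + trace (N ** P s)"
    by (simp add: P_mult[OF s] trace_transpose trace_mul_sym[of "P s" N])
  have "((\<lambda>s. det (gramian A B s)) has_derivative (\<lambda>h. det ?Q * trace (P s ** (h *\<^sub>R ?D)))) (at s)"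
    using has_derivative_compose[OF gramian_der[OF s, unfolded has_vector_derivative_def] has_derivative_det[OF gram_inv[OF s]]]
    by (simp add: P_def)
  moreover have "trace (P s ** (h *\<^sub>R ?D)) = h * trace (P s ** ?D)" for h
    by (simp only: bounded_bilinear.scaleR_right[OF bounded_bilinear_matrix_mult]
        linear_cmul[OF bounded_linear.linear[OF bounded_linear_trace]]) simp
  ultimately have d: "((\<lambda>s. det (gramian A B s)) has_real_derivative det ?Q * (2 * trace A + trace (N ** P s))) (at s)"
    unfolding has_field_derivative_def tr
    by (elim has_derivative_eq_rhs) (simp add: mult_ac fun_eq_iff)
  have "((\<lambda>s. det (gramian A B s) powr (-1/2)) has_real_derivative
      (-1/2) * det ?Q powr (-1/2 - 1) * (det ?Q * (2 * trace A + trace (N ** P s)))) (at s)"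
    by (rule DERIV_chain2[where f = "\<lambda>x. x powr (-1/2)", OF has_real_derivative_powr[OF det_gramian_pos[OF s]] d])
  also have "(-1/2) * det ?Q powr (-1/2 - 1) * (det ?Q * (2 * trace A + trace (N ** P s)))
      = det ?Q powr (-1/2) * (- trace A - trace (N ** P s) / 2)"
  proof -
    have "det ?Q * det ?Q powr (-1/2 - 1) = det ?Q powr (-1/2)"
      using det_gramian_pos[OF s] by (subst powr_mult_base) simp_all
    then have "det ?Q powr (-1/2) * (- trace A - trace (N ** P s) / 2)
      = (det ?Q * det ?Q powr (-1/2 - 1)) * (- trace A - trace (N ** P s) / 2)" by simp
    then show ?thesis by (simp add: field_simps)
  qed
  finally show ?thesis
    unfolding c_def has_real_derivative_iff_has_vector_derivative[symmetric] mult.assoc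
    by (rule DERIV_cmult)
qed

lemma c_cont: "continuous_on {0<..} c"
  using c_der by (meson continuous_at_imp_continuous_on greaterThan_iff has_vector_derivative_continuous)

lemma mexp_cont: "continuous_on S (\<lambda>s. mexp s A)"
  using mexp_has_vector_derivative[of A] by (meson continuous_on_eq_continuous_within has_vector_derivative_continuous)

text \<open>Three sources meet in \<open>\<kappa>\<close>: the prefactor gives the traces, the
  Riccati equation gives the squared norm and \<open>\<xi> \<bullet> (A *v z)\<close>, and the
  moving mean gives \<open>\<xi> \<bullet> (A *v (mexp s A *v x))\<close>. The last two add up to
  \<open>\<xi> \<bullet> (A *v y)\<close>, so \<open>x\<close> enters \<open>\<kappa>\<close> only
  through \<open>\<zeta>\<close>.\<close>

lemma k_der:
  assumes s: "s > 0"
  shows "((\<lambda>\<theta>. k (fst \<theta>) x (snd \<theta>)) has_derivative (\<lambda>h. (k s x y * \<kappa> s x y, - k s x y *\<^sub>R \<zeta> s x y) \<bullet> h)) (at (s, y))"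
proof -
  define z where "z = y - mexp s A *v x"
  define \<xi> where "\<xi> = \<zeta> s x y"
  have \<xi>: "\<xi> = P s *v z" by (simp add: \<xi>_def \<zeta>_def z_def)
  define P' where "P' = - (P s ** A + transpose A ** P s + P s ** N ** P s)"
  let ?Mx = "A *v (mexp s A *v x)"
  let ?z = "\<lambda>\<theta>. snd \<theta> - mexp (fst \<theta>) A *v x"
  let ?dz = "\<lambda>h. snd h - fst h *\<^sub>R ?Mx"
  have "((\<lambda>s. mexp s A *v x) has_vector_derivative ?Mx) (at s)"
    using bounded_linear.has_vector_derivative[OF bounded_bilinear.bounded_linear_left[OF bounded_bilinear_matrix_vector_mult, of x] mexp_has_vector_derivative[of A s UNIV]]
    by (simp add: matrix_vector_mul_assoc)
  from has_derivative_fst_vector[OF this, of y]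
  have hz: "(?z has_derivative ?dz) (at (s, y))"
    by (intro has_derivative_diff has_derivative_snd has_derivative_ident)
  have hP: "((\<lambda>\<theta>. P (fst \<theta>)) has_derivative (\<lambda>h. fst h *\<^sub>R P')) (at (s, y))"
    unfolding P'_def by (rule has_derivative_fst_vector[OF P_der[OF s]])
  have hPz: "((\<lambda>\<theta>. P (fst \<theta>) *v ?z \<theta>) has_derivative (\<lambda>h. P s *v ?dz h + (fst h *\<^sub>R P') *v z)) (at (s, y))"
    using bounded_bilinear.FDERIV[OF bounded_bilinear_matrix_vector_mult hP hz] by (simp add: z_def)
  have hq: "((\<lambda>\<theta>. ?z \<theta> \<bullet> (P (fst \<theta>) *v ?z \<theta>)) has_derivative
      (\<lambda>h. z \<bullet> (P s *v ?dz h + (fst h *\<^sub>R P') *v z) + ?dz h \<bullet> \<xi>)) (at (s, y))"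
    using has_derivative_inner[OF hz hPz] by (simp add: z_def \<xi>)
  have symP: "a \<bullet> (P s *v b) = (P s *v a) \<bullet> b" for a b
    by (rule symmetric_inner[OF P_symmetric[OF s]])
  have zP': "z \<bullet> (P' *v z) = - (2 * (\<xi> \<bullet> (A *v z)) + (norm (transpose B *v \<xi>))\<^sup>2)"
  proof -
    have "z \<bullet> (P' *v z) = - (z \<bullet> (P s *v (A *v z)) + z \<bullet> (transpose A *v \<xi>) + z \<bullet> (P s *v (N *v \<xi>)))"
      unfolding P'_def \<xi>
      by (simp add: bounded_bilinear.add_left[OF bounded_bilinear_matrix_vector_mult]
          bounded_bilinear.minus_left[OF bounded_bilinear_matrix_vector_mult]
          bounded_bilinear.diff_left[OF bounded_bilinear_matrix_vector_mult]
          matrix_vector_mul_assoc matrix_mul_assoc inner_add_right inner_diff_right del: transpose_matrix_vector)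
    also have "z \<bullet> (P s *v (A *v z)) = \<xi> \<bullet> (A *v z)" by (simp add: symP \<xi>)
    also have "z \<bullet> (transpose A *v \<xi>) = \<xi> \<bullet> (A *v z)"
      using inner_transpose[of z "transpose A" \<xi>] by (simp add: inner_commute transpose_transpose del: transpose_matrix_vector)
    also have "z \<bullet> (P s *v (N *v \<xi>)) = \<xi> \<bullet> (B *v (transpose B *v \<xi>))"
      unfolding symP \<xi>[symmetric] N_def by (simp only: matrix_vector_mul_assoc)
    also have "\<dots> = (norm (transpose B *v \<xi>))\<^sup>2"
      unfolding inner_transpose power2_norm_eq_inner ..
    finally show ?thesis by simp
  qed
  have E: "- (1/2) * (z \<bullet> (P s *v ?dz h + (fst h *\<^sub>R P') *v z) + ?dz h \<bullet> \<xi>)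
      = fst h * ((norm (transpose B *v \<xi>))\<^sup>2 / 2 + \<xi> \<bullet> (A *v y)) - \<xi> \<bullet> snd h" for h
  proof -
    have "z \<bullet> (P s *v ?dz h + (fst h *\<^sub>R P') *v z) + ?dz h \<bullet> \<xi> = 2 * (\<xi> \<bullet> ?dz h) + fst h * (z \<bullet> (P' *v z))"
      by (simp only: inner_add_right symP \<xi>[symmetric] inner_commute[of "?dz h" \<xi>]
          bounded_bilinear.scaleR_left[OF bounded_bilinear_matrix_vector_mult] inner_scaleR_right)
    also have "\<xi> \<bullet> ?dz h = \<xi> \<bullet> snd h - fst h * (\<xi> \<bullet> ?Mx)"
      by (simp add: inner_diff_right)
    also have "\<xi> \<bullet> ?Mx = \<xi> \<bullet> (A *v y) - \<xi> \<bullet> (A *v z)"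
      by (simp add: z_def matrix_vector_mult_diff_distrib inner_diff_right)
    finally show ?thesis unfolding zP' by (simp add: algebra_simps)
  qed
  let ?e = "\<lambda>\<theta>. - (1/2) * (?z \<theta> \<bullet> (P (fst \<theta>) *v ?z \<theta>))"
  have he: "(?e has_derivative (\<lambda>h. fst h * ((norm (transpose B *v \<xi>))\<^sup>2 / 2 + \<xi> \<bullet> (A *v y)) - \<xi> \<bullet> snd h)) (at (s, y))"
    using has_derivative_mult_right[OF hq, of "- (1/2)"] unfolding E .
  have hexp: "((\<lambda>\<theta>. exp (?e \<theta>)) has_derivative (\<lambda>h. exp (?e (s, y)) * (fst h * ((norm (transpose B *v \<xi>))\<^sup>2 / 2 + \<xi> \<bullet> (A *v y)) - \<xi> \<bullet> snd h))) (at (s, y))"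
    using has_derivative_exp[OF he] by (simp add: mult_ac)
  have hc: "((\<lambda>\<theta>. c (fst \<theta>)) has_derivative (\<lambda>h. fst h *\<^sub>R (c s * (- trace A - trace (N ** P s) / 2)))) (at (s, y))"
    by (rule has_derivative_fst_vector[OF c_der[OF s]])
  have "((\<lambda>\<theta>. c (fst \<theta>) * exp (?e \<theta>)) has_derivative (\<lambda>h. (k s x y * \<kappa> s x y, - k s x y *\<^sub>R \<zeta> s x y) \<bullet> h)) (at (s, y))"
    using has_derivative_mult[OF hc hexp]
    by (rule has_derivative_eq_rhs) (simp add: fun_eq_iff inner_prod_def k_eq \<kappa>_def \<xi>_def \<zeta>_def algebra_simps)
  then show ?thesis by (simp add: k_eq[abs_def] \<zeta>_def)
qed

lemma k_\<zeta>_der: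
  assumes s: "s > 0"
  shows "((\<lambda>y. k s x y *\<^sub>R \<zeta> s x y) has_derivative
    (*v) (k s x y *\<^sub>R (P s - outer (\<zeta> s x y) (\<zeta> s x y)))) (at y)"
proof -
  have "((\<lambda>y. k (fst (s, y)) x (snd (s, y))) has_derivative (\<lambda>h. (k s x y * \<kappa> s x y, - k s x y *\<^sub>R \<zeta> s x y) \<bullet> (0, h))) (at y)"
    by (rule has_derivative_compose[where f = "\<lambda>y. (s, y)", OF _ k_der[OF s]])
      (auto intro!: derivative_eq_intros)
  then have hk: "((\<lambda>y. k s x y) has_derivative (\<lambda>h. - k s x y * (\<zeta> s x y \<bullet> h))) (at y)"
    by simp
  have h\<zeta>: "((\<lambda>y. \<zeta> s x y) has_derivative (\<lambda>h. P s *v h)) (at y)"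
    unfolding \<zeta>_def by (rule bounded_linear.has_derivative[OF matrix_vector_mul_bounded_linear])
      (auto intro!: derivative_eq_intros)
  show ?thesis
    using has_derivative_scaleR[OF hk h\<zeta>]
    by (rule has_derivative_eq_rhs)
      (simp add: fun_eq_iff bounded_bilinear.scaleR_left[OF bounded_bilinear_matrix_vector_mult]
        bounded_bilinear.diff_left[OF bounded_bilinear_matrix_vector_mult] outer_mult_vec algebra_simps)
qed

text \<open>Stated along arbitrary continuous arguments so that it serves both slices in one
  variable and joint continuity.\<close>

lemma continuous_parts:
  assumes f: "continuous_on S f" "\<And>t. t \<in> S \<Longrightarrow> f t > 0" and g: "continuous_on S g" and h: "continuous_on S h"
  shows "continuous_on S (\<lambda>t. P (f t))" "continuous_on S (\<lambda>t. \<zeta> (f t) (g t) (h t))"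
    "continuous_on S (\<lambda>t. k (f t) (g t) (h t))" "continuous_on S (\<lambda>t. \<kappa> (f t) (g t) (h t))"
proof -
  note mv = bounded_bilinear.continuous_on[OF bounded_bilinear_matrix_vector_mult]
  note mm = bounded_bilinear.continuous_on[OF bounded_bilinear_matrix_mult]
  show P: "continuous_on S (\<lambda>t. P (f t))"
    by (rule continuous_on_compose2[OF P_cont f(1)]) (use f(2) in auto)
  have C: "continuous_on S (\<lambda>t. c (f t))"
    by (rule continuous_on_compose2[OF c_cont f(1)]) (use f(2) in auto)
  have M: "continuous_on S (\<lambda>t. mexp (f t) A)"
    by (rule continuous_on_compose2[OF mexp_cont[of UNIV] f(1)]) auto
  show Z: "continuous_on S (\<lambda>t. \<zeta> (f t) (g t) (h t))"
    unfolding \<zeta>_def by (intro mv P M continuous_intros g h)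
  show "continuous_on S (\<lambda>t. k (f t) (g t) (h t))"
    unfolding k_eq by (intro continuous_intros C Z mv M g h)
  have BZ: "continuous_on S (\<lambda>t. transpose B *v \<zeta> (f t) (g t) (h t))"
    by (intro mv continuous_on_const Z)
  have tr: "continuous_on S (\<lambda>t. trace (N ** P (f t)))"
    by (intro bounded_linear.continuous_on[OF bounded_linear_trace] mm continuous_on_const P)
  show "continuous_on S (\<lambda>t. \<kappa> (f t) (g t) (h t))"
    unfolding \<kappa>_def by (intro continuous_intros tr BZ Z mv h) simp_all
qed

text \<open>Integrals against \<open>p0\<close>: \<open>dens\<close> is the forward density, \<open>dens_t\<close> its time derivative, \<open>- G\<close> its gradient,
  and \<open>H\<close> the derivative of \<open>G\<close>.\<close>

definition dens where "dens s y = (\<integral>x. p0 x *\<^sub>R k s x y \<partial>lborel)"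
definition dens_t where "dens_t s y = (\<integral>x. p0 x *\<^sub>R (k s x y * \<kappa> s x y) \<partial>lborel)"
definition G where "G s y = (\<integral>x. p0 x *\<^sub>R (k s x y *\<^sub>R \<zeta> s x y) \<partial>lborel)"
definition H where "H s y = (\<integral>x. p0 x *\<^sub>R (k s x y *\<^sub>R (P s - outer (\<zeta> s x y) (\<zeta> s x y))) \<partial>lborel)"

lemma fwd_density_eq: "s > 0 \<Longrightarrow> fwd_density A B p0 s y = dens s y"
  by (simp add: fwd_density_def dens_def k_def mult.commute)

lemma integrable_p0: "continuous_on UNIV h \<Longrightarrow> integrable lborel (\<lambda>x. p0 x *\<^sub>R h x)" for h :: "real^'n \<Rightarrow> 'b::euclidean_space"
  by (rule integrable_weighted[OF p0_int p0_supp])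

lemma continuous_x:
  assumes "s > 0"
  shows "continuous_on UNIV (\<lambda>x. k s x y)" "continuous_on UNIV (\<lambda>x. \<zeta> s x y)" "continuous_on UNIV (\<lambda>x. \<kappa> s x y)"
  using assms by (auto intro!: continuous_parts continuous_intros)

text \<open>Since the kernel is strictly positive, a vanishing integral would force
  \<open>p0\<close> to vanish almost everywhere, against its total mass.\<close>

lemma dens_pos:
  assumes s: "s > 0"
  shows "dens s y > 0"
proof -
  have int: "integrable lborel (\<lambda>x. p0 x *\<^sub>R k s x y)" by (rule integrable_p0[OF continuous_x(1)[OF s]])
  have nn: "0 \<le> p0 x *\<^sub>R k s x y" for x using p0_nonneg[of x] k_pos[OF s, of x y] by simp
  have "dens s y \<noteq> 0"
  proof
    assume "dens s y = 0"
    then have "AE x in lborel. p0 x *\<^sub>R k s x y = 0"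
      using integral_nonneg_eq_0_iff_AE[OF int] nn by (simp add: dens_def)
    then have "AE x in lborel. p0 x = 0"
      by eventually_elim (use k_pos[OF s] in \<open>auto simp: less_imp_neq[symmetric]\<close>)
    then have "(\<integral>x. p0 x \<partial>lborel) = (\<integral>x. 0 \<partial>(lborel :: (real^'n) measure))"
      using p0_int by (intro integral_cong_AE) auto
    then show False using p0_mass by simp
  qed
  moreover have "dens s y \<ge> 0" unfolding dens_def using nn by (intro Bochner_Integration.integral_nonneg)
  ultimately show ?thesis by simp
qed

lemma open_time_space: "open ({0::real<..} \<times> (UNIV :: (real^'n) set))"
  by (intro open_Times) auto

lemma dens_der:
  assumes s: "s > 0"
  shows "((\<lambda>\<theta>. dens (fst \<theta>) (snd \<theta>)) has_derivative (\<lambda>h. (dens_t s y, - G s y) \<bullet> h)) (at (s, y))"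
proof -
  let ?g = "\<lambda>\<theta> x. (k (fst \<theta>) x (snd \<theta>) * \<kappa> (fst \<theta>) x (snd \<theta>), - k (fst \<theta>) x (snd \<theta>) *\<^sub>R \<zeta> (fst \<theta>) x (snd \<theta>))"
  have "((\<lambda>\<theta>. \<integral>x. p0 x *\<^sub>R k (fst \<theta>) x (snd \<theta>) \<partial>lborel) has_derivative
      (\<bullet>) (\<integral>x. p0 x *\<^sub>R ?g (s, y) x \<partial>lborel)) (at (s, y))"
  proof (rule has_derivative_integral_weighted[OF p0_int p0_supp p0_nonneg p0_mass bounded_bilinear_inner open_time_space])
    show "(s, y) \<in> {0<..} \<times> UNIV" using s by simp
    show "continuous_on UNIV (\<lambda>x. k (fst \<theta>) x (snd \<theta>))" if "\<theta> \<in> {0<..} \<times> UNIV" for \<theta>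
      using that by (intro continuous_x) auto
    show "continuous_on (({0<..} \<times> UNIV) \<times> UNIV) (\<lambda>(\<theta>, x). ?g \<theta> x)"
      unfolding case_prod_beta by (intro continuous_intros continuous_parts) auto
    show "((\<lambda>\<theta>. k (fst \<theta>) x (snd \<theta>)) has_derivative (\<bullet>) (?g \<theta> x)) (at \<theta>)" if "\<theta> \<in> {0<..} \<times> UNIV" for \<theta> x
      using that k_der[of "fst \<theta>" x "snd \<theta>"] by auto
  qed
  also have "(\<integral>x. p0 x *\<^sub>R ?g (s, y) x \<partial>lborel) = (dens_t s y, - G s y)"
  proof -
    have i: "integrable lborel (\<lambda>x. p0 x *\<^sub>R ?g (s, y) x)"
      using s by (intro integrable_p0 continuous_intros) (auto intro!: continuous_x)
    have "fst (\<integral>x. p0 x *\<^sub>R ?g (s, y) x \<partial>lborel) = dens_t s y"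
      unfolding dens_t_def integral_bounded_linear[OF bounded_linear_fst i, symmetric] by simp
    moreover have "snd (\<integral>x. p0 x *\<^sub>R ?g (s, y) x \<partial>lborel) = - G s y"
      unfolding G_def integral_bounded_linear[OF bounded_linear_snd i, symmetric] by simp
    ultimately show ?thesis by (intro prod_eqI) (simp_all only: fst_conv snd_conv)
  qed
  finally show ?thesis by (simp add: dens_def)
qed

lemma dens_y_der:
  assumes s: "s > 0"
  shows "((\<lambda>y. dens s y) has_derivative (\<lambda>h. - (G s y \<bullet> h))) (at y)"
proof -
  have "((\<lambda>y. dens (fst (s, y)) (snd (s, y))) has_derivative (\<lambda>h. (dens_t s y, - G s y) \<bullet> (0, h))) (at y)"
    by (rule has_derivative_compose[where f = "\<lambda>y. (s, y)", OF _ dens_der[OF s]])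
      (auto intro!: derivative_eq_intros)
  then show ?thesis by simp
qed

lemma G_der:
  assumes s: "s > 0"
  shows "((\<lambda>y. G s y) has_derivative (*v) (H s y)) (at y)"
  unfolding G_def H_def
proof (rule has_derivative_integral_weighted[OF p0_int p0_supp p0_nonneg p0_mass bounded_bilinear_matrix_vector_mult open_UNIV UNIV_I])
  show "continuous_on UNIV (\<lambda>x. k s x y *\<^sub>R \<zeta> s x y)" for y
    using s by (intro continuous_intros continuous_x)
  show "continuous_on (UNIV \<times> UNIV) (\<lambda>(y, x). k s x y *\<^sub>R (P s - outer (\<zeta> s x y) (\<zeta> s x y)))"
    unfolding case_prod_beta using s
    by (intro continuous_intros continuous_parts bounded_bilinear.continuous_on[OF bounded_bilinear_outer]) auto
  show "((\<lambda>y. k s x y *\<^sub>R \<zeta> s x y) has_derivative (*v) (k s x y *\<^sub>R (P s - outer (\<zeta> s x y) (\<zeta> s x y)))) (at y)" for x y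
    by (rule k_\<zeta>_der[OF s])
qed

lemma continuous_on_integral_p0:
  fixes g :: "real \<Rightarrow> real^'n \<Rightarrow> real^'n \<Rightarrow> 'b::euclidean_space"
  assumes "continuous_on (({0<..} \<times> UNIV) \<times> UNIV) (\<lambda>z. g (fst (fst z)) (snd z) (snd (fst z)))"
  shows "continuous_on ({0<..} \<times> UNIV) (\<lambda>(s, y). \<integral>x. p0 x *\<^sub>R g s x y \<partial>lborel)"
  using continuous_on_integral_weighted[OF p0_int p0_supp p0_nonneg p0_mass open_time_space,
      where g = "\<lambda>\<theta> x. g (fst \<theta>) x (snd \<theta>)"] assms
  by (simp add: case_prod_beta)

lemma dens_cont:
  shows "continuous_on ({0<..} \<times> UNIV) (\<lambda>(s, y). dens s y)"
    and "continuous_on ({0<..} \<times> UNIV) (\<lambda>(s, y). dens_t s y)"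
    and "continuous_on ({0<..} \<times> UNIV) (\<lambda>(s, y). G s y)"
    and "continuous_on ({0<..} \<times> UNIV) (\<lambda>(s, y). H s y)"
  unfolding dens_def dens_t_def G_def H_def
  by (rule continuous_on_integral_p0; intro continuous_intros continuous_parts
      bounded_bilinear.continuous_on[OF bounded_bilinear_outer]; auto)+

text \<open>The forward drift, for which the forward equation reads \<open>\<partial>\<^sub>s dens + div (b dens) = 0\<close>.\<close>

definition b where "b s y = A *v y + (1/2) *\<^sub>R (N *v ((1 / dens s y) *\<^sub>R G s y))"
definition b' where "b' s y = A + (1/2) *\<^sub>R (N ** ((1 / dens s y) *\<^sub>R H s y + (1 / (dens s y)\<^sup>2) *\<^sub>R outer (G s y) (G s y)))"

lemma b_der:
  assumes s: "s > 0"
  shows "(b s has_derivative (\<lambda>h. b' s y *v h)) (at y)"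
proof -
  let ?p = "dens s y"
  have p: "?p \<noteq> 0" using dens_pos[OF s, of y] by simp
  have "((\<lambda>y. inverse (dens s y)) has_derivative (\<lambda>h. - (inverse ?p * (- (G s y \<bullet> h)) * inverse ?p))) (at y)"
    by (rule Deriv.has_derivative_inverse[OF p dens_y_der[OF s]])
  then have "((\<lambda>y. 1 / dens s y) has_derivative (\<lambda>h. (G s y \<bullet> h) / ?p\<^sup>2)) (at y)"
    by (simp add: divide_inverse power2_eq_square mult_ac)
  from has_derivative_scaleR[OF this G_der[OF s]]
  have "((\<lambda>y. (1 / dens s y) *\<^sub>R G s y) has_derivative
      (\<lambda>h. (1 / ?p) *\<^sub>R (H s y *v h) + ((G s y \<bullet> h) / ?p\<^sup>2) *\<^sub>R G s y)) (at y)" .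
  then have "(b s has_derivative (\<lambda>h. A *v h + (1/2) *\<^sub>R (N *v ((1 / ?p) *\<^sub>R (H s y *v h) + ((G s y \<bullet> h) / ?p\<^sup>2) *\<^sub>R G s y)))) (at y)"
    unfolding b_def[abs_def]
    by (intro has_derivative_add has_derivative_scaleR_right bounded_linear.has_derivative[OF matrix_vector_mul_bounded_linear]
        has_derivative_ident)
  then show ?thesis
    by (rule has_derivative_eq_rhs)
      (simp add: fun_eq_iff b'_def bounded_bilinear.add_left[OF bounded_bilinear_matrix_vector_mult]
        bounded_bilinear.scaleR_left[OF bounded_bilinear_matrix_vector_mult]
        matrix_vector_mul_assoc[symmetric] outer_mult_vec)
qed

lemma b_cont:
  "continuous_on ({0<..} \<times> UNIV) (\<lambda>(s, y). b s y)"
  "continuous_on ({0<..} \<times> UNIV) (\<lambda>(s, y). b' s y)"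
proof -
  have pos: "dens (fst z) (snd z) \<noteq> 0" if "z \<in> {0<..} \<times> UNIV" for z
    using that dens_pos[of "fst z" "snd z"] by (auto simp: less_imp_neq[symmetric])
  note c = dens_cont[unfolded case_prod_beta]
  show "continuous_on ({0<..} \<times> UNIV) (\<lambda>(s, y). b s y)" "continuous_on ({0<..} \<times> UNIV) (\<lambda>(s, y). b' s y)"
    unfolding b_def b'_def case_prod_beta
    by (intro continuous_intros bounded_bilinear.continuous_on[OF bounded_bilinear_matrix_vector_mult]
        bounded_bilinear.continuous_on[OF bounded_bilinear_matrix_mult]
        bounded_bilinear.continuous_on[OF bounded_bilinear_outer] c ballI; use pos in force)+
qed

text \<open>Everything is expressed by the averages \<open>dens\<close>, \<open>G\<close> and
  \<open>V\<close>. The contributions of \<open>V\<close> and of \<open>trace (N ** P s)\<close> to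
  \<open>dens_t\<close> cancel against \<open>trace (N ** H s y) / 2\<close>, and the nonlinear
  terms in \<open>G\<close> cancel between advection and divergence.\<close>

lemma forward_equation:
  assumes s: "s > 0"
  shows "dens_t s y - G s y \<bullet> b s y + dens s y * trace (b' s y) = 0"
proof -
  let ?p = "dens s y" and ?G = "G s y" and ?\<zeta> = "\<lambda>x. \<zeta> s x y" and ?k = "\<lambda>x. k s x y"
  have p: "?p \<noteq> 0" using dens_pos[OF s, of y] by simp
  note cx = continuous_x[OF s, of y]
  have NB: "v \<bullet> (N *v v) = (norm (transpose B *v v))\<^sup>2" for v
    unfolding N_def matrix_vector_mul_assoc[symmetric] inner_transpose[of v B] power2_norm_eq_inner ..
  define V where "V = (\<integral>x. p0 x *\<^sub>R (?k x * (norm (transpose B *v ?\<zeta> x))\<^sup>2) \<partial>lborel)"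
  have cB: "continuous_on UNIV (\<lambda>x. transpose B *v ?\<zeta> x)"
    by (intro bounded_bilinear.continuous_on[OF bounded_bilinear_matrix_vector_mult] continuous_on_const cx)
  have iV: "integrable lborel (\<lambda>x. p0 x *\<^sub>R (?k x * (norm (transpose B *v ?\<zeta> x))\<^sup>2))"
    by (intro integrable_p0 continuous_intros cx cB)
  have ip: "integrable lborel (\<lambda>x. p0 x *\<^sub>R ?k x)" by (intro integrable_p0 cx)
  have iG: "integrable lborel (\<lambda>x. p0 x *\<^sub>R (?k x *\<^sub>R ?\<zeta> x))" by (intro integrable_p0 continuous_intros cx)
  have iH: "integrable lborel (\<lambda>x. p0 x *\<^sub>R (?k x *\<^sub>R (P s - outer (?\<zeta> x) (?\<zeta> x))))"
    by (intro integrable_p0 continuous_intros cx bounded_bilinear.continuous_on[OF bounded_bilinear_outer])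
  have 1: "dens_t s y = (- trace A - trace (N ** P s) / 2) * ?p + V / 2 + ?G \<bullet> (A *v y)"
  proof -
    have "dens_t s y = (\<integral>x. (- trace A - trace (N ** P s) / 2) * (p0 x *\<^sub>R ?k x)
        + (p0 x *\<^sub>R (?k x * (norm (transpose B *v ?\<zeta> x))\<^sup>2)) / 2 + (p0 x *\<^sub>R (?k x *\<^sub>R ?\<zeta> x)) \<bullet> (A *v y) \<partial>lborel)"
      unfolding dens_t_def \<kappa>_def by (intro Bochner_Integration.integral_cong refl) (simp add: algebra_simps)
    also have "\<dots> = (\<integral>x. (- trace A - trace (N ** P s) / 2) * (p0 x *\<^sub>R ?k x) \<partial>lborel)
        + (\<integral>x. (p0 x *\<^sub>R (?k x * (norm (transpose B *v ?\<zeta> x))\<^sup>2)) / 2 \<partial>lborel)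
        + (\<integral>x. (p0 x *\<^sub>R (?k x *\<^sub>R ?\<zeta> x)) \<bullet> (A *v y) \<partial>lborel)"
    proof -
      have a: "integrable lborel (\<lambda>x. (- trace A - trace (N ** P s) / 2) * (p0 x *\<^sub>R ?k x))"
        by (rule integrable_mult_right[OF ip])
      have b: "integrable lborel (\<lambda>x. (p0 x *\<^sub>R (?k x * (norm (transpose B *v ?\<zeta> x))\<^sup>2)) / 2)"
        by (rule integrable_divide[OF iV])
      have c: "integrable lborel (\<lambda>x. (p0 x *\<^sub>R (?k x *\<^sub>R ?\<zeta> x)) \<bullet> (A *v y))"
        by (rule integrable_inner_left[OF iG])
      show ?thesis
        unfolding Bochner_Integration.integral_add[OF Bochner_Integration.integrable_add[OF a b] c]
          Bochner_Integration.integral_add[OF a b] ..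
    qed
    also have "\<dots> = (- trace A - trace (N ** P s) / 2) * ?p + V / 2 + ?G \<bullet> (A *v y)"
      unfolding dens_def V_def G_def integral_mult_right_zero integral_divide_zero integral_inner_left[OF iG] ..
    finally show ?thesis .
  qed
  have lin: "bounded_linear (\<lambda>X. trace (N ** X))"
    by (rule bounded_linear_compose[OF bounded_linear_trace bounded_bilinear.bounded_linear_right[OF bounded_bilinear_matrix_mult]])
  interpret T: bounded_linear "\<lambda>X. trace (N ** X)" by (rule lin)
  have 2: "trace (N ** H s y) = trace (N ** P s) * ?p - V"
  proof -
    have "trace (N ** H s y) = (\<integral>x. trace (N ** (p0 x *\<^sub>R (?k x *\<^sub>R (P s - outer (?\<zeta> x) (?\<zeta> x))))) \<partial>lborel)"
      unfolding H_def by (rule integral_bounded_linear[OF lin iH, symmetric])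
    also have "\<dots> = (\<integral>x. trace (N ** P s) * (p0 x *\<^sub>R ?k x) - p0 x *\<^sub>R (?k x * (norm (transpose B *v ?\<zeta> x))\<^sup>2) \<partial>lborel)"
      by (intro Bochner_Integration.integral_cong refl)
        (simp only: T.scaleR T.diff trace_matrix_mult_outer NB, simp add: algebra_simps)
    also have "\<dots> = trace (N ** P s) * ?p - V"
      unfolding dens_def V_def using ip iV by simp
    finally show ?thesis .
  qed
  have 3: "trace (b' s y) = trace A + (1/2) * ((1 / ?p) * trace (N ** H s y) + (1 / ?p\<^sup>2) * (norm (transpose B *v ?G))\<^sup>2)"
    unfolding b'_def trace_add
    by (simp only: linear_cmul[OF bounded_linear.linear[OF bounded_linear_trace]] T.add T.scaleR trace_matrix_mult_outer NB real_scaleR_def)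
  have 4: "?G \<bullet> b s y = ?G \<bullet> (A *v y) + (1/2) * ((1 / ?p) * (norm (transpose B *v ?G))\<^sup>2)"
    unfolding b_def by (simp only: inner_add_right inner_scaleR_right matrix_vector_mult_scaleR NB)
  show ?thesis unfolding 1 3 4 2 using p by (simp add: field_simps power2_eq_square)
qed

text \<open>Writing \<open>\<zeta> = P y - \<eta>\<close>, the derivative of \<open>G / dens\<close> is \<open>P\<close> minus the conditional covariance of \<open>\<zeta>\<close>,
  which equals that of \<open>\<eta>\<close>; on the support of \<open>p0\<close> the latter is bounded uniformly in \<open>y\<close>. This is what makes
  the drift globally Lipschitz.\<close>

lemma b'_covariance:
  assumes s: "s > 0"
  defines "\<eta> \<equiv> \<lambda>x. P s *v (mexp s A *v x)"
  defines "Ge \<equiv> \<lambda>y. \<integral>x. p0 x *\<^sub>R (k s x y *\<^sub>R \<eta> x) \<partial>lborel"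
  defines "S \<equiv> \<lambda>y. \<integral>x. p0 x *\<^sub>R (k s x y *\<^sub>R outer (\<eta> x) (\<eta> x)) \<partial>lborel"
  shows "(1 / dens s y) *\<^sub>R H s y + (1 / (dens s y)\<^sup>2) *\<^sub>R outer (G s y) (G s y)
    = P s - (1 / dens s y) *\<^sub>R S y + (1 / (dens s y)\<^sup>2) *\<^sub>R outer (Ge y) (Ge y)"
proof -
  interpret O: bounded_bilinear "outer :: real^'n \<Rightarrow> real^'n \<Rightarrow> real^'n^'n" by (rule bounded_bilinear_outer)
  let ?p = "dens s y" and ?k = "\<lambda>x. k s x y" and ?\<zeta> = "\<lambda>x. \<zeta> s x y"
  \<comment> \<open>\<open>a\<close> is the only part of \<open>\<zeta>\<close> that grows with
    \<open>y\<close>. It is constant under the integral, so it drops out of the covariance and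
    leaves the part built from \<open>\<eta>\<close>.\<close>
  define a where "a = P s *v y"
  have p: "?p \<noteq> 0" using dens_pos[OF s, of y] by simp
  have \<zeta>: "?\<zeta> x = a - \<eta> x" for x
    by (simp add: \<zeta>_def a_def \<eta>_def matrix_vector_mult_diff_distrib)
  have c\<eta>: "continuous_on UNIV \<eta>"
    unfolding \<eta>_def by (intro bounded_bilinear.continuous_on[OF bounded_bilinear_matrix_vector_mult] continuous_intros)
  have ck: "continuous_on UNIV ?k" by (rule continuous_x(1)[OF s])
  have ip: "integrable lborel (\<lambda>x. p0 x *\<^sub>R ?k x)" by (intro integrable_p0 ck)
  have iGe: "integrable lborel (\<lambda>x. p0 x *\<^sub>R (?k x *\<^sub>R \<eta> x))" by (intro integrable_p0 continuous_intros ck c\<eta>)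
  have iS: "integrable lborel (\<lambda>x. p0 x *\<^sub>R (?k x *\<^sub>R outer (\<eta> x) (\<eta> x)))"
    by (intro integrable_p0 continuous_intros ck c\<eta> O.continuous_on)
  have sc: "integrable lborel (\<lambda>x. (p0 x *\<^sub>R ?k x) *\<^sub>R X)" "(\<integral>x. (p0 x *\<^sub>R ?k x) *\<^sub>R X \<partial>lborel) = ?p *\<^sub>R X"
    for X :: "'b::euclidean_space"
    using integrable_scaleR_left[of X lborel "\<lambda>x. p0 x *\<^sub>R ?k x"] integral_scaleR_left[of X lborel "\<lambda>x. p0 x *\<^sub>R ?k x"] ip
    by (simp_all only: dens_def)
  have G: "G s y = ?p *\<^sub>R a - Ge y"
  proof -
    have "G s y = (\<integral>x. (p0 x *\<^sub>R ?k x) *\<^sub>R a - p0 x *\<^sub>R (?k x *\<^sub>R \<eta> x) \<partial>lborel)"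
      unfolding G_def \<zeta> by (simp add: scaleR_diff_right)
    then show ?thesis unfolding Bochner_Integration.integral_diff[OF sc(1) iGe] sc(2) Ge_def .
  qed
  have bl: "bounded_linear (outer a :: real^'n \<Rightarrow> real^'n^'n)" "bounded_linear (\<lambda>x. outer x a :: real^'n^'n)"
    by (rule O.bounded_linear_right, rule O.bounded_linear_left)
  note I1 = integrable_bounded_linear[OF bl(1) iGe] and I2 = integrable_bounded_linear[OF bl(2) iGe]
  have H: "H s y = ?p *\<^sub>R (P s - outer a a) + (outer a (Ge y) + outer (Ge y) a) - S y"
  proof -
    have "H s y = (\<integral>x. ((p0 x *\<^sub>R ?k x) *\<^sub>R (P s - outer a a)
        + (outer a (p0 x *\<^sub>R (?k x *\<^sub>R \<eta> x)) + outer (p0 x *\<^sub>R (?k x *\<^sub>R \<eta> x)) a))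
        - p0 x *\<^sub>R (?k x *\<^sub>R outer (\<eta> x) (\<eta> x)) \<partial>lborel)"
      unfolding H_def \<zeta> by (intro Bochner_Integration.integral_cong refl)
        (simp add: O.diff_left O.diff_right O.scaleR_left O.scaleR_right algebra_simps)
    also have "\<dots> = ?p *\<^sub>R (P s - outer a a) + (outer a (Ge y) + outer (Ge y) a) - S y"
      unfolding Bochner_Integration.integral_diff[OF Bochner_Integration.integrable_add[OF sc(1) Bochner_Integration.integrable_add[OF I1 I2]] iS]
        Bochner_Integration.integral_add[OF sc(1) Bochner_Integration.integrable_add[OF I1 I2]]
        Bochner_Integration.integral_add[OF I1 I2] sc(2) S_def Ge_def
        integral_bounded_linear[OF bl(1) iGe] integral_bounded_linear[OF bl(2) iGe] ..
    finally show ?thesis .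
  qed
  have GG: "outer (G s y) (G s y) = ?p\<^sup>2 *\<^sub>R outer a a - ?p *\<^sub>R (outer a (Ge y) + outer (Ge y) a) + outer (Ge y) (Ge y)"
    unfolding G by (simp add: O.diff_left O.diff_right O.scaleR_left O.scaleR_right algebra_simps power2_eq_square)
  have "(1 / ?p\<^sup>2) * ?p = 1 / ?p" "(1 / ?p\<^sup>2) * ?p\<^sup>2 = 1" "(1 / ?p) * ?p = 1"
    using p by (simp_all add: power2_eq_square)
  then show ?thesis
    unfolding H GG by (simp add: scaleR_add_right scaleR_diff_right)
qed

text \<open>Compactness of \<open>{r..t}\<close>, with \<open>r\<close> away from 0, bounds
  \<open>P\<close>, and together with the ball of radius \<open>R\<close> it bounds
  \<open>\<eta>\<close>. Averages inherit these bounds without dependence on \<open>y\<close>, and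
  the mean value inequality on the whole space concludes.\<close>

lemma b_lipschitz:
  assumes r: "0 < r"
  obtains L where "L > 0" "\<And>s x y. s \<in> {r..t} \<Longrightarrow> norm (b s x - b s y) \<le> L * norm (x - y)"
proof -
  let ?\<eta> = "\<lambda>s x. P s *v (mexp s A *v x)"
  have P_cont': "continuous_on {r..t} P" using r by (intro continuous_on_subset[OF P_cont]) auto
  obtain CP where CP: "CP > 0" "\<And>s. s \<in> {r..t} \<Longrightarrow> norm (P s) \<le> CP"
    using bounded_on_compact[OF compact_Icc P_cont'] by blast
  have "continuous_on ({r..t} \<times> cball 0 R) (\<lambda>z. ?\<eta> (fst z) (snd z))"
    using P_cont' by (intro bounded_bilinear.continuous_on[OF bounded_bilinear_matrix_vector_mult] continuous_intros
        continuous_on_compose2[OF mexp_cont[of UNIV]] continuous_on_compose2[OF P_cont']) auto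
  then have "\<exists>B>0. \<forall>z\<in>{r..t} \<times> cball 0 R. norm (?\<eta> (fst z) (snd z)) \<le> B"
    by (intro bounded_on_compact compact_Times) auto
  then obtain C where C: "C > 0" "\<And>z. z \<in> {r..t} \<times> cball 0 R \<Longrightarrow> norm (?\<eta> (fst z) (snd z)) \<le> C" by blast
  have C': "norm (?\<eta> s x) \<le> C" if "s \<in> {r..t}" "norm x \<le> R" for s x
    using C(2)[of "(s, x)"] that by auto
  obtain Ko where Ko: "Ko > 0" "\<And>u v :: real^'n. norm (outer u v :: real^'n^'n) \<le> norm u * norm v * Ko"
    using bounded_bilinear.pos_bounded[OF bounded_bilinear_outer] by blast
  obtain Km where Km: "Km > 0" "\<And>(X :: real^'n^'n) (Y :: real^'n^'n). norm (X ** Y) \<le> norm X * norm Y * Km"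
    using bounded_bilinear.pos_bounded[OF bounded_bilinear_matrix_mult] by blast
  obtain Kv where Kv: "Kv > 0" "\<And>(X :: real^'n^'n) (y :: real^'n). norm (X *v y) \<le> norm X * norm y * Kv"
    using bounded_bilinear.pos_bounded[OF bounded_bilinear_matrix_vector_mult] by blast
  \<comment> \<open>The summands bound \<open>P s\<close>, the conditional second moment of
    \<open>\<eta>\<close>, and the outer square of its conditional mean.\<close>
  define D where "D = CP + C * C * Ko + C * C * Ko"
  define Lb where "Lb = (norm A + (1/2) * (norm N * D * Km)) * Kv"
  have D: "D \<ge> 0" using CP(1) C(1) Ko(1) by (simp add: D_def)
  have Lb: "Lb \<ge> 0" using D Km(1) Kv(1) by (simp add: Lb_def)
  have b'_bound: "norm (b' s y) \<le> norm A + (1/2) * (norm N * D * Km)" if st: "s \<in> {r..t}" for s y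
  proof -
    have s: "s > 0" using st r by auto
    let ?p = "dens s y"
    have p: "?p > 0" by (rule dens_pos[OF s])
    \<comment> \<open>\<open>?w\<close> is the unnormalised conditional density of the starting
      point given \<open>y\<close>. Its mass \<open>?p\<close> is what the divisions by
      \<open>dens\<close> remove.\<close>
    let ?w = "\<lambda>x. p0 x * k s x y"
    let ?Ge = "\<integral>x. p0 x *\<^sub>R (k s x y *\<^sub>R ?\<eta> s x) \<partial>lborel"
    let ?S = "\<integral>x. p0 x *\<^sub>R (k s x y *\<^sub>R outer (?\<eta> s x) (?\<eta> s x)) \<partial>lborel"
    have w: "integrable lborel ?w" "\<And>x. norm x > R \<Longrightarrow> ?w x = 0" "\<And>x. ?w x \<ge> 0"
      using integrable_p0[OF continuous_x(1)[OF s]] p0_supp p0_nonneg k_pos[OF s] by (auto simp: less_imp_le)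
    have wp: "(\<integral>x. ?w x \<partial>lborel) = ?p" by (simp add: dens_def)
    have c\<eta>: "continuous_on UNIV (?\<eta> s)"
      by (intro bounded_bilinear.continuous_on[OF bounded_bilinear_matrix_vector_mult] continuous_intros)
    have "norm (\<integral>x. ?w x *\<^sub>R ?\<eta> s x \<partial>lborel) \<le> C * (\<integral>x. ?w x \<partial>lborel)"
      using C'[OF st] by (intro norm_integral_weighted_le[OF w] c\<eta>) auto
    then have Ge: "norm ?Ge \<le> C * ?p" by (simp add: wp)
    have "norm (\<integral>x. ?w x *\<^sub>R outer (?\<eta> s x) (?\<eta> s x) \<partial>lborel) \<le> (C * C * Ko) * (\<integral>x. ?w x \<partial>lborel)"
    proof (intro norm_integral_weighted_le[OF w] bounded_bilinear.continuous_on[OF bounded_bilinear_outer] c\<eta>)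
      fix x :: "real^'n" assume x: "norm x \<le> R"
      have "norm (outer (?\<eta> s x) (?\<eta> s x)) \<le> norm (?\<eta> s x) * norm (?\<eta> s x) * Ko" by (rule Ko(2))
      also have "\<dots> \<le> C * C * Ko" using C'[OF st x] C(1) Ko(1) by (intro mult_mono mult_right_mono) auto
      finally show "norm (outer (?\<eta> s x) (?\<eta> s x)) \<le> C * C * Ko" .
    qed
    then have S: "norm ?S \<le> (C * C * Ko) * ?p" by (simp add: wp)
    have "norm ((1 / ?p) *\<^sub>R ?S) \<le> C * C * Ko"
      using S p by (simp add: pos_divide_le_eq)
    moreover have "norm ((1 / ?p\<^sup>2) *\<^sub>R outer ?Ge ?Ge) \<le> C * C * Ko"
    proof -
      have "norm (outer ?Ge ?Ge) \<le> norm ?Ge * norm ?Ge * Ko" by (rule Ko(2))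
      also have "\<dots> \<le> (C * ?p) * (C * ?p) * Ko"
        using Ge C(1) p Ko(1) by (intro mult_mono mult_right_mono) auto
      finally have "norm (outer ?Ge ?Ge) \<le> (C * C * Ko) * ?p\<^sup>2" by (simp add: power2_eq_square mult_ac)
      then show ?thesis using p by (simp add: pos_divide_le_eq)
    qed
    ultimately have W: "norm ((1 / ?p) *\<^sub>R H s y + (1 / ?p\<^sup>2) *\<^sub>R outer (G s y) (G s y)) \<le> D"
      unfolding b'_covariance[OF s] D_def using CP(2)[OF st]
      by (intro norm_triangle_le add_mono) (auto intro!: norm_triangle_le_diff add_mono)
    let ?W = "(1 / ?p) *\<^sub>R H s y + (1 / ?p\<^sup>2) *\<^sub>R outer (G s y) (G s y)"
    have "norm (N ** ?W) \<le> norm N * norm ?W * Km" by (rule Km(2))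
    also have "\<dots> \<le> norm N * D * Km" using W Km(1) by (intro mult_right_mono mult_left_mono) auto
    finally show ?thesis unfolding b'_def by (intro norm_triangle_le add_mono) auto
  qed
  show thesis
  proof (rule that[of "Lb + 1"])
    fix s x y assume st: "s \<in> {r..t}"
    then have s: "s > 0" using r by auto
    have "norm (b s x - b s y) \<le> Lb * norm (x - y)"
    proof (rule differentiable_bound[of UNIV "b s" "\<lambda>y h. b' s y *v h"])
      fix y
      show "(b s has_derivative (\<lambda>h. b' s y *v h)) (at y within UNIV)" by (rule b_der[OF s])
      show "onorm (\<lambda>h. b' s y *v h) \<le> Lb"
      proof (rule onorm_bound[OF Lb])
        fix h
        have "norm (b' s y *v h) \<le> norm (b' s y) * norm h * Kv" by (rule Kv(2))
        also have "\<dots> \<le> (norm A + (1/2) * (norm N * D * Km)) * norm h * Kv"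
          using b'_bound[OF st] Kv(1) by (intro mult_right_mono) auto
        finally show "norm (b' s y *v h) \<le> Lb * norm h" by (simp add: Lb_def mult_ac)
      qed
    qed auto
    also have "\<dots> \<le> (Lb + 1) * norm (x - y)" by (intro mult_right_mono) auto
    finally show "norm (b s x - b s y) \<le> (Lb + 1) * norm (x - y)" .
  qed (use Lb in simp)
qed

section \<open>Total mass, score and reverse drift\<close>

text \<open>Tonelli's theorem: the inner integral over \<open>y\<close> is 1 for every
  \<open>x\<close>, which leaves the mass of \<open>p0\<close>.\<close>

lemma dens_mass:
  assumes s: "s > 0"
  shows "integrable lborel (dens s)" "(\<integral>\<^sup>+y. ennreal (dens s y) \<partial>lborel) = 1"
proof -
  have [measurable]: "p0 \<in> borel_measurable borel" using p0_int by auto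
  have "continuous_on UNIV (\<lambda>z. k s (fst z) (snd z))"
    using s by (intro continuous_intros continuous_parts) auto
  then have "(\<lambda>z. k s (fst z) (snd z)) \<in> borel_measurable borel"
    by (rule borel_measurable_continuous_onI)
  then have km [measurable]: "(\<lambda>(x, y). k s x y) \<in> borel_measurable (borel \<Otimes>\<^sub>M borel)"
    by (simp add: borel_prod case_prod_beta)
  have dm [measurable]: "dens s \<in> borel_measurable borel"
    by (intro borel_measurable_continuous_onI)
      (metis dens_y_der[OF s] has_derivative_continuous continuous_at_imp_continuous_on)
  have "(\<integral>\<^sup>+y. ennreal (dens s y) \<partial>lborel) = (\<integral>\<^sup>+y. \<integral>\<^sup>+x. ennreal (p0 x) * ennreal (k s x y) \<partial>lborel \<partial>lborel)"
  proof (intro nn_integral_cong)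
    fix y
    have "(\<integral>\<^sup>+x. ennreal (p0 x *\<^sub>R k s x y) \<partial>lborel) = ennreal (dens s y)"
      unfolding dens_def using p0_nonneg k_pos[OF s]
      by (intro nn_integral_eq_integral integrable_p0 continuous_x s) (auto simp: less_imp_le)
    then show "ennreal (dens s y) = (\<integral>\<^sup>+x. ennreal (p0 x) * ennreal (k s x y) \<partial>lborel)"
      using p0_nonneg by (simp add: ennreal_mult')
  qed
  also have "\<dots> = (\<integral>\<^sup>+x. \<integral>\<^sup>+y. ennreal (p0 x) * ennreal (k s x y) \<partial>lborel \<partial>lborel)"
    by (rule lborel_pair.Fubini') measurable
  also have "\<dots> = (\<integral>\<^sup>+x. ennreal (p0 x) \<partial>lborel)"
  proof (intro nn_integral_cong)
    fix x
    have "(\<integral>\<^sup>+y. ennreal (k s x y) \<partial>lborel) = 1"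
      using nn_integral_eq_integral[OF k_integral(1)[OF s, of x]] k_integral(2)[OF s, of x] k_pos[OF s]
      by (simp add: less_imp_le)
    then show "(\<integral>\<^sup>+y. ennreal (p0 x) * ennreal (k s x y) \<partial>lborel) = ennreal (p0 x)"
      by (subst nn_integral_cmult) auto
  qed
  also have "\<dots> = 1"
    using nn_integral_eq_integral[OF p0_int] p0_nonneg p0_mass by simp
  finally show 1: "(\<integral>\<^sup>+y. ennreal (dens s y) \<partial>lborel) = 1" .
  show "integrable lborel (dens s)"
    using 1 dens_pos[OF s] by (intro integrableI_nonneg) (auto simp: less_imp_le)
qed

lemma grad_ln_dens:
  assumes s: "s > 0"
  shows "grad (\<lambda>z. ln (fwd_density A B p0 s z)) y = - ((1 / dens s y) *\<^sub>R G s y)"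
proof -
  have "((\<lambda>z. ln (dens s z)) has_derivative (\<lambda>h. inverse (dens s y) * (- (G s y \<bullet> h)))) (at y)"
    using has_derivative_ln[OF dens_pos[OF s] dens_y_der[OF s, of y]] by (simp add: mult.commute)
  then have "frechet_derivative (\<lambda>z. ln (fwd_density A B p0 s z)) (at y) = (\<lambda>h. inverse (dens s y) * (- (G s y \<bullet> h)))"
    using fwd_density_eq[OF s] frechet_derivative_at by fastforce
  then show ?thesis
    by (simp add: grad_def vec_eq_iff cart_eq_inner_axis[symmetric] divide_inverse)
qed

text \<open>\<open>G\<close> is minus the gradient of the density, so the control contributes
  exactly minus the diffusive part of \<open>b\<close>.\<close>

lemma reverse_drift:
  assumes "T - t > 0"
  shows "- (A *v y) + B *v policy A B p0 T t y = - b (T - t) y"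
  unfolding policy_def grad_ln_dens[OF assms] b_def N_def
  by (simp add: matrix_vector_mul_assoc[symmetric] matrix_vector_mult_scaleR
      bounded_bilinear.minus_right[OF bounded_bilinear_matrix_vector_mult] del: transpose_matrix_vector)

end

section \<open>The reverse process\<close>

text \<open>Reversing time changes the sign of both the time derivative and the drift, so
  \<open>pde\<close> is minus the forward equation at \<open>T - t\<close>. The condition
  \<open>\<tau> < T\<close> keeps these times positive.\<close>

lemma (in lti_density) reverse_continuity_equation:
  assumes \<tau>: "0 \<le> \<tau>" "\<tau> < T" and L: "L > 0"
    and lip: "\<And>s x y. s \<in> {T - \<tau>..T} \<Longrightarrow> norm (b s x - b s y) \<le> L * norm (x - y)"
  shows "continuity_equation (\<lambda>t x. - b (T - t) x) (\<lambda>t x. - b' (T - t) x) (\<lambda>t x. dens (T - t) x)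
    (\<lambda>t x. blinfun_inner_right (- dens_t (T - t) x, - G (T - t) x)) \<tau> L"
proof
  have pos: "T - t > 0" if "t \<in> {0..\<tau>}" for t using that \<tau> by auto
  have rev: "continuous_on ({0..\<tau>} \<times> UNIV) (\<lambda>(t, x). f (T - t) x)"
    if "continuous_on ({0<..} \<times> UNIV) (\<lambda>(s, y). f s y)" for f :: "real \<Rightarrow> real^'n \<Rightarrow> 'b::topological_space"
  proof -
    have "continuous_on ({0..\<tau>} \<times> UNIV) (\<lambda>z. (\<lambda>(s, y). f s y) (T - fst z, snd z))"
      by (rule continuous_on_compose2[OF that]) (use \<tau> in \<open>auto intro!: continuous_intros\<close>)
    then show ?thesis by (simp add: case_prod_beta)
  qed
  show "0 \<le> \<tau>" "0 < L" by fact+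
  show "norm (- b (T - t) x - - b (T - t) y) \<le> L * norm (x - y)" if "t \<in> {0..\<tau>}" for t x y
    using lip[of "T - t" x y] that by (auto simp: norm_minus_commute)
  show "continuous_on ({0..\<tau>} \<times> UNIV) (\<lambda>(t, x). - b (T - t) x)"
    "continuous_on ({0..\<tau>} \<times> UNIV) (\<lambda>(t, x). - b' (T - t) x)"
    using continuous_on_minus[OF rev[OF b_cont(1)]] continuous_on_minus[OF rev[OF b_cont(2)]]
    by (simp_all add: case_prod_beta)
  show "((\<lambda>x. - b (T - t) x) has_derivative (\<lambda>h. - b' (T - t) x *v h)) (at x)" if "t \<in> {0..\<tau>}" for t x
    using has_derivative_minus[OF b_der[OF pos[OF that]]]
    by (simp add: bounded_bilinear.minus_left[OF bounded_bilinear_matrix_vector_mult])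
  show "((\<lambda>(t, x). dens (T - t) x) has_derivative
      blinfun_apply (blinfun_inner_right (- dens_t (T - t) x, - G (T - t) x))) (at (t, x) within {0..\<tau>} \<times> UNIV)"
    if "t \<in> {0..\<tau>}" for t x
  proof -
    have inner: "((\<lambda>z. (T - fst z, snd z)) has_derivative (\<lambda>h. (- fst h, snd h))) (at (t, x))"
      by (auto intro!: derivative_eq_intros)
    have outer: "((\<lambda>\<theta>. dens (fst \<theta>) (snd \<theta>)) has_derivative (\<lambda>h. (dens_t (T - t) x, - G (T - t) x) \<bullet> h))
        (at (T - fst (t, x), snd (t, x)))"
      using dens_der[OF pos[OF that]] by simp
    have "((\<lambda>z. dens (fst (T - fst z, snd z)) (snd (T - fst z, snd z))) has_derivative
        (\<lambda>h. (dens_t (T - t) x, - G (T - t) x) \<bullet> (- fst h, snd h))) (at (t, x))"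
      by (rule has_derivative_compose[OF inner outer])
    then have "((\<lambda>(t, x). dens (T - t) x) has_derivative
        (\<lambda>h. (dens_t (T - t) x, - G (T - t) x) \<bullet> (- fst h, snd h))) (at (t, x))"
      by (simp add: case_prod_unfold)
    then have "((\<lambda>(t, x). dens (T - t) x) has_derivative
      blinfun_apply (blinfun_inner_right (- dens_t (T - t) x, - G (T - t) x))) (at (t, x))"
      by (rule has_derivative_eq_rhs) (simp add: fun_eq_iff inner_prod_def)
    then show ?thesis by (rule has_derivative_at_withinI)
  qed
  have "continuous_on ({0..\<tau>} \<times> UNIV) (\<lambda>z. (- dens_t (T - fst z) (snd z), - G (T - fst z) (snd z)))"
    using rev[OF dens_cont(2)] rev[OF dens_cont(3)] by (auto simp: case_prod_beta intro!: continuous_intros)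
  then show "continuous_on ({0..\<tau>} \<times> UNIV) (\<lambda>(t, x). blinfun_inner_right (- dens_t (T - t) x, - G (T - t) x))"
    unfolding case_prod_beta by (rule bounded_linear.continuous_on[OF bounded_linear_blinfun_inner_right])
  show "blinfun_apply (blinfun_inner_right (- dens_t (T - t) x, - G (T - t) x)) (1, - b (T - t) x)
      + dens (T - t) x * trace (- b' (T - t) x) = 0" if "t \<in> {0..\<tau>}" for t x
  proof -
    have "trace (- b' (T - t) x) = - trace (b' (T - t) x)"
      by (simp add: trace_def sum_negf)
    then show ?thesis using forward_equation[OF pos[OF that], of x] by (simp add: inner_prod_def)
  qed
qed

lemma abs_cont_on_lipschitz:
  fixes f :: "real \<Rightarrow> 'a::real_normed_vector"
  assumes lip: "\<And>s t. s \<in> {a..b} \<Longrightarrow> t \<in> {a..b} \<Longrightarrow> s \<le> t \<Longrightarrow> norm (f t - f s) \<le> C * (t - s)" and C: "C > 0"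
  shows "abs_cont_on f a b"
  unfolding abs_cont_on_def
proof (intro allI impI)
  fix e :: real assume e: "e > 0"
  show "\<exists>\<delta>>0. \<forall>(n::nat) s u. (\<forall>i<n. a \<le> s i \<and> s i \<le> u i \<and> u i \<le> b) \<and>
        (\<forall>i<n. \<forall>j<n. i \<noteq> j \<longrightarrow> u i \<le> s j \<or> u j \<le> s i) \<and> (\<Sum>i<n. u i - s i) < \<delta>
        \<longrightarrow> (\<Sum>i<n. norm (f (u i) - f (s i))) < e"
  proof (intro exI[of _ "e / C"] conjI allI impI)
    show "e / C > 0" using e C by simp
    fix n :: nat and s u :: "nat \<Rightarrow> real"
    assume *: "(\<forall>i<n. a \<le> s i \<and> s i \<le> u i \<and> u i \<le> b) \<and>
        (\<forall>i<n. \<forall>j<n. i \<noteq> j \<longrightarrow> u i \<le> s j \<or> u j \<le> s i) \<and> (\<Sum>i<n. u i - s i) < e / C"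
    have "(\<Sum>i<n. norm (f (u i) - f (s i))) \<le> (\<Sum>i<n. C * (u i - s i))"
      using * by (intro sum_mono lip) auto
    also have "\<dots> = C * (\<Sum>i<n. u i - s i)" by (simp add: sum_distrib_left)
    also have "\<dots> < C * (e / C)" using * C by (intro mult_strict_left_mono) auto
    finally show "(\<Sum>i<n. norm (f (u i) - f (s i))) < e" using C by simp
  qed
qed

lemma sets_Collect_eq_vec:
  fixes f g :: "'a \<Rightarrow> 'b::euclidean_space"
  assumes "f \<in> borel_measurable M" "g \<in> borel_measurable M"
  shows "{z \<in> space M. f z = g z} \<in> sets M"
proof -
  have "(\<lambda>z. f z - g z) -` {0} \<inter> space M \<in> sets M"
    using borel_measurable_diff[OF assms] by (rule measurable_sets) simp
  also have "(\<lambda>z. f z - g z) -` {0} \<inter> space M = {z \<in> space M. f z = g z}" by auto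
  finally show ?thesis .
qed

theorem mainTheorem15:
  fixes A :: "real^'n^'n" and B :: "real^'m^'n"
    and p0 :: "real^'n \<Rightarrow> real" and T :: real
  assumes stable: "\<And>c. is_eigenvalue A c \<Longrightarrow> Re c < 0"
    and gram_inv: "\<And>t. t > 0 \<Longrightarrow> invertible (gramian A B t)"
    and p0_meas: "p0 \<in> borel_measurable lborel"
    and p0_nonneg: "\<And>x. p0 x \<ge> 0"
    and p0_int: "integrable lborel p0"
    and p0_mass: "(\<integral>x. p0 x \<partial>lborel) = 1"
    and p0_L2: "integrable lborel (\<lambda>x. (p0 x)\<^sup>2)"
    and p0_supp: "\<exists>S. compact S \<and> (\<forall>x. x \<notin> S \<longrightarrow> p0 x = 0)"
    and T_pos: "T > 0"
  shows "\<forall>\<epsilon>. 0 < \<epsilon> \<and> \<epsilon> < T \<longrightarrow>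
    (\<exists>P :: ((real^'n) \<times> (real \<Rightarrow>\<^sub>C (real^'n))) measure.
       prob_space P \<and>
       sets P = sets (borel \<Otimes>\<^sub>M borel) \<and>
       (AE (y, \<gamma>) in P.
          (\<forall>t. apply_bcontfun \<gamma> t = apply_bcontfun \<gamma> (max 0 (min (T - \<epsilon>) t))) \<and>
          abs_cont_on (apply_bcontfun \<gamma>) 0 (T - \<epsilon>) \<and>
          apply_bcontfun \<gamma> 0 = y \<and>
          (AE t in lborel. t \<in> {0..T - \<epsilon>} \<longrightarrow>
             (apply_bcontfun \<gamma> has_vector_derivative
                (- (A *v apply_bcontfun \<gamma> t) + B *v policy A B p0 T t (apply_bcontfun \<gamma> t)))
             (at t))) \<and>
       (\<forall>t \<in> {0..T - \<epsilon>}.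
          distr P lborel (\<lambda>(y, \<gamma>). apply_bcontfun \<gamma> t) =
          density lborel (\<lambda>x. ennreal (fwd_density A B p0 (T - t) x))))"
proof (intro allI impI)
  fix \<epsilon> :: real assume \<epsilon>: "0 < \<epsilon> \<and> \<epsilon> < T"
  define \<tau> where "\<tau> = T - \<epsilon>"
  have \<tau>: "0 < \<tau>" "\<tau> < T" using \<epsilon> by (auto simp: \<tau>_def)
  obtain S where S: "compact S" "\<And>x. x \<notin> S \<Longrightarrow> p0 x = 0" using p0_supp by blast
  obtain R where R: "\<And>x. x \<in> S \<Longrightarrow> norm x \<le> R"
    using compact_imp_bounded[OF S(1)] by (auto simp: bounded_iff)
  interpret lti_density A B p0 R
  proof
    show "p0 x = 0" if "norm x > R" for x using R[of x] S(2)[of x] that by force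
  qed (fact gram_inv p0_int p0_nonneg p0_mass)+
  obtain L where L: "L > 0" "\<And>s x y. s \<in> {\<epsilon>..T} \<Longrightarrow> norm (b s x - b s y) \<le> L * norm (x - y)"
    using b_lipschitz[of \<epsilon> T] \<epsilon> by blast
  let ?v = "\<lambda>t x. - b (T - t) x"
  let ?q' = "\<lambda>t x. blinfun_inner_right (- dens_t (T - t) x, - G (T - t) x)"
  \<comment> \<open>For every horizon \<open>t \<le> \<tau>\<close> the times \<open>T - t\<close>
    stay above \<open>\<epsilon>\<close>, so a single Lipschitz constant serves all of them.\<close>
  have CE: "continuity_equation ?v (\<lambda>t x. - b' (T - t) x) (\<lambda>t x. dens (T - t) x) ?q' t L" if "t \<in> {0..\<tau>}" for t
    using that \<tau> by (intro reverse_continuity_equation L) (auto simp: \<tau>_def)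
  interpret E: continuity_equation ?v "\<lambda>t x. - b' (T - t) x" "\<lambda>t x. dens (T - t) x" ?q' \<tau> L
    using \<tau> by (intro CE) auto
  define X where "X = E.flow 0"
  have X_sol: "solves_ode ?v (X y) 0 \<tau>" and X_0: "X y 0 = y" for y
    using \<tau> E.flow_solves[of 0 y] E.flow_init[of 0 y] by (auto simp: X_def)
  have X_cont: "continuous_on {0..\<tau>} (X y)" for y by (rule solves_ode_continuous[OF X_sol])
  \<comment> \<open>Paths on \<open>{0..\<tau>}\<close> are represented by bounded continuous
    functions on the line, frozen outside the interval.\<close>
  have "\<exists>g. \<forall>t. apply_bcontfun g t = X y (max 0 (min \<tau> t))" for y
    using bcontfun_clampE[OF X_cont[of y]] \<tau> by (metis less_imp_le)
  then obtain \<Gamma> where \<Gamma>: "\<And>y t. apply_bcontfun (\<Gamma> y) t = X y (max 0 (min \<tau> t))" by metis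
  have \<Gamma>_in: "apply_bcontfun (\<Gamma> y) t = X y t" if "t \<in> {0..\<tau>}" for y t
    using that by (simp add: \<Gamma>)
  \<comment> \<open>The flow is Lipschitz in its starting point uniformly in time, so
    \<open>\<Gamma>\<close> is continuous for the supremum distance and hence Borel measurable into
    the path space.\<close>
  have "dist (\<Gamma> x) (\<Gamma> y) \<le> exp (L * \<tau>) * dist x y" for x y
  proof (rule dist_bound)
    fix t
    show "dist (apply_bcontfun (\<Gamma> x) t) (apply_bcontfun (\<Gamma> y) t) \<le> exp (L * \<tau>) * dist x y"
      using E.flow_lipschitz[of 0 "max 0 (min \<tau> t)" x y] \<tau> by (simp add: \<Gamma> X_def dist_norm)
  qed
  then have "continuous_on UNIV \<Gamma>"
    by (intro lipschitz_on_continuous_on[of "exp (L * \<tau>)"] lipschitz_onI) auto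
  then have \<Gamma>_meas [measurable]: "\<Gamma> \<in> borel_measurable borel" by (rule borel_measurable_continuous_onI)
  have ev_cont: "continuous_on UNIV (\<lambda>g :: real \<Rightarrow>\<^sub>C (real^'n). apply_bcontfun g t)" for t
    by (intro lipschitz_on_continuous_on[of 1] lipschitz_onI) (auto intro: dist_bounded)
  have ev_meas [measurable]: "(\<lambda>g :: real \<Rightarrow>\<^sub>C (real^'n). apply_bcontfun g t) \<in> borel_measurable borel" for t
    by (rule borel_measurable_continuous_onI[OF ev_cont])
  define \<mu> where "\<mu> = density lborel (\<lambda>x. ennreal (dens T x))"
  have [measurable]: "dens T \<in> borel_measurable borel" using dens_mass(1)[of T] T_pos by auto
  have sets_\<mu> [measurable_cong, simp]: "sets \<mu> = sets borel" by (simp add: \<mu>_def)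
  interpret \<mu>: prob_space \<mu>
    using dens_mass(2)[of T] T_pos by (intro prob_spaceI) (simp add: \<mu>_def emeasure_density)
  define P where "P = distr \<mu> (borel \<Otimes>\<^sub>M borel) (\<lambda>y. (y, \<Gamma> y))"
  have graph_meas [measurable]: "(\<lambda>y. (y, \<Gamma> y)) \<in> measurable \<mu> (borel \<Otimes>\<^sub>M borel)"
    by (intro measurable_Pair) measurable
  \<comment> \<open>The path space is not separable, so the graph of \<open>\<Gamma>\<close> is not obviously measurable for the
    product \<open>\<sigma>\<close>-algebra; testing paths at rational times only makes it so.\<close>
  have AE_graph: "AE z in P. snd z = \<Gamma> (fst z)"
  proof -
    have m: "{z \<in> space (borel \<Otimes>\<^sub>M borel). apply_bcontfun (snd z) r = apply_bcontfun (\<Gamma> (fst z)) r} \<in> sets (borel \<Otimes>\<^sub>M borel)" for r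
      by (intro sets_Collect_eq_vec measurable_compose[OF measurable_snd ev_meas]
          measurable_compose[OF measurable_compose[OF measurable_fst \<Gamma>_meas] ev_meas])
    have r: "AE z in P. apply_bcontfun (snd z) r = apply_bcontfun (\<Gamma> (fst z)) r" for r
      unfolding P_def by (rule AE_distr_iff[OF graph_meas m, THEN iffD2]) simp
    have "AE z in P. \<forall>r\<in>\<rat>. apply_bcontfun (snd z) r = apply_bcontfun (\<Gamma> (fst z)) r"
      by (rule AE_ball_countable[OF countable_rat, THEN iffD2]) (use r in blast)
    then show ?thesis
    proof eventually_elim
      case (elim z)
      show ?case
      proof (rule bcontfun_eqI)
        fix t
        have "closed {r. apply_bcontfun (snd z) r = apply_bcontfun (\<Gamma> (fst z)) r}"
          by (intro closed_Collect_eq) auto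
        then have "closure \<rat> \<subseteq> {r. apply_bcontfun (snd z) r = apply_bcontfun (\<Gamma> (fst z)) r}"
          using elim by (intro closure_minimal) auto
        then show "apply_bcontfun (snd z) t = apply_bcontfun (\<Gamma> (fst z)) t"
          using Rats_closure_real by auto
      qed
    qed
  qed
  show "\<exists>P :: ((real^'n) \<times> (real \<Rightarrow>\<^sub>C (real^'n))) measure.
       prob_space P \<and>
       sets P = sets (borel \<Otimes>\<^sub>M borel) \<and>
       (AE (y, \<gamma>) in P.
          (\<forall>t. apply_bcontfun \<gamma> t = apply_bcontfun \<gamma> (max 0 (min (T - \<epsilon>) t))) \<and>
          abs_cont_on (apply_bcontfun \<gamma>) 0 (T - \<epsilon>) \<and>
          apply_bcontfun \<gamma> 0 = y \<and>
          (AE t in lborel. t \<in> {0..T - \<epsilon>} \<longrightarrow>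
             (apply_bcontfun \<gamma> has_vector_derivative
                (- (A *v apply_bcontfun \<gamma> t) + B *v policy A B p0 T t (apply_bcontfun \<gamma> t)))
             (at t))) \<and>
       (\<forall>t \<in> {0..T - \<epsilon>}.
          distr P lborel (\<lambda>(y, \<gamma>). apply_bcontfun \<gamma> t) =
          density lborel (\<lambda>x. ennreal (fwd_density A B p0 (T - t) x)))"
    unfolding \<tau>_def[symmetric]
  proof (intro exI[of _ P] conjI ballI)
    show "prob_space P" unfolding P_def by (rule \<mu>.prob_space_distr[OF graph_meas])
    show "sets P = sets (borel \<Otimes>\<^sub>M borel)" by (simp add: P_def)
    have path: "(\<forall>t. apply_bcontfun (\<Gamma> y) t = apply_bcontfun (\<Gamma> y) (max 0 (min \<tau> t))) \<and>
          abs_cont_on (apply_bcontfun (\<Gamma> y)) 0 \<tau> \<and> apply_bcontfun (\<Gamma> y) 0 = y \<and>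
          (AE t in lborel. t \<in> {0..\<tau>} \<longrightarrow>
             (apply_bcontfun (\<Gamma> y) has_vector_derivative
                (- (A *v apply_bcontfun (\<Gamma> y) t) + B *v policy A B p0 T t (apply_bcontfun (\<Gamma> y) t))) (at t))" for y
    proof (intro conjI allI)
      show "apply_bcontfun (\<Gamma> y) t = apply_bcontfun (\<Gamma> y) (max 0 (min \<tau> t))" for t
        using \<tau> by (simp add: \<Gamma>)
      show "apply_bcontfun (\<Gamma> y) 0 = y" using \<Gamma>_in[of 0 y] \<tau> X_0 by simp
      have "continuous_on {0..\<tau>} (\<lambda>t. (\<lambda>(t, x). ?v t x) (t, X y t))"
        by (rule continuous_on_compose2[OF E.v_cont]) (auto intro!: continuous_intros X_cont)
      then have "\<exists>C>0. \<forall>t\<in>{0..\<tau>}. norm ((\<lambda>(t, x). ?v t x) (t, X y t)) \<le> C"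
        by (intro bounded_on_compact) auto
      then obtain C where C: "C > 0" "\<And>t. t \<in> {0..\<tau>} \<Longrightarrow> norm (?v t (X y t)) \<le> C" by auto
      show "abs_cont_on (apply_bcontfun (\<Gamma> y)) 0 \<tau>"
      proof (rule abs_cont_on_lipschitz[OF _ C(1)])
        fix s t assume st: "s \<in> {0..\<tau>}" "t \<in> {0..\<tau>}" "s \<le> t"
        have "norm (X y t - X y s) \<le> C * (t - s)"
          using solves_ode_subset[OF X_sol[of y], of s t] st
          by (intro vector_derivative_bound[where f' = "\<lambda>t. ?v t (X y t)"] C(2)) (auto simp: solves_ode_def)
        then show "norm (apply_bcontfun (\<Gamma> y) t - apply_bcontfun (\<Gamma> y) s) \<le> C * (t - s)"
          using st by (simp add: \<Gamma>_in)
      qed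
      have der: "(apply_bcontfun (\<Gamma> y) has_vector_derivative
          (- (A *v apply_bcontfun (\<Gamma> y) t) + B *v policy A B p0 T t (apply_bcontfun (\<Gamma> y) t))) (at t)"
        if t: "0 < t" "t < \<tau>" for t
      proof -
        have "(X y has_vector_derivative ?v t (X y t)) (at t)"
          using X_sol[of y, unfolded solves_ode_def, rule_format, of t] t
          by (simp add: at_within_Icc_at)
        then have "(apply_bcontfun (\<Gamma> y) has_vector_derivative ?v t (X y t)) (at t)"
          by (rule has_vector_derivative_transform_within_open[of _ _ _ "{0<..<\<tau>}"]) (use t in \<open>auto simp: \<Gamma>_in\<close>)
        moreover have "?v t (X y t) = - (A *v X y t) + B *v policy A B p0 T t (X y t)"
          using t \<tau> by (intro reverse_drift[symmetric]) auto
        ultimately show ?thesis using t by (simp add: \<Gamma>_in)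
      qed
      show "AE t in lborel. t \<in> {0..\<tau>} \<longrightarrow>
             (apply_bcontfun (\<Gamma> y) has_vector_derivative
                (- (A *v apply_bcontfun (\<Gamma> y) t) + B *v policy A B p0 T t (apply_bcontfun (\<Gamma> y) t))) (at t)"
        using AE_lborel_singleton[of "0::real"] AE_lborel_singleton[of \<tau>]
      proof eventually_elim
        case (elim t)
        then show ?case using der[of t] by auto
      qed
    qed
    show "AE (y, \<gamma>) in P.
          (\<forall>t. apply_bcontfun \<gamma> t = apply_bcontfun \<gamma> (max 0 (min \<tau> t))) \<and>
          abs_cont_on (apply_bcontfun \<gamma>) 0 \<tau> \<and> apply_bcontfun \<gamma> 0 = y \<and>
          (AE t in lborel. t \<in> {0..\<tau>} \<longrightarrow>
             (apply_bcontfun \<gamma> has_vector_derivative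
                (- (A *v apply_bcontfun \<gamma> t) + B *v policy A B p0 T t (apply_bcontfun \<gamma> t))) (at t))"
      using AE_graph
    proof eventually_elim
      case (elim z)
      then show ?case using path[of "fst z"] by (cases z) simp
    qed
    fix t assume t: "t \<in> {0..\<tau>}"
    \<comment> \<open>With horizon \<open>t\<close> the density at time \<open>t\<close> becomes the
      terminal one. Uniqueness identifies this flow at time \<open>t\<close> with the trajectory
      \<open>X\<close>, although each flow was obtained by its own choice.\<close>
    interpret Et: continuity_equation ?v "\<lambda>t x. - b' (T - t) x" "\<lambda>t x. dens (T - t) x" ?q' t L
      by (rule CE[OF t])
    have X_t: "X y t = Et.flow 0 y t" for y
      using Et.flow_unique[OF solves_ode_subset[OF X_sol[of y]], of 0 t] t X_0 by simp
    have "distr P lborel (\<lambda>(y, \<gamma>). apply_bcontfun \<gamma> t) = distr \<mu> lborel (\<lambda>y. apply_bcontfun (\<Gamma> y) t)"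
      unfolding P_def by (subst distr_distr) (auto simp: o_def)
    also have "\<dots> = distr \<mu> borel (\<lambda>y. Et.flow 0 y t)"
      by (rule distr_cong) (auto simp: \<Gamma>_in[OF t] X_t)
    also have "\<dots> = density lborel (\<lambda>x. ennreal (dens (T - t) x))"
      using Et.pushforward_density dens_mass(1) dens_pos t \<tau> by (auto simp: \<mu>_def less_imp_le)
    also have "\<dots> = density lborel (\<lambda>x. ennreal (fwd_density A B p0 (T - t) x))"
      using t \<tau> by (simp add: fwd_density_eq)
    finally show "distr P lborel (\<lambda>(y, \<gamma>). apply_bcontfun \<gamma> t) =
          density lborel (\<lambda>x. ennreal (fwd_density A B p0 (T - t) x))" .
  qed
qed

end
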